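(* Let $X$ be an oriented odd $AB$-graph. The homology class $[\Phi(X)]\in H_*(\mathbf B_* )$ of the cycle $\Phi(X)$ is well defined: it is independent of the choice of the maximal tree $T$ of $X$, of the ordering $o_1$ of the type A vertices of $X$, and of the ordering $o_2$ of the edges of $X-T$ used to construct $\Phi(X)$.
   Context: Graphs are finite, with loops and multiple edges allowed; vector spaces are over $\mathbb Q$. **The chain complex $\mathbf B_*$.** A core graph is a graph with all vertices of valence at least $2$ and no separating edges (not necessarily connected). A filtered $r$-graph $\mathbf G$ is a connected graph $G$ with $\operatorname{rank}\pi_1(G)=r$ and all vertices of valence $\ge 3$, with a (possibly empty) chain $G_1\subsetneq\cdots\subsetneq G_{k-1}$ of proper core subgraphs of $G$; put $G_k=G$. An orientation is an ordering of the edges of $G$ up to even permutation. The degree is (number of edges of $G$) $-\,k$. $\mathbf B_*$ is the graded vector space spanned by isomorphism classes (isomorphisms preserve the filtration) of oriented filtered $r$-graphs modulo $(\mathbf G,-or)=-(\mathbf G,or)$. The differential is $d=d_E+d_F$ with $$d_F(\mathbf G)=\sum_C(-1)^{f(C)}\mathbf G\langle C\rangle,\qquad d_E(\mathbf G)=\sum_e(-1)^{n(e)+k-1}\mathbf G_e .$$ Here $C$ runs over all core subgraphs that can be inserted into the filtration, $\mathbf G\langle C\rangle$ is the result (same edge ordering), and $f(C)$ is the position of $C$ in the new filtration; $e$ runs over all edges whose collapse preserves both the rank of $G$ and the number of graphs in the filtration (so $e$ is not a loop and is not all of some $G_i-G_{i-1}$), $\mathbf G_e$ is the result of collapsing $e$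 (omit $e$ from the ordering), and $n(e)$ is the position of $e$ in the ordering. **$AB$-graphs.** An $AB$-graph is a connected graph with all vertices of valence $\ge3$, each vertex being designated type A or type B. It is odd if all type A vertices have odd valence. An orientation of an odd $AB$-graph is an ordering of the half-edges incident to each type A vertex; a reordering changes the orientation by the sign of the permutation. **Construction of $\Phi(X)$.** Choose a maximal tree $T$ of $X$, an ordering $o_1=(s_1,\dots,s_a)$ of the type A vertices, and an ordering $o_2=(e_1,\dots,e_k)$ of the edges of $X-T$. To each type A vertex $s$ of valence $v$ associate a $v$-gon $\Delta_s$ with edges ordered cyclically $1,\dots,v$, which gives an ordering $1,\dots,v$ of its vertices. Let $I_s$ be the set of bijections from the half-edges incident to $s$ to the vertices of $\Delta_s$; using the orientation of $X$ (ordering of the half-edges at $s$), $I_s$ is identified with permutations of $v$ letters, and $\epsilon(\iota)$ denotes the sign of $\iota\in I_s$. For $\iota_j\in I_{s_j}$, replace each type A vertex $s_j$ by the polygon $\Delta_{s_j}$, attaching the half-edges at $s_j$ to the vertices of $\Delta_{s_j}$ via $\iota_j$, and then collapse the image of $T$ (each component of it to a point), obtaining a graph $Y=Y[\iota_1,\dots,\iota_a]$. Orient $Y$ by listing the edges of $\Delta_{s_1}$, then those of $\Delta_{s_2}$, ..., $\Delta_{s_a}$ (each in its order), then $e_1,\dots,e_k$. Filter $Y$ by $$\Delta_{s_1}\subset\Delta_{s_1}\cup\Delta_{s_2}\subset\cdots\subset\Delta_{s_1}\cup\cdots\cup\Delta_{s_a}\subset\Delta_{s_1}\cup\cdots\cup\Delta_{s_a}\cup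 e_1\subset\cdots\subset\Delta_{s_1}\cup\cdots\cup\Delta_{s_a}\cup e_1\cup\cdots\cup e_k=Y.$$ Then $\Phi(X)=\sum_{\iota_j\in I_{s_j}}\epsilon(\iota_1)\cdots\epsilon(\iota_a)\,Y[\iota_1,\dots,\iota_a]$, where the sum is over all choices of $\iota_1,\dots,\iota_a$. This chain is a cycle of $\mathbf B_*$.
   Formalization: In d_E, an edge e is collapsed only if this also preserves the rank of every graph in the filtration (no G_i not containing e has a component containing both ends of e); with only the two conditions in parentheses, d² is not zero and B_* is not a chain complex. *)

theory Defs
  imports Complex_Main
    "HOL-Library.Poly_Mapping"
    "HOL-Library.FuncSet"
    "HOL-Combinatorics.Permutations"
begin

section \<open>Finite graphs with loops and multiple edges\<close>

text \<open>
  The half-edges of an edge \<open>e\<close> are \<open>(e, False)\<close> and \<open>(e, True)\<close>; \<open>ends G e b\<close> is the vertex at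
  which \<open>(e, b)\<close> is attached.  The direction that this gives to an edge carries no information:
  isomorphisms may reverse it.
\<close>

record ('v, 'e) graph =
  verts :: "'v set"
  edges :: "'e set"
  ends :: "'e \<Rightarrow> bool \<Rightarrow> 'v"

definition wf_graph :: "('v, 'e, 'z) graph_scheme \<Rightarrow> bool" where
  "wf_graph G \<longleftrightarrow> finite (verts G) \<and> finite (edges G) \<and> (\<forall>e\<in>edges G. \<forall>b. ends G e b \<in> verts G)"

definition half_edges :: "('v, 'e, 'z) graph_scheme \<Rightarrow> 'e set \<Rightarrow> 'v \<Rightarrow> ('e \<times> bool) set" where
  "half_edges G C v = {(e, b). e \<in> C \<and> ends G e b = v}"

definition valence :: "('v, 'e, 'z) graph_scheme \<Rightarrow> 'e set \<Rightarrow> 'v \<Rightarrow> nat" where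
  "valence G C v = card (half_edges G C v)"

text \<open>\<open>joined G C\<close> relates vertices that are connected by a path of edges in \<open>C\<close>.\<close>

definition joined :: "('v, 'e, 'z) graph_scheme \<Rightarrow> 'e set \<Rightarrow> ('v \<times> 'v) set" where
  "joined G C = {(ends G e b, ends G e (\<not> b)) | e b. e \<in> C}\<^sup>*"

definition connected_graph :: "('v, 'e, 'z) graph_scheme \<Rightarrow> bool" where
  "connected_graph G \<longleftrightarrow>
     verts G \<noteq> {} \<and> (\<forall>u\<in>verts G. \<forall>v\<in>verts G. (u, v) \<in> joined G (edges G))"

definition separating_edge :: "('v, 'e, 'z) graph_scheme \<Rightarrow> 'e set \<Rightarrow> 'e \<Rightarrow> bool" where
  "separating_edge G C e \<longleftrightarrow> (ends G e False, ends G e True) \<notin> joined G (C - {e})"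

text \<open>The rank of the (free) fundamental group of a connected graph.\<close>

definition rank :: "('v, 'e, 'z) graph_scheme \<Rightarrow> int" where
  "rank G = int (card (edges G)) - int (card (verts G)) + 1"

text \<open>
  A maximal tree is a spanning one; there is no cycle in \<open>T\<close> iff every edge of \<open>T\<close> separates \<open>T\<close>.
\<close>

definition maximal_tree :: "('v, 'e, 'z) graph_scheme \<Rightarrow> 'e set \<Rightarrow> bool" where
  "maximal_tree G T \<longleftrightarrow> T \<subseteq> edges G \<and>
     (\<forall>u\<in>verts G. \<forall>v\<in>verts G. (u, v) \<in> joined G T) \<and> (\<forall>e\<in>T. separating_edge G T e)"

text \<open>
  Collapsing a set \<open>F\<close> of edges: the vertices of the new graph are the vertex sets of the components
  of the graph with edge set \<open>F\<close> (and all vertices of \<open>G\<close>).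
\<close>

definition collapse :: "('v, 'e, 'z) graph_scheme \<Rightarrow> 'e set \<Rightarrow> ('v set, 'e) graph" where
  "collapse G F =
     \<lparr>verts = verts G // joined G F, edges = edges G - F, ends = (\<lambda>e b. joined G F `` {ends G e b})\<rparr>"

text \<open>
  All vertices of a core graph have positive valence, so core subgraphs are given by their edge sets.
  They are nonempty.
\<close>

definition core :: "('v, 'e, 'z) graph_scheme \<Rightarrow> 'e set \<Rightarrow> bool" where
  "core G C \<longleftrightarrow> C \<noteq> {} \<and> C \<subseteq> edges G \<and>
     (\<forall>e\<in>C. \<forall>b. 2 \<le> valence G C (ends G e b)) \<and> (\<forall>e\<in>C. \<not> separating_edge G C e)"


section \<open>Filtered graphs\<close>

text \<open>
  \<open>filt\<close> lists \<open>G\<^sub>1, \<dots>, G\<^sub>k\<^sub>-\<^sub>1\<close> (without \<open>G\<^sub>k = G\<close>); \<open>eord\<close> is an ordering of the edges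
  representing the orientation.
\<close>

record ('v, 'e) fgraph = "('v, 'e) graph" +
  filt :: "'e set list"
  eord :: "'e list"

definition stages :: "('v, 'e, 'z) fgraph_scheme \<Rightarrow> 'e set list" where
  "stages g = filt g @ [edges g]"

definition filtered_graph :: "int \<Rightarrow> ('v, 'e) fgraph \<Rightarrow> bool" where
  "filtered_graph r g \<longleftrightarrow>
     wf_graph g \<and> connected_graph g \<and> rank g = r \<and> (\<forall>v\<in>verts g. 3 \<le> valence g (edges g) v) \<and>
     (\<forall>C\<in>set (filt g). core g C) \<and> sorted_wrt (\<subset>) (stages g) \<and>
     distinct (eord g) \<and> set (eord g) = edges g"

definition fdegree :: "('v, 'e) fgraph \<Rightarrow> int" where
  "fdegree g = int (card (edges g)) - int (length (stages g))"

text \<open>\<open>reordering s xs ys\<close>: \<open>ys\<close> arises from \<open>xs\<close> by a permutation of sign \<open>s\<close>.\<close>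

definition reordering :: "int \<Rightarrow> 'a list \<Rightarrow> 'a list \<Rightarrow> bool" where
  "reordering s xs ys \<longleftrightarrow> (\<exists>p. p permutes {..<length xs} \<and> sign p = s \<and> ys = permute_list p xs)"

definition graph_iso :: "('v \<Rightarrow> 'w) \<Rightarrow> ('e \<Rightarrow> 'f) \<Rightarrow> ('v, 'e, 'y) graph_scheme \<Rightarrow>
    ('w, 'f, 'z) graph_scheme \<Rightarrow> bool" where
  "graph_iso \<phi> \<psi> G H \<longleftrightarrow> bij_betw \<phi> (verts G) (verts H) \<and> bij_betw \<psi> (edges G) (edges H) \<and>
     (\<forall>e\<in>edges G. (\<forall>b. ends H (\<psi> e) b = \<phi> (ends G e b)) \<or> (\<forall>b. ends H (\<psi> e) b = \<phi> (ends G e (\<not> b))))"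

definition filtered_iso :: "('v \<Rightarrow> 'w) \<Rightarrow> ('e \<Rightarrow> 'f) \<Rightarrow> ('v, 'e) fgraph \<Rightarrow> ('w, 'f) fgraph \<Rightarrow> bool" where
  "filtered_iso \<phi> \<psi> g h \<longleftrightarrow> graph_iso \<phi> \<psi> g h \<and> filt h = map (image \<psi>) (filt g)"

definition oriented_iso :: "('v, 'e) fgraph \<Rightarrow> ('w, 'f) fgraph \<Rightarrow> bool" where
  "oriented_iso g h \<longleftrightarrow>
     (\<exists>\<phi> \<psi>. filtered_iso \<phi> \<psi> g h \<and> reordering 1 (map \<psi> (eord g)) (eord h))"


section \<open>Oriented graphs modulo isomorphism and reversal of orientation\<close>

text \<open>
  Every finite graph is isomorphic to one whose vertices and edges are natural numbers.  Therefore the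
  space is constructed as a quotient of the free rational vector space on graphs of this kind.
  Only the conditions in \<open>wf_fgraph\<close>, which make orientations meaningful, are imposed at this stage;
  the subspaces spanned by filtered graphs are singled out in \<open>chains\<close> below.
\<close>

definition wf_fgraph :: "('v, 'e) fgraph \<Rightarrow> bool" where
  "wf_fgraph g \<longleftrightarrow> wf_graph g \<and> (\<forall>C\<in>set (filt g). C \<subseteq> edges g) \<and>
     distinct (eord g) \<and> set (eord g) = edges g"

lift_definition fscale :: "rat \<Rightarrow> ('a \<Rightarrow>\<^sub>0 rat) \<Rightarrow> ('a \<Rightarrow>\<^sub>0 rat)" is "\<lambda>r f x. r * f x"
  by (rule finite_subset[rotated]) auto

global_interpretation free: vector_space "fscale :: rat \<Rightarrow> ('a \<Rightarrow>\<^sub>0 rat) \<Rightarrow> ('a \<Rightarrow>\<^sub>0 rat)"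
  by unfold_locales (transfer; simp add: algebra_simps fun_eq_iff)+

definition relations :: "((nat, nat) fgraph \<Rightarrow>\<^sub>0 rat) set" where
  "relations = free.span
     ({Poly_Mapping.single g 1 - Poly_Mapping.single h 1 | g h.
         wf_fgraph g \<and> wf_fgraph h \<and> oriented_iso g h} \<union>
      {Poly_Mapping.single g 1 + Poly_Mapping.single (g\<lparr>eord := os\<rparr>) 1 | g os.
         wf_fgraph g \<and> reordering (-1) (eord g) os})"

quotient_type bchain = "(nat, nat) fgraph \<Rightarrow>\<^sub>0 rat" / "\<lambda>c c'. c - c' \<in> relations"
proof (rule equivpI)
  show "reflp (\<lambda>c c'. c - c' \<in> relations)"
    by (simp add: reflp_def relations_def free.span_zero)
  show "symp (\<lambda>c c'. c - c' \<in> relations)"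
    unfolding relations_def by (rule sympI) (drule free.span_neg, simp)
  show "transp (\<lambda>c c'. c - c' \<in> relations)"
    unfolding relations_def by (rule transpI) (drule (1) free.span_add, simp)
qed

instantiation bchain :: ab_group_add
begin
lift_definition zero_bchain :: bchain is 0 .
lift_definition plus_bchain :: "bchain \<Rightarrow> bchain \<Rightarrow> bchain" is "(+)"
  unfolding relations_def by (subst add_diff_add) (rule free.span_add)
lift_definition uminus_bchain :: "bchain \<Rightarrow> bchain" is uminus
  unfolding relations_def by (subst minus_diff_minus) (rule free.span_neg)
lift_definition minus_bchain :: "bchain \<Rightarrow> bchain \<Rightarrow> bchain" is "(-)"
proof -
  fix a a' b b' :: "(nat, nat) fgraph \<Rightarrow>\<^sub>0 rat"
  assume "a - a' \<in> relations" "b - b' \<in> relations"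
  then have "(a - a') - (b - b') \<in> relations"
    unfolding relations_def by (rule free.span_diff)
  then show "a - b - (a' - b') \<in> relations"
    by (simp add: algebra_simps)
qed
instance
proof
  fix a b c :: bchain
  show "a + b + c = a + (b + c)"
    by transfer (simp add: relations_def free.span_zero add.assoc)
  show "a + b = b + a"
    by transfer (simp add: relations_def free.span_zero add.commute)
  show "0 + a = a"
    by transfer (simp add: relations_def free.span_zero)
  show "- a + a = 0"
    by transfer (simp add: relations_def free.span_zero)
  show "a - b = a + - b"
    by transfer (simp add: relations_def free.span_zero)
qed
end

lift_definition qscale :: "rat \<Rightarrow> bchain \<Rightarrow> bchain" (infixr \<open>*\<^sub>Q\<close> 75) is fscale
  unfolding relations_def by (subst free.scale_right_diff_distrib[symmetric]) (rule free.span_scale)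

global_interpretation bchain: vector_space qscale
proof
  fix a b :: rat and x y :: bchain
  show "a *\<^sub>Q (x + y) = a *\<^sub>Q x + a *\<^sub>Q y"
    by transfer (simp add: relations_def free.span_zero free.scale_right_distrib)
  show "(a + b) *\<^sub>Q x = a *\<^sub>Q x + b *\<^sub>Q x"
    by transfer (simp add: relations_def free.span_zero free.scale_left_distrib)
  show "a *\<^sub>Q b *\<^sub>Q x = (a * b) *\<^sub>Q x"
    by transfer (simp add: relations_def free.span_zero)
  show "1 *\<^sub>Q x = x"
    by transfer (simp add: relations_def free.span_zero)
qed

lift_definition basis :: "(nat, nat) fgraph \<Rightarrow> bchain" is "\<lambda>g. Poly_Mapping.single g 1" .

text \<open>The element represented by an oriented graph with vertices and edges of arbitrary types.\<close>

definition gen :: "('v, 'e) fgraph \<Rightarrow> bchain" where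
  "gen g = basis (SOME h. oriented_iso g h)"


section \<open>The boundary map\<close>

text \<open>Positions are counted from 1.\<close>

definition position :: "'a \<Rightarrow> 'a list \<Rightarrow> nat" where
  "position x xs = Suc (length (takeWhile (\<lambda>y. y \<noteq> x) xs))"

definition insertable :: "('v, 'e) fgraph \<Rightarrow> 'e set \<Rightarrow> bool" where
  "insertable g C \<longleftrightarrow> core g C \<and> C \<subset> edges g \<and> (\<forall>F\<in>set (filt g). F \<subset> C \<or> C \<subset> F)"

definition insert_core :: "('v, 'e) fgraph \<Rightarrow> 'e set \<Rightarrow> ('v, 'e) fgraph" where
  "insert_core g C = g\<lparr>filt := filter (\<lambda>F. F \<subset> C) (filt g) @ C # filter (\<lambda>F. C \<subset> F) (filt g)\<rparr>"

text \<open>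
  An edge is collapsible if its collapse preserves the ranks of the graphs of the filtration as well
  as their number.  The rank of \<open>G\<close> is preserved iff \<open>e\<close> is not a loop, the number of graphs iff
  \<open>e\<close> is not all of some \<open>G\<^sub>i - G\<^sub>i\<^sub>-\<^sub>1\<close> (where \<open>G\<^sub>0\<close> is empty).  If \<open>G\<^sub>i\<close> does not contain \<open>e\<close> but has
  a component containing both ends of \<open>e\<close>, then collapsing \<open>e\<close> raises the rank of \<open>G\<^sub>i\<close>.  The last
  condition below excludes this; without it, the boundary map does not square to zero.
\<close>

definition collapsible :: "('v, 'e) fgraph \<Rightarrow> 'e \<Rightarrow> bool" where
  "collapsible g e \<longleftrightarrow> e \<in> edges g \<and> ends g e False \<noteq> ends g e True \<and>
     (\<forall>i < length (stages g). ({} # stages g) ! Suc i - ({} # stages g) ! i \<noteq> {e}) \<and>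
     (\<forall>F\<in>set (filt g). e \<notin> F \<longrightarrow> (ends g e False, ends g e True) \<notin> joined g F)"

definition collapse_edge :: "('v, 'e) fgraph \<Rightarrow> 'e \<Rightarrow> ('v set, 'e) fgraph" where
  "collapse_edge g e =
     (let Q = collapse g {e} in
      \<lparr>verts = verts Q, edges = edges Q, ends = ends Q,
       filt = map (\<lambda>F. F - {e}) (filt g), eord = filter (\<lambda>x. x \<noteq> e) (eord g)\<rparr>)"

definition boundary_F :: "('v, 'e) fgraph \<Rightarrow> bchain" where
  "boundary_F g =
     (\<Sum>C | insertable g C. (-1) ^ position C (filt (insert_core g C)) *\<^sub>Q gen (insert_core g C))"

definition boundary_E :: "('v, 'e) fgraph \<Rightarrow> bchain" where
  "boundary_E g =
     (\<Sum>e | collapsible g e.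
        (-1) ^ (position e (eord g) + length (stages g) - 1) *\<^sub>Q gen (collapse_edge g e))"


subsection \<open>Compatibility with isomorphisms and orientations\<close>

lemma reordering_refl: "reordering 1 xs xs"
  unfolding reordering_def by (rule exI[of _ id]) (auto simp: permutes_id)

lemma reordering_trans:
  assumes "reordering s xs ys" "reordering t ys zs"
  shows "reordering (s * t) xs zs"
proof -
  obtain p where p: "p permutes {..<length xs}" "sign p = s" "ys = permute_list p xs"
    using assms(1) unfolding reordering_def by auto
  obtain q where q: "q permutes {..<length xs}" "sign q = t" "zs = permute_list q ys"
    using assms(2) p(3) unfolding reordering_def by auto
  have "permutation p" "permutation q"
    using p(1) q(1) by (auto intro: permutes_imp_permutation)
  then have "sign (p \<circ> q) = s * t"
    using p(2) q(2) by (simp add: sign_compose)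
  moreover have "zs = permute_list (p \<circ> q) xs"
    using permute_list_compose[OF q(1)] q(3) p(3) by simp
  ultimately show ?thesis
    unfolding reordering_def using permutes_compose[OF q(1) p(1)] by blast
qed

lemma reordering_sym:
  assumes "reordering s xs ys"
  shows "reordering s ys xs"
proof -
  obtain p where p: "p permutes {..<length xs}" "sign p = s" "ys = permute_list p xs"
    using assms unfolding reordering_def by auto
  have i: "inv p permutes {..<length xs}"
    using p(1) by (rule permutes_inv)
  have "permute_list (inv p) ys = permute_list (p \<circ> inv p) xs"
    using permute_list_compose[OF i] p(3) by simp
  then have "xs = permute_list (inv p) ys"
    using permutes_inv_o(1)[OF p(1)] by simp
  moreover have "sign (inv p) = s"
    using p permutes_imp_permutation[OF finite_lessThan p(1)] by (simp add: sign_inverse)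
  ultimately show ?thesis
    unfolding reordering_def using i p(3) by (intro exI[of _ "inv p"]) simp
qed

lemma reordering_map: "reordering s xs ys \<Longrightarrow> reordering s (map f xs) (map f ys)"
  unfolding reordering_def by (metis length_map permute_list_map)

lemma reordering_mset: "reordering s xs ys \<Longrightarrow> mset ys = mset xs"
  unfolding reordering_def by auto

lemma reordering_exists:
  assumes "mset ys = mset xs"
  obtains s where "reordering s xs ys"
  using mset_eq_permutation[OF assms] unfolding reordering_def by metis

lemma reordering_sign: "reordering s xs ys \<Longrightarrow> s * s = 1"
  unfolding reordering_def by auto

lemma reordering_unique:
  assumes "distinct xs" "reordering s xs ys" "reordering t xs ys"
  shows "s = t"
proof -
  obtain p where p: "p permutes {..<length xs}" "sign p = s" "ys = permute_list p xs"
    using assms(2) unfolding reordering_def by auto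
  obtain q where q: "q permutes {..<length xs}" "sign q = t" "ys = permute_list q xs"
    using assms(3) unfolding reordering_def by auto
  have "p i = q i" for i
  proof (cases "i < length xs")
    case True
    have "xs ! p i = xs ! q i"
      using p q True by (metis permute_list_nth)
    moreover have "p i < length xs" "q i < length xs"
      using True permutes_in_image[OF p(1)] permutes_in_image[OF q(1)] by auto
    ultimately show ?thesis
      using assms(1) nth_eq_iff_index_eq by blast
  next
    case False
    then show ?thesis
      using permutes_not_in[OF p(1), of i] permutes_not_in[OF q(1), of i] by simp
  qed
  then show ?thesis
    using p q by (metis ext)
qed

lemma reordering_Cons:
  assumes "reordering s xs ys"
  shows "reordering s (x # xs) (x # ys)"
proof -
  obtain p where p: "p permutes {..<length xs}" "sign p = s" "ys = permute_list p xs"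
    using assms unfolding reordering_def by auto
  define q where "q = map_permutation {..<length xs} Suc p"
  have "q permutes Suc ` {..<length xs}"
    unfolding q_def by (rule map_permutation_permutes[OF _ p(1)]) (simp add: bij_betw_def)
  then have q: "q permutes {..<length (x # xs)}" "q 0 = 0"
    using permutes_subset[of q "Suc ` {..<length xs}" "{..<length (x # xs)}"]
      permutes_not_in[of q "Suc ` {..<length xs}" 0] by auto
  have qS: "q (Suc i) = Suc (p i)" if "i < length xs" for i
    unfolding q_def using that by (simp add: map_permutation_apply)
  have "sign q = s"
    unfolding q_def using p by (simp add: sign_map_permutation)
  moreover have "x # ys = permute_list q (x # xs)"
  proof (rule nth_equalityI)
    fix i assume "i < length (x # ys)"
    then have i: "i < length (x # xs)"
      using p(3) by simp
    have "permute_list q (x # xs) ! i = (x # xs) ! q i"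
      using permute_list_nth[OF q(1) i] .
    also have "\<dots> = (x # ys) ! i"
      using i p(3) q(2) qS permute_list_nth[OF p(1)] by (cases i) auto
    finally show "(x # ys) ! i = permute_list q (x # xs) ! i" ..
  qed (simp add: p(3))
  ultimately show ?thesis
    unfolding reordering_def using q(1) by blast
qed

lemma reordering_swap: "reordering (-1) (x # y # zs) (y # x # zs)"
proof -
  let ?p = "transpose 0 (1::nat)"
  have p: "?p permutes {..<length (x # y # zs)}"
    by (rule permutes_swap_id) auto
  have "y # x # zs = permute_list ?p (x # y # zs)"
  proof (rule nth_equalityI)
    fix i assume i: "i < length (y # x # zs)"
    then have "permute_list ?p (x # y # zs) ! i = (x # y # zs) ! ?p i"
      by (intro permute_list_nth[OF p]) simp
    also have "\<dots> = (y # x # zs) ! i"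
      by (cases i; cases "i - 1") (auto simp: transpose_def)
    finally show "(y # x # zs) ! i = permute_list ?p (x # y # zs) ! i" ..
  qed simp
  then show ?thesis
    unfolding reordering_def using p by (intro exI[of _ ?p]) (simp add: sign_swap_id)
qed

lemma reordering_front: "reordering ((-1) ^ length us) (us @ e # vs) (e # us @ vs)"
proof (induction us)
  case Nil
  show ?case by (simp add: reordering_refl)
next
  case (Cons u us)
  show ?case
    using reordering_trans[OF reordering_Cons[OF Cons, of u] reordering_swap] by simp
qed

lemma reordering_to_front:
  assumes "distinct xs" "e \<in> set xs"
  shows "reordering (- ((-1) ^ position e xs)) xs (e # filter (\<lambda>x. x \<noteq> e) xs)"
proof -
  obtain us vs where xs: "xs = us @ e # vs" "e \<notin> set us"
    using split_list_first[OF assms(2)] by blast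
  then have v: "e \<notin> set vs"
    using assms(1) by auto
  have "filter (\<lambda>x. x \<noteq> e) us = us" "filter (\<lambda>x. x \<noteq> e) vs = vs"
    using xs(2) v by (auto simp: filter_id_conv)
  moreover have "takeWhile (\<lambda>y. y \<noteq> e) xs = us"
    using xs by (simp add: takeWhile_append)
  ultimately show ?thesis
    using reordering_front[of us e vs] xs(1) by (simp add: position_def)
qed

lemma reordering_remove:
  assumes "distinct xs" "e \<in> set xs" "reordering s xs ys"
  shows "reordering (s * (-1) ^ (position e xs + position e ys))
           (filter (\<lambda>x. x \<noteq> e) xs) (filter (\<lambda>x. x \<noteq> e) ys)"
proof -
  let ?f = "filter (\<lambda>x. x \<noteq> e)"
  have ms: "mset ys = mset xs"
    using assms(3) by (rule reordering_mset)
  then have ys: "distinct ys" "e \<in> set ys"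
    using assms(1,2) by (metis distinct_count_atmost_1 mset_eq_setD, metis mset_eq_setD)
  obtain t where t: "reordering t (?f xs) (?f ys)"
    using ms by (metis mset_filter reordering_exists)
  have "reordering (- ((-1) ^ position e xs) * t * - ((-1) ^ position e ys)) xs ys"
    by (intro reordering_trans[OF reordering_trans[OF reordering_to_front[OF assms(1,2)]
          reordering_Cons[OF t]]] reordering_sym[OF reordering_to_front[OF ys]])
  from reordering_unique[OF assms(1,3) this]
  have "s = (-1) ^ position e xs * (-1) ^ position e ys * t"
    by simp
  moreover have "((-1) ^ position e xs * (-1) ^ position e ys) *
      ((-1) ^ position e xs * (-1) ^ position e ys) = (1::int)"
    by (simp flip: power_add power_mult_distrib)
  ultimately have "t = s * (-1) ^ (position e xs + position e ys)"
    by (simp add: power_add algebra_simps)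
  then show ?thesis
    using t by simp
qed

definition signed_iso :: "int \<Rightarrow> ('v, 'e) fgraph \<Rightarrow> ('w, 'f) fgraph \<Rightarrow> bool" where
  "signed_iso s g h \<longleftrightarrow>
     (\<exists>\<phi> \<psi>. filtered_iso \<phi> \<psi> g h \<and> reordering s (map \<psi> (eord g)) (eord h))"

lemma oriented_iso_signed: "oriented_iso g h \<longleftrightarrow> signed_iso 1 g h"
  unfolding oriented_iso_def signed_iso_def ..

lemma graph_iso_ends:
  assumes "graph_iso \<phi> \<psi> G H" "e \<in> edges G"
  obtains (straight) "\<And>b. ends H (\<psi> e) b = \<phi> (ends G e b)"
  | (flipped) "\<And>b. ends H (\<psi> e) b = \<phi> (ends G e (\<not> b))"
  using assms unfolding graph_iso_def by blast

lemma graph_iso_comp: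
  assumes 1: "graph_iso \<phi> \<psi> G H" and 2: "graph_iso \<phi>' \<psi>' H K"
  shows "graph_iso (\<phi>' \<circ> \<phi>) (\<psi>' \<circ> \<psi>) G K"
proof -
  have "(\<forall>b. ends K ((\<psi>' \<circ> \<psi>) e) b = (\<phi>' \<circ> \<phi>) (ends G e b)) \<or>
      (\<forall>b. ends K ((\<psi>' \<circ> \<psi>) e) b = (\<phi>' \<circ> \<phi>) (ends G e (\<not> b)))" if e: "e \<in> edges G" for e
  proof -
    have h: "\<psi> e \<in> edges H"
      using 1 e unfolding graph_iso_def bij_betw_def by auto
    show ?thesis
      by (rule graph_iso_ends[OF 1 e]; rule graph_iso_ends[OF 2 h]) simp_all
  qed
  moreover have "bij_betw (\<phi>' \<circ> \<phi>) (verts G) (verts K)" "bij_betw (\<psi>' \<circ> \<psi>) (edges G) (edges K)"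
    using 1 2 bij_betw_trans unfolding graph_iso_def by blast+
  ultimately show ?thesis
    unfolding graph_iso_def by blast
qed

lemma graph_iso_inv:
  assumes "graph_iso \<phi> \<psi> G H" "wf_graph G"
  shows "graph_iso (inv_into (verts G) \<phi>) (inv_into (edges G) \<psi>) H G"
proof -
  let ?f = "inv_into (verts G) \<phi>" and ?p = "inv_into (edges G) \<psi>"
  have b: "bij_betw \<phi> (verts G) (verts H)" "bij_betw \<psi> (edges G) (edges H)"
    using assms(1) unfolding graph_iso_def by auto
  have "(\<forall>b. ends G (?p e) b = ?f (ends H e b)) \<or> (\<forall>b. ends G (?p e) b = ?f (ends H e (\<not> b)))"
    if e: "e \<in> edges H" for e
  proof -
    have p: "?p e \<in> edges G" "\<psi> (?p e) = e"
      using b(2) e by (auto simp: bij_betw_def inv_into_into f_inv_into_f)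
    have v: "?f (\<phi> (ends G (?p e) b)) = ends G (?p e) b" for b
      using assms(2) p(1) b(1) unfolding wf_graph_def by (simp add: bij_betw_inv_into_left)
    show ?thesis
      using assms(1) p(1) by (rule graph_iso_ends) (simp_all add: p(2) v)
  qed
  then show ?thesis
    unfolding graph_iso_def using b by (auto intro: bij_betw_inv_into)
qed

lemma signed_iso_trans:
  assumes "signed_iso s g h" "signed_iso t h k"
  shows "signed_iso (s * t) g k"
proof -
  obtain \<phi> \<psi> where 1: "filtered_iso \<phi> \<psi> g h" "reordering s (map \<psi> (eord g)) (eord h)"
    using assms(1) unfolding signed_iso_def by auto
  obtain \<phi>' \<psi>' where 2: "filtered_iso \<phi>' \<psi>' h k" "reordering t (map \<psi>' (eord h)) (eord k)"
    using assms(2) unfolding signed_iso_def by auto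
  have "filtered_iso (\<phi>' \<circ> \<phi>) (\<psi>' \<circ> \<psi>) g k"
    using 1(1) 2(1) unfolding filtered_iso_def by (auto intro: graph_iso_comp simp: image_comp)
  moreover have "reordering (s * t) (map (\<psi>' \<circ> \<psi>) (eord g)) (eord k)"
    using reordering_trans[OF reordering_map[OF 1(2), of \<psi>'] 2(2)] by simp
  ultimately show ?thesis
    unfolding signed_iso_def by blast
qed

lemma signed_iso_sym:
  assumes "wf_fgraph g" "signed_iso s g h"
  shows "signed_iso s h g"
proof -
  obtain \<phi> \<psi> where 1: "filtered_iso \<phi> \<psi> g h" "reordering s (map \<psi> (eord g)) (eord h)"
    using assms(2) unfolding signed_iso_def by auto
  let ?f = "inv_into (verts g) \<phi>" and ?p = "inv_into (edges g) \<psi>"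
  have inj: "inj_on \<psi> (edges g)"
    using 1(1) unfolding filtered_iso_def graph_iso_def bij_betw_def by auto
  have g: "wf_graph g" "\<forall>C\<in>set (filt g). C \<subseteq> edges g" "set (eord g) = edges g"
    using assms(1) unfolding wf_fgraph_def by auto
  have "filt g = map (image ?p) (filt h)"
    using 1(1) g(2) inj unfolding filtered_iso_def
    by (auto simp: comp_def map_idI)
  moreover have "map ?p (map \<psi> (eord g)) = eord g"
    using inj g(3) by (auto simp: comp_def intro: map_idI)
  then have "reordering s (map ?p (eord h)) (eord g)"
    using reordering_sym[OF reordering_map[OF 1(2), of ?p]] by simp
  ultimately show ?thesis
    using graph_iso_inv[of \<phi> \<psi> g h] 1(1) g(1) unfolding signed_iso_def filtered_iso_def by blast
qed

lemma signed_iso_wf: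
  assumes "wf_fgraph g" "signed_iso s g h"
  shows "wf_fgraph h"
proof -
  obtain \<phi> \<psi> where 1: "filtered_iso \<phi> \<psi> g h" "reordering s (map \<psi> (eord g)) (eord h)"
    using assms(2) unfolding signed_iso_def by auto
  have b: "bij_betw \<phi> (verts g) (verts h)" "bij_betw \<psi> (edges g) (edges h)"
    "filt h = map (image \<psi>) (filt g)"
    using 1(1) unfolding filtered_iso_def graph_iso_def by auto
  have g: "wf_graph g" "\<forall>C\<in>set (filt g). C \<subseteq> edges g" "distinct (eord g)" "set (eord g) = edges g"
    using assms(1) unfolding wf_fgraph_def by simp_all
  have "ends h e c \<in> verts h" if "e \<in> edges h" for e c
  proof -
    have "e \<in> \<psi> ` edges g"
      using bij_betw_imp_surj_on[OF b(2)] that by simp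
    then obtain e' where e': "e' \<in> edges g" "e = \<psi> e'"
      by (elim imageE)
    have v: "\<phi> (ends g e' c') \<in> verts h" for c'
      using bij_betwE[OF b(1)] e'(1) g(1) unfolding wf_graph_def by simp
    have "graph_iso \<phi> \<psi> g h"
      using 1(1) unfolding filtered_iso_def by auto
    then show ?thesis
      using e'(1) by (rule graph_iso_ends) (simp_all add: e'(2) v)
  qed
  moreover have "finite (verts h)" "finite (edges h)"
    using g(1) bij_betw_finite[OF b(1)] bij_betw_finite[OF b(2)] unfolding wf_graph_def by simp_all
  ultimately have "wf_graph h"
    unfolding wf_graph_def by simp
  moreover have "\<forall>C\<in>set (filt h). C \<subseteq> edges h"
    using g(2) b(3) bij_betw_imp_surj_on[OF b(2)] by auto
  moreover have ms: "mset (eord h) = mset (map \<psi> (eord g))"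
    using 1(2) by (rule reordering_mset)
  have "set (eord h) = edges h"
    using mset_eq_setD[OF ms] g(4) bij_betw_imp_surj_on[OF b(2)] by simp
  moreover have "distinct (map \<psi> (eord g))"
    using g(3,4) bij_betw_imp_inj_on[OF b(2)] by (simp add: distinct_map)
  then have "distinct (eord h)"
    using mset_eq_imp_distinct_iff[OF ms] by simp
  ultimately show ?thesis
    unfolding wf_fgraph_def by simp
qed

lemma nat_model_exists:
  assumes "wf_fgraph g"
  shows "\<exists>h::(nat, nat) fgraph. oriented_iso g h"
proof -
  have fin: "finite (verts g)" "finite (edges g)"
    using assms unfolding wf_fgraph_def wf_graph_def by auto
  obtain \<phi> :: "'a \<Rightarrow> nat" where \<phi>: "inj_on \<phi> (verts g)"
    using finite_imp_inj_to_nat_seg[OF fin(1)] by auto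
  obtain \<psi> :: "'b \<Rightarrow> nat" where \<psi>: "inj_on \<psi> (edges g)"
    using finite_imp_inj_to_nat_seg[OF fin(2)] by auto
  let ?h = "\<lparr>verts = \<phi> ` verts g, edges = \<psi> ` edges g,
     ends = (\<lambda>e b. \<phi> (ends g (inv_into (edges g) \<psi> e) b)),
     filt = map (image \<psi>) (filt g), eord = map \<psi> (eord g)\<rparr>"
  have "filtered_iso \<phi> \<psi> g ?h"
    using \<phi> \<psi> unfolding filtered_iso_def graph_iso_def by (auto simp: bij_betw_def)
  then show ?thesis
    unfolding oriented_iso_def using reordering_refl[of "map \<psi> (eord g)"]
    by (intro exI[of _ ?h] exI[of _ \<phi>] exI[of _ \<psi>]) simp
qed

lemma basis_iso:
  assumes "wf_fgraph g" "oriented_iso g h"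
  shows "basis g = basis h"
proof -
  have "wf_fgraph h"
    using assms signed_iso_wf oriented_iso_signed by blast
  then have "Poly_Mapping.single g 1 - Poly_Mapping.single h 1 \<in> relations"
    unfolding relations_def using assms by (intro free.span_base) blast
  then show ?thesis
    by transfer
qed

lemma basis_reverse:
  assumes "wf_fgraph g" "reordering (-1) (eord g) os"
  shows "basis (g\<lparr>eord := os\<rparr>) = - basis g"
proof -
  have "Poly_Mapping.single g 1 + Poly_Mapping.single (g\<lparr>eord := os\<rparr>) 1 \<in> relations"
    unfolding relations_def using assms by (intro free.span_base) blast
  then show ?thesis
    by transfer (simp add: add.commute)
qed

lemma gen_eq_basis:
  assumes "wf_fgraph g" "oriented_iso g h"
  shows "gen g = basis h"
proof -
  define k :: "(nat, nat) fgraph" where "k = (SOME k. oriented_iso g k)"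
  have k: "oriented_iso g k"
    unfolding k_def using nat_model_exists[OF assms(1)] by (rule someI_ex)
  then have "signed_iso (1 * 1) k h"
    using assms signed_iso_sym signed_iso_trans oriented_iso_signed by metis
  moreover have "wf_fgraph k"
    using assms(1) k signed_iso_wf oriented_iso_signed by blast
  ultimately have "basis k = basis h"
    by (intro basis_iso) (simp_all add: oriented_iso_signed)
  then show ?thesis
    unfolding gen_def k_def .
qed

lemma gen_signed_iso:
  fixes g :: "('v, 'e) fgraph" and h :: "('w, 'f) fgraph"
  assumes g: "wf_fgraph g" and i: "signed_iso s g h"
  shows "gen h = of_int s *\<^sub>Q gen g"
proof -
  have h: "wf_fgraph h"
    using signed_iso_wf[OF g i] .
  obtain k :: "(nat, nat) fgraph" where k: "oriented_iso h k"
    using nat_model_exists[OF h] by blast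
  have gk: "signed_iso s g k"
    using signed_iso_trans[OF i, of 1 k] k by (simp add: oriented_iso_signed)
  then obtain \<phi> \<psi> where 1: "filtered_iso \<phi> \<psi> g k" "reordering s (map \<psi> (eord g)) (eord k)"
    unfolding signed_iso_def by auto
  define k' where "k' = k\<lparr>eord := map \<psi> (eord g)\<rparr>"
  have "filtered_iso \<phi> \<psi> g k'"
    using 1(1) unfolding filtered_iso_def graph_iso_def k'_def by simp
  then have gk': "oriented_iso g k'"
    unfolding oriented_iso_def using reordering_refl[of "map \<psi> (eord g)"] by (auto simp: k'_def)
  have k'_wf: "wf_fgraph k'"
    using g gk' signed_iso_wf oriented_iso_signed by blast
  have kk: "k = k'\<lparr>eord := eord k\<rparr>" "eord k' = map \<psi> (eord g)"
    by (simp_all add: k'_def)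
  have "s = 1 \<or> s = -1"
    using reordering_sign[OF 1(2)] by (simp add: square_eq_1_iff)
  then have "basis k = of_int s *\<^sub>Q basis k'"
  proof
    assume "s = 1"
    then have "signed_iso 1 k g"
      using g gk signed_iso_sym by blast
    then have "oriented_iso k k'"
      using gk' signed_iso_trans[of 1 k g 1 k'] by (simp add: oriented_iso_signed)
    then show ?thesis
      using basis_iso[of k k'] signed_iso_wf[OF g gk] \<open>s = 1\<close> by simp
  next
    assume "s = -1"
    then show ?thesis
      using basis_reverse[OF k'_wf, of "eord k"] 1(2) kk by simp
  qed
  then show ?thesis
    using gen_eq_basis[OF h k] gen_eq_basis[OF g gk'] by simp
qed

lemma joined_sym:
  assumes "(u, v) \<in> joined G F"
  shows "(v, u) \<in> joined G F"
proof -
  have "sym {(ends G e b, ends G e (\<not> b)) | e b. e \<in> F}"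
  proof (rule symI)
    fix x y assume "(x, y) \<in> {(ends G e b, ends G e (\<not> b)) | e b. e \<in> F}"
    then obtain e b where "e \<in> F" "x = ends G e b" "y = ends G e (\<not> b)"
      by blast
    then show "(y, x) \<in> {(ends G e b, ends G e (\<not> b)) | e b. e \<in> F}"
      by (intro CollectI exI[of _ e] exI[of _ "\<not> b"]) simp
  qed
  then have "sym (joined G F)"
    unfolding joined_def by (rule sym_rtrancl)
  then show ?thesis
    using assms by (rule symD)
qed

lemma joined_iso_imp:
  assumes "graph_iso \<phi> \<psi> G H" "F \<subseteq> edges G" "(u, v) \<in> joined G F"
  shows "(\<phi> u, \<phi> v) \<in> joined H (\<psi> ` F)"
  using assms(3) unfolding joined_def
proof (induction rule: rtrancl_induct)
  case (step y z)
  then obtain e b where e: "e \<in> F" "y = ends G e b" "z = ends G e (\<not> b)"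
    by auto
  then have "e \<in> edges G"
    using assms(2) by auto
  with assms(1) have "\<exists>c. \<phi> y = ends H (\<psi> e) c \<and> \<phi> z = ends H (\<psi> e) (\<not> c)"
  proof (cases rule: graph_iso_ends)
    case straight
    then show ?thesis using e(2,3) by (intro exI[of _ b]) simp
  next
    case flipped
    then show ?thesis using e(2,3) by (intro exI[of _ "\<not> b"]) simp
  qed
  then have "(\<phi> y, \<phi> z) \<in> {(ends H e b, ends H e (\<not> b)) | e b. e \<in> \<psi> ` F}"
    using e(1) by blast
  with step.IH show ?case
    by (rule rtrancl_into_rtrancl)
qed simp

lemma joined_iso:
  assumes i: "graph_iso \<phi> \<psi> G H" and w: "wf_graph G" and F: "F \<subseteq> edges G"
    and uv: "u \<in> verts G" "v \<in> verts G"
  shows "(\<phi> u, \<phi> v) \<in> joined H (\<psi> ` F) \<longleftrightarrow> (u, v) \<in> joined G F"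
proof
  let ?f = "inv_into (verts G) \<phi>" and ?p = "inv_into (edges G) \<psi>"
  have b: "bij_betw \<phi> (verts G) (verts H)" "bij_betw \<psi> (edges G) (edges H)"
    using i unfolding graph_iso_def by auto
  assume "(\<phi> u, \<phi> v) \<in> joined H (\<psi> ` F)"
  moreover have "\<psi> ` F \<subseteq> edges H"
    using b(2) F unfolding bij_betw_def by auto
  ultimately have "(?f (\<phi> u), ?f (\<phi> v)) \<in> joined G (?p ` \<psi> ` F)"
    using joined_iso_imp[OF graph_iso_inv[OF i w]] by blast
  moreover have "?p ` \<psi> ` F = F"
    using b(2) F unfolding bij_betw_def by auto
  ultimately show "(u, v) \<in> joined G F"
    using b(1) uv by (simp add: bij_betw_inv_into_left)
qed (rule joined_iso_imp[OF i F])

lemma joined_ends_iso: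
  assumes i: "graph_iso \<phi> \<psi> G H" and w: "wf_graph G" and F: "F \<subseteq> edges G" and e: "e \<in> edges G"
  shows "(ends H (\<psi> e) False, ends H (\<psi> e) True) \<in> joined H (\<psi> ` F) \<longleftrightarrow>
    (ends G e False, ends G e True) \<in> joined G F"
proof -
  have v: "ends G e b \<in> verts G" for b
    using w e unfolding wf_graph_def by auto
  have "(\<forall>b. ends H (\<psi> e) b = \<phi> (ends G e b)) \<or> (\<forall>b. ends H (\<psi> e) b = \<phi> (ends G e (\<not> b)))"
    using i e unfolding graph_iso_def by auto
  then show ?thesis
    using joined_iso[OF i w F v v, of False True] joined_iso[OF i w F v v, of True False]
      joined_sym[of _ _ G F] by auto
qed

lemma graph_iso_inj_verts:
  assumes "graph_iso \<phi> \<psi> G H" "u \<in> verts G" "v \<in> verts G"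
  shows "\<phi> u = \<phi> v \<longleftrightarrow> u = v"
  using assms bij_betw_imp_inj_on inj_on_eq_iff unfolding graph_iso_def by metis

lemma ends_eq_iso:
  assumes i: "graph_iso \<phi> \<psi> G H" and w: "wf_graph G" and e: "e \<in> edges G"
  shows "ends H (\<psi> e) False = ends H (\<psi> e) True \<longleftrightarrow> ends G e False = ends G e True"
proof -
  have v: "ends G e b \<in> verts G" for b
    using w e unfolding wf_graph_def by simp
  note inj = graph_iso_inj_verts[OF i v v]
  show ?thesis
    using i e by (rule graph_iso_ends) (simp_all add: inj eq_commute)
qed

lemma valence_iso:
  assumes i: "graph_iso \<phi> \<psi> G H" and w: "wf_graph G" and C: "C \<subseteq> edges G" and v: "v \<in> verts G"
  shows "valence H (\<psi> ` C) (\<phi> v) = valence G C v"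
proof -
  define s where "s e \<longleftrightarrow> (\<forall>b. ends H (\<psi> e) b = \<phi> (ends G e b))" for e
  let ?t = "\<lambda>(e, b). (\<psi> e, if s e then b else \<not> b)"
  have inj: "inj_on \<psi> C"
    using i C unfolding graph_iso_def bij_betw_def by (auto intro: inj_on_subset)
  have inj_v: "\<phi> x = \<phi> v \<longleftrightarrow> x = v" if "x \<in> verts G" for x
    using graph_iso_inj_verts[OF i that v] .
  have t: "ends H (\<psi> e) (if s e then b else \<not> b) = \<phi> (ends G e b)" "ends G e b \<in> verts G"
    if "e \<in> C" for e b
  proof -
    have e: "e \<in> edges G"
      using that C by auto
    then show "ends G e b \<in> verts G"
      using w unfolding wf_graph_def by auto
    show "ends H (\<psi> e) (if s e then b else \<not> b) = \<phi> (ends G e b)"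
      using i e by (rule graph_iso_ends) (auto simp: s_def)
  qed
  have "bij_betw ?t (half_edges G C v) (half_edges H (\<psi> ` C) (\<phi> v))"
    unfolding bij_betw_def
  proof (intro conjI subset_antisym subsetI)
    show "inj_on ?t (half_edges G C v)"
      using inj unfolding inj_on_def half_edges_def by (auto split: if_splits)
    show "x \<in> half_edges H (\<psi> ` C) (\<phi> v)" if "x \<in> ?t ` half_edges G C v" for x
      using that t(1) unfolding half_edges_def by auto
    show "x \<in> ?t ` half_edges G C v" if x: "x \<in> half_edges H (\<psi> ` C) (\<phi> v)" for x
    proof -
      obtain e b where e: "x = (\<psi> e, b)" "e \<in> C" "ends H (\<psi> e) b = \<phi> v"
        using x unfolding half_edges_def by auto
      define c where "c = (if s e then b else \<not> b)"
      have c: "(if s e then c else \<not> c) = b"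
        by (simp add: c_def)
      have "\<phi> (ends G e c) = \<phi> v"
        using e(3) t(1)[OF e(2), of c] unfolding c by (rule trans[OF sym, rotated])
      then have "ends G e c = v"
        using inj_v[OF t(2)[OF e(2)]] by simp
      then have "(e, c) \<in> half_edges G C v"
        using e(2) unfolding half_edges_def by simp
      moreover have "x = ?t (e, c)"
        using e(1) c by simp
      ultimately show ?thesis
        by blast
    qed
  qed
  from bij_betw_same_card[OF this] show ?thesis
    by (simp add: valence_def)
qed

lemma core_iso:
  assumes i: "graph_iso \<phi> \<psi> G H" and w: "wf_graph G" and C: "C \<subseteq> edges G"
  shows "core H (\<psi> ` C) \<longleftrightarrow> core G C"
proof -
  have inj: "inj_on \<psi> (edges G)" and im: "\<psi> ` edges G = edges H"
    using i unfolding graph_iso_def bij_betw_def by auto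
  have "(\<forall>b. 2 \<le> valence H (\<psi> ` C) (ends H (\<psi> e) b)) \<longleftrightarrow> (\<forall>b. 2 \<le> valence G C (ends G e b))"
    if e: "e \<in> C" for e
  proof -
    have "ends G e b \<in> verts G" for b
      using w C e unfolding wf_graph_def by auto
    then have val: "valence H (\<psi> ` C) (\<phi> (ends G e b)) = valence G C (ends G e b)" for b
      using valence_iso[OF i w C] by blast
    have "e \<in> edges G"
      using C e by auto
    with i show ?thesis
    proof (cases rule: graph_iso_ends)
      case straight
      then show ?thesis by (simp add: val)
    next
      case flipped
      then show ?thesis by (auto simp: val all_bool_eq)
    qed
  qed
  moreover have "separating_edge H (\<psi> ` C) (\<psi> e) \<longleftrightarrow> separating_edge G C e" if e: "e \<in> C" for e
  proof -
    have "\<psi> ` C - {\<psi> e} = \<psi> ` (C - {e})"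
      using inj C e by (simp add: inj_on_image_set_diff[where C = "edges G"] subset_eq)
    then show ?thesis
      unfolding separating_edge_def using joined_ends_iso[OF i w, of "C - {e}" e] C e by auto
  qed
  moreover have "\<psi> ` C \<subseteq> edges H"
    using C im by blast
  ultimately show ?thesis
    unfolding core_def using C by simp
qed

lemma psubset_image_iff:
  assumes "inj_on f E" "A \<subseteq> E" "B \<subseteq> E"
  shows "f ` A \<subset> f ` B \<longleftrightarrow> A \<subset> B"
proof -
  have "f ` X \<subseteq> f ` Y \<longleftrightarrow> X \<subseteq> Y" if "X \<subseteq> E" "Y \<subseteq> E" for X Y
    using that inj_on_image_mem_iff[OF assms(1)] by (metis image_mono image_subset_iff subset_iff)
  then show ?thesis
    using assms(2,3) by (simp add: less_le_not_le)
qed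

lemma position_map:
  assumes "inj_on f (insert x (set xs))"
  shows "position (f x) (map f xs) = position x xs"
proof -
  have "takeWhile ((\<lambda>y. y \<noteq> f x) \<circ> f) xs = takeWhile (\<lambda>y. y \<noteq> x) xs"
    using assms by (intro takeWhile_cong) (auto simp: inj_on_def)
  then show ?thesis
    unfolding position_def by (simp add: takeWhile_map)
qed

lemma insertable_iso:
  assumes i: "filtered_iso \<phi> \<psi> g h" and w: "wf_fgraph g" and C: "C \<subseteq> edges g"
  shows "insertable h (\<psi> ` C) \<longleftrightarrow> insertable g C"
    and "insert_core h (\<psi> ` C) = h\<lparr>filt := map (image \<psi>) (filt (insert_core g C))\<rparr>"
proof -
  have gi: "graph_iso \<phi> \<psi> g h" and f: "filt h = map (image \<psi>) (filt g)"
    using i unfolding filtered_iso_def by auto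
  have inj: "inj_on \<psi> (edges g)" and im: "edges h = \<psi> ` edges g"
    using gi unfolding graph_iso_def bij_betw_def by auto
  have wg: "wf_graph g" and sub: "F \<subseteq> edges g" if "F \<in> set (filt g)" for F
    using w that unfolding wf_fgraph_def by auto
  have wg: "wf_graph g"
    using w unfolding wf_fgraph_def by auto
  show "insertable h (\<psi> ` C) \<longleftrightarrow> insertable g C"
    unfolding insertable_def f im core_iso[OF gi wg C]
    using psubset_image_iff[OF inj C subset_refl] psubset_image_iff[OF inj C sub]
      psubset_image_iff[OF inj sub C] by auto
  have "filter (\<lambda>F. F \<subset> \<psi> ` C) (filt h) = map (image \<psi>) (filter (\<lambda>F. F \<subset> C) (filt g))"
    unfolding f filter_map comp_def using psubset_image_iff[OF inj sub C]
    by (intro arg_cong[where f = "map _"] filter_cong) auto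
  moreover have "filter (\<lambda>F. \<psi> ` C \<subset> F) (filt h) = map (image \<psi>) (filter (\<lambda>F. C \<subset> F) (filt g))"
    unfolding f filter_map comp_def using psubset_image_iff[OF inj C sub]
    by (intro arg_cong[where f = "map _"] filter_cong) auto
  ultimately show "insert_core h (\<psi> ` C) = h\<lparr>filt := map (image \<psi>) (filt (insert_core g C))\<rparr>"
    unfolding insert_core_def by simp
qed

lemma wf_insert_core:
  assumes "wf_fgraph g" "C \<subseteq> edges g"
  shows "wf_fgraph (insert_core g C)"
  using assms unfolding wf_fgraph_def insert_core_def wf_graph_def by auto

lemma boundary_F_iso:
  assumes w: "wf_fgraph g" and i: "signed_iso s g h"
  shows "boundary_F h = of_int s *\<^sub>Q boundary_F g"
proof -
  obtain \<phi> \<psi> where fi: "filtered_iso \<phi> \<psi> g h" and r: "reordering s (map \<psi> (eord g)) (eord h)"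
    using i unfolding signed_iso_def by auto
  have gi: "graph_iso \<phi> \<psi> g h" and f: "filt h = map (image \<psi>) (filt g)"
    using fi unfolding filtered_iso_def by auto
  have inj: "inj_on \<psi> (edges g)" and im: "edges h = \<psi> ` edges g"
    using gi unfolding graph_iso_def bij_betw_def by auto
  have sub: "C \<subseteq> edges g" if "insertable g C" for C
    using that unfolding insertable_def by auto
  have bij: "bij_betw (image \<psi>) {C. insertable g C} {C. insertable h C}"
    unfolding bij_betw_def
  proof (intro conjI subset_antisym subsetI)
    show "inj_on (image \<psi>) {C. insertable g C}"
      using inj sub by (auto intro!: inj_onI simp: inj_on_image_eq_iff)
    show "D \<in> {C. insertable h C}" if "D \<in> image \<psi> ` {C. insertable g C}" for D
      using that sub insertable_iso(1)[OF fi w] by auto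
    show "D \<in> image \<psi> ` {C. insertable g C}" if D: "D \<in> {C. insertable h C}" for D
    proof -
      have "D \<subseteq> \<psi> ` edges g"
        using D im unfolding insertable_def by auto
      then obtain C where "C \<subseteq> edges g" "D = \<psi> ` C"
        by (auto simp: subset_image_iff)
      then show ?thesis
        using D insertable_iso(1)[OF fi w] by auto
    qed
  qed
  have "(-1) ^ position (\<psi> ` C) (filt (insert_core h (\<psi> ` C))) *\<^sub>Q gen (insert_core h (\<psi> ` C)) =
     of_int s *\<^sub>Q (-1) ^ position C (filt (insert_core g C)) *\<^sub>Q gen (insert_core g C)"
    if C: "insertable g C" for C
  proof -
    note CE = sub[OF C]
    have "signed_iso s (insert_core g C) (insert_core h (\<psi> ` C))"
      unfolding signed_iso_def using gi r insertable_iso(2)[OF fi w CE]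
      by (intro exI[of _ \<phi>] exI[of _ \<psi>])
        (simp add: filtered_iso_def graph_iso_def insert_core_def)
    from gen_signed_iso[OF wf_insert_core[OF w CE] this]
    have "gen (insert_core h (\<psi> ` C)) = of_int s *\<^sub>Q gen (insert_core g C)" .
    moreover have "\<forall>F\<in>set (filt (insert_core g C)). F \<subseteq> edges g"
      using w CE unfolding wf_fgraph_def insert_core_def by auto
    then have "inj_on (image \<psi>) (insert C (set (filt (insert_core g C))))"
      using inj CE by (auto intro!: inj_onI simp: inj_on_image_eq_iff)
    then have "position (\<psi> ` C) (filt (insert_core h (\<psi> ` C))) = position C (filt (insert_core g C))"
      using insertable_iso(2)[OF fi w CE] position_map by simp
    ultimately show ?thesis
      by (simp add: mult.commute)
  qed
  then have "(\<Sum>C | insertable g C. (-1) ^ position (\<psi> ` C) (filt (insert_core h (\<psi> ` C))) *\<^sub>Q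
      gen (insert_core h (\<psi> ` C))) = of_int s *\<^sub>Q boundary_F g"
    unfolding boundary_F_def bchain.scale_sum_right by (intro sum.cong) auto
  then show ?thesis
    unfolding boundary_F_def using sum.reindex_bij_betw[OF bij,
      of "\<lambda>D. (-1) ^ position D (filt (insert_core h D)) *\<^sub>Q gen (insert_core h D)"] by simp
qed

lemma verts_joined_class:
  assumes i: "graph_iso \<phi> \<psi> G H" and w: "wf_graph G" and F: "F \<subseteq> edges G" and v: "v \<in> verts G"
  shows "\<phi> ` (joined G F `` {v}) = joined H (\<psi> ` F) `` {\<phi> v}"
    and "joined G F `` {v} \<subseteq> verts G"
proof -
  have closed: "y \<in> verts K" if "(x, y) \<in> joined K D" "x \<in> verts K" "wf_graph K" "D \<subseteq> edges K"
    for x y and K :: "('x, 'y, 'z) graph_scheme" and D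
    using that(1) unfolding joined_def
  proof (cases rule: rtranclE)
    case base
    then show ?thesis using that(2) by simp
  next
    case (step z)
    then show ?thesis
      using that(3,4) unfolding wf_graph_def by auto
  qed
  show sub: "joined G F `` {v} \<subseteq> verts G"
    using closed[OF _ v w F] by auto
  have b: "bij_betw \<phi> (verts G) (verts H)" "bij_betw \<psi> (edges G) (edges H)"
    using i unfolding graph_iso_def by auto
  show "\<phi> ` (joined G F `` {v}) = joined H (\<psi> ` F) `` {\<phi> v}"
  proof (intro subset_antisym subsetI)
    fix x assume "x \<in> \<phi> ` (joined G F `` {v})"
    then show "x \<in> joined H (\<psi> ` F) `` {\<phi> v}"
      using joined_iso_imp[OF i F] by auto
  next
    fix x assume x: "x \<in> joined H (\<psi> ` F) `` {\<phi> v}"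
    have "x \<in> verts H"
    proof -
      have "(\<phi> v, x) \<in> joined H (\<psi> ` F)"
        using x by simp
      then show ?thesis
        unfolding joined_def
      proof (cases rule: rtranclE)
        case base
        then show ?thesis using bij_betwE[OF b(1)] v by auto
      next
        case (step z)
        then obtain e c where e: "e \<in> F" "x = ends H (\<psi> e) c"
          by auto
        then have eE: "e \<in> edges G"
          using F by auto
        then have "ends G e c' \<in> verts G" for c'
          using w unfolding wf_graph_def by simp
        then have "\<phi> (ends G e c') \<in> verts H" for c'
          using bij_betwE[OF b(1)] by simp
        then show ?thesis
          using e(2) by (cases rule: graph_iso_ends[OF i eE]) simp_all
      qed
    qed
    then obtain y where y: "y \<in> verts G" "x = \<phi> y"
      using bij_betw_imp_surj_on[OF b(1)] by auto
    then have "(v, y) \<in> joined G F"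
      using x joined_iso[OF i w F v y(1)] by simp
    then show "x \<in> \<phi> ` (joined G F `` {v})"
      using y(2) by auto
  qed
qed

lemma collapse_iso:
  assumes i: "graph_iso \<phi> \<psi> G H" and w: "wf_graph G" and F: "F \<subseteq> edges G"
  shows "graph_iso (image \<phi>) \<psi> (collapse G F) (collapse H (\<psi> ` F))"
proof -
  note cls = verts_joined_class[OF i w F]
  have b: "bij_betw \<phi> (verts G) (verts H)" "bij_betw \<psi> (edges G) (edges H)"
    using i unfolding graph_iso_def by auto
  have inj: "inj_on \<phi> (verts G)" "inj_on \<psi> (edges G)"
    using b by (simp_all add: bij_betw_imp_inj_on)
  have im: "image \<phi> ` (verts G // joined G F) = verts H // joined H (\<psi> ` F)"
  proof (intro subset_antisym subsetI)
    fix X assume "X \<in> image \<phi> ` (verts G // joined G F)"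
    then obtain v where v: "v \<in> verts G" "X = \<phi> ` (joined G F `` {v})"
      by (auto elim!: quotientE)
    then show "X \<in> verts H // joined H (\<psi> ` F)"
      using cls(1) bij_betwE[OF b(1)] by (auto intro: quotientI)
  next
    fix X assume "X \<in> verts H // joined H (\<psi> ` F)"
    then obtain u where u: "u \<in> verts H" "X = joined H (\<psi> ` F) `` {u}"
      by (rule quotientE)
    then obtain v where v: "v \<in> verts G" "u = \<phi> v"
      using bij_betw_imp_surj_on[OF b(1)] by auto
    then have "X = \<phi> ` (joined G F `` {v})"
      using cls(1)[OF v(1)] u(2) by simp
    then show "X \<in> image \<phi> ` (verts G // joined G F)"
      using v(1) by (auto intro: quotientI)
  qed
  have sub: "X \<subseteq> verts G" if "X \<in> verts G // joined G F" for X
    using that cls(2) by (auto elim!: quotientE)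
  have "inj_on (image \<phi>) (verts G // joined G F)"
    using inj(1) sub by (intro inj_onI) (metis inj_on_image_eq_iff)
  with im have v: "bij_betw (image \<phi>) (verts (collapse G F)) (verts (collapse H (\<psi> ` F)))"
    unfolding bij_betw_def collapse_def by simp
  have e: "bij_betw \<psi> (edges (collapse G F)) (edges (collapse H (\<psi> ` F)))"
    unfolding bij_betw_def collapse_def
    using inj(2) F bij_betw_imp_surj_on[OF b(2)]
    by (simp add: inj_on_image_set_diff[where C = "edges G"] inj_on_diff)
  have "(\<forall>b. ends (collapse H (\<psi> ` F)) (\<psi> e) b = \<phi> ` ends (collapse G F) e b) \<or>
      (\<forall>b. ends (collapse H (\<psi> ` F)) (\<psi> e) b = \<phi> ` ends (collapse G F) e (\<not> b))"
    if "e \<in> edges (collapse G F)" for e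
  proof -
    have e: "e \<in> edges G"
      using that by (simp add: collapse_def)
    then have "ends G e b \<in> verts G" for b
      using w unfolding wf_graph_def by simp
    note c = cls(1)[OF this]
    show ?thesis
      by (rule graph_iso_ends[OF i e]) (simp_all add: collapse_def c)
  qed
  with v e show ?thesis
    unfolding graph_iso_def by simp
qed

lemma wf_collapse_edge:
  assumes "wf_fgraph g"
  shows "wf_fgraph (collapse_edge g e)"
proof -
  have g: "wf_graph g" "\<forall>C\<in>set (filt g). C \<subseteq> edges g" "distinct (eord g)" "set (eord g) = edges g"
    using assms unfolding wf_fgraph_def by simp_all
  have "finite (verts g // joined g {e})"
    using g(1) unfolding wf_graph_def quotient_def by simp
  then have "wf_graph (collapse_edge g e)"
    using g(1) unfolding wf_graph_def collapse_edge_def collapse_def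
    by (simp add: Let_def quotientI)
  then show ?thesis
    using g(2-) unfolding wf_fgraph_def by (auto simp: collapse_edge_def collapse_def Let_def)
qed

lemma collapsible_iso:
  assumes fi: "filtered_iso \<phi> \<psi> g h" and wf: "wf_fgraph g" and e: "e \<in> edges g"
  shows "collapsible h (\<psi> e) \<longleftrightarrow> collapsible g e"
proof -
  have gi: "graph_iso \<phi> \<psi> g h" and f: "filt h = map (image \<psi>) (filt g)"
    using fi unfolding filtered_iso_def by auto
  have b: "bij_betw \<psi> (edges g) (edges h)"
    using gi unfolding graph_iso_def by auto
  have inj: "inj_on \<psi> (edges g)" and im: "edges h = \<psi> ` edges g"
    using b bij_betw_imp_inj_on bij_betw_imp_surj_on by blast+
  have w: "wf_graph g" and sub: "\<forall>F\<in>set (filt g). F \<subseteq> edges g"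
    using wf unfolding wf_fgraph_def by simp_all
  have st: "{} # stages h = map (image \<psi>) ({} # stages g)"
    unfolding stages_def f im by simp
  have st_sub: "\<forall>F\<in>set ({} # stages g). F \<subseteq> edges g"
    using sub unfolding stages_def by simp
  have "({} # stages h) ! Suc i - ({} # stages h) ! i = {\<psi> e} \<longleftrightarrow>
      ({} # stages g) ! Suc i - ({} # stages g) ! i = {e}" if i: "i < length (stages g)" for i
  proof -
    let ?A = "({} # stages g) ! Suc i" and ?B = "({} # stages g) ! i"
    have A: "?A \<subseteq> edges g" "?B \<subseteq> edges g"
      using st_sub i by (metis length_Cons less_SucI Suc_less_eq nth_mem)+
    have d: "?A - ?B \<subseteq> edges g"
      using A(1) by blast
    have "({} # stages h) ! Suc i - ({} # stages h) ! i = \<psi> ` ?A - \<psi> ` ?B"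
      unfolding st using i by (simp only: nth_map length_Cons Suc_less_eq less_SucI)
    also have "\<dots> = \<psi> ` (?A - ?B)"
      using inj_on_image_set_diff[OF inj d A(2)] by (rule sym)
    finally show ?thesis
      using inj_on_image_eq_iff[OF inj d, of "{e}"] e by simp
  qed
  moreover have "length (stages h) = length (stages g)"
    unfolding stages_def f by simp
  moreover have "\<psi> e \<in> \<psi> ` F \<longleftrightarrow> e \<in> F" if "F \<in> set (filt g)" for F
    using inj_on_image_mem_iff[OF inj e] sub that by auto
  moreover have "(ends h (\<psi> e) False, ends h (\<psi> e) True) \<in> joined h (\<psi> ` F) \<longleftrightarrow>
      (ends g e False, ends g e True) \<in> joined g F" if "F \<in> set (filt g)" for F
    using joined_ends_iso[OF gi w _ e, of F] sub that by auto
  ultimately show ?thesis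
    unfolding collapsible_def f using e im ends_eq_iso[OF gi w e] by auto
qed

lemma boundary_E_iso:
  assumes wf: "wf_fgraph g" and i: "signed_iso s g h"
  shows "boundary_E h = of_int s *\<^sub>Q boundary_E g"
proof -
  obtain \<phi> \<psi> where fi: "filtered_iso \<phi> \<psi> g h" and r: "reordering s (map \<psi> (eord g)) (eord h)"
    using i unfolding signed_iso_def by auto
  have gi: "graph_iso \<phi> \<psi> g h" and f: "filt h = map (image \<psi>) (filt g)"
    using fi unfolding filtered_iso_def by auto
  have b: "bij_betw \<psi> (edges g) (edges h)"
    using gi unfolding graph_iso_def by auto
  have inj: "inj_on \<psi> (edges g)" and im: "edges h = \<psi> ` edges g"
    using b bij_betw_imp_inj_on bij_betw_imp_surj_on by blast+
  have w: "wf_graph g" and sub: "\<forall>F\<in>set (filt g). F \<subseteq> edges g"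
    and ord: "distinct (eord g)" "set (eord g) = edges g"
    using wf unfolding wf_fgraph_def by simp_all
  have bij: "bij_betw \<psi> {e. collapsible g e} {e. collapsible h e}"
    unfolding bij_betw_def
  proof (intro conjI subset_antisym subsetI)
    show "inj_on \<psi> {e. collapsible g e}"
      using inj by (rule inj_on_subset) (auto simp: collapsible_def)
    show "x \<in> {e. collapsible h e}" if x: "x \<in> \<psi> ` {e. collapsible g e}" for x
    proof -
      obtain e where "collapsible g e" "x = \<psi> e"
        using x by auto
      moreover have "e \<in> edges g"
        using \<open>collapsible g e\<close> by (simp add: collapsible_def)
      ultimately show ?thesis
        using collapsible_iso[OF fi wf] by simp
    qed
    show "x \<in> \<psi> ` {e. collapsible g e}" if x: "x \<in> {e. collapsible h e}" for x
    proof -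
      have "x \<in> \<psi> ` edges g"
        using x im by (simp add: collapsible_def)
      then show ?thesis
        using x collapsible_iso[OF fi wf] by auto
    qed
  qed
  have "(-1) ^ (position (\<psi> e) (eord h) + length (stages h) - 1) *\<^sub>Q gen (collapse_edge h (\<psi> e)) =
     of_int s *\<^sub>Q (-1) ^ (position e (eord g) + length (stages g) - 1) *\<^sub>Q gen (collapse_edge g e)"
    if c: "collapsible g e" for e
  proof -
    have e: "e \<in> edges g"
      using c by (simp add: collapsible_def)
    define n where "n = position e (eord g)"
    define m where "m = position (\<psi> e) (eord h)"
    have pos: "position (\<psi> e) (map \<psi> (eord g)) = n"
      unfolding n_def using inj ord(2) e by (intro position_map) (simp add: insert_absorb)
    have "map \<psi> (filter (\<lambda>x. x \<noteq> e) (eord g)) = filter (\<lambda>x. x \<noteq> \<psi> e) (map \<psi> (eord g))"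
      unfolding filter_map comp_def using inj ord(2) e
      by (intro arg_cong[where f = "map \<psi>"] filter_cong) (auto simp: inj_on_eq_iff)
    moreover have "reordering (s * (-1) ^ (n + m))
        (filter (\<lambda>x. x \<noteq> \<psi> e) (map \<psi> (eord g))) (filter (\<lambda>x. x \<noteq> \<psi> e) (eord h))"
      unfolding m_def pos[symmetric] using inj ord e r
      by (intro reordering_remove) (simp_all add: distinct_map)
    ultimately have r': "reordering (s * (-1) ^ (n + m))
        (map \<psi> (eord (collapse_edge g e))) (eord (collapse_edge h (\<psi> e)))"
      by (simp add: collapse_edge_def Let_def)
    have "\<psi> ` F - {\<psi> e} = \<psi> ` (F - {e})" if F: "F \<in> set (filt g)" for F
      using inj_on_image_set_diff[OF inj, of F "{e}"] sub F e by auto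
    then have "filt (collapse_edge h (\<psi> e)) = map (image \<psi>) (filt (collapse_edge g e))"
      by (simp add: collapse_edge_def Let_def f)
    moreover have "graph_iso (image \<phi>) \<psi> (collapse_edge g e) (collapse_edge h (\<psi> e))"
      using collapse_iso[OF gi w, of "{e}"] e
      unfolding graph_iso_def by (simp add: collapse_edge_def Let_def)
    ultimately have "signed_iso (s * (-1) ^ (n + m)) (collapse_edge g e) (collapse_edge h (\<psi> e))"
      unfolding signed_iso_def filtered_iso_def using r' by blast
    from gen_signed_iso[OF wf_collapse_edge[OF wf] this]
    have G: "gen (collapse_edge h (\<psi> e)) = (of_int s * (-1) ^ (n + m)) *\<^sub>Q gen (collapse_edge g e)"
      by simp
    have "length (stages h) = length (stages g)" "length (stages g) = Suc (length (filt g))"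
      unfolding stages_def f by simp_all
    moreover have "(-1) ^ (m + k) * (of_int s * (-1) ^ (n + m)) = of_int s * ((-1) ^ (n + k) :: rat)" for k
      by (simp add: power_add flip: power_mult_distrib)
    ultimately show ?thesis
      unfolding n_def[symmetric] m_def[symmetric] G by simp
  qed
  then have "(\<Sum>e | collapsible g e. (-1) ^ (position (\<psi> e) (eord h) + length (stages h) - 1) *\<^sub>Q
      gen (collapse_edge h (\<psi> e))) = of_int s *\<^sub>Q boundary_E g"
    unfolding boundary_E_def bchain.scale_sum_right by (intro sum.cong) auto
  then show ?thesis
    unfolding boundary_E_def using sum.reindex_bij_betw[OF bij,
      of "\<lambda>e. (-1) ^ (position e (eord h) + length (stages h) - 1) *\<^sub>Q gen (collapse_edge h e)"] by simp
qed

definition boundary_free :: "((nat, nat) fgraph \<Rightarrow>\<^sub>0 rat) \<Rightarrow> bchain" where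
  "boundary_free c = (\<Sum>g\<in>Poly_Mapping.keys c.
     Poly_Mapping.lookup c g *\<^sub>Q (boundary_E g + boundary_F g))"

lemma boundary_free_superset:
  assumes "finite A" "Poly_Mapping.keys c \<subseteq> A"
  shows "boundary_free c = (\<Sum>g\<in>A. Poly_Mapping.lookup c g *\<^sub>Q (boundary_E g + boundary_F g))"
  unfolding boundary_free_def using assms
  by (intro sum.mono_neutral_left) (auto simp: in_keys_iff)

lemma boundary_free_add: "boundary_free (a + b) = boundary_free a + boundary_free b"
proof -
  let ?A = "Poly_Mapping.keys a \<union> Poly_Mapping.keys b"
  have "boundary_free x = (\<Sum>g\<in>?A. Poly_Mapping.lookup x g *\<^sub>Q (boundary_E g + boundary_F g))"
    if "x \<in> {a, b, a + b}" for x
    using that Poly_Mapping.keys_add[of a b] by (intro boundary_free_superset) auto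
  then show ?thesis
    by (simp add: lookup_add bchain.scale_left_distrib sum.distrib)
qed

lemma boundary_free_scale: "boundary_free (fscale r a) = r *\<^sub>Q boundary_free a"
proof -
  have "boundary_free x = (\<Sum>g\<in>Poly_Mapping.keys a.
      Poly_Mapping.lookup x g *\<^sub>Q (boundary_E g + boundary_F g))" if "x \<in> {a, fscale r a}" for x
    using that by (intro boundary_free_superset) (auto simp: in_keys_iff fscale.rep_eq)
  then show ?thesis
    by (simp add: fscale.rep_eq bchain.scale_sum_right)
qed

lemma boundary_free_single [simp]:
  "boundary_free (Poly_Mapping.single g r) = r *\<^sub>Q (boundary_E g + boundary_F g)"
  unfolding boundary_free_def by simp

lemma boundary_free_diff: "boundary_free (a - b) = boundary_free a - boundary_free b"
  using boundary_free_add[of "a - b" b] by simp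

lemma boundary_free_relations:
  assumes "c \<in> relations"
  shows "boundary_free c = 0"
  using assms unfolding relations_def
proof (induction rule: free.span_induct_alt)
  case base
  show ?case by (simp add: boundary_free_def)
next
  case (step r x y)
  have sgn: "boundary_E h + boundary_F h = of_int s *\<^sub>Q (boundary_E g + boundary_F g)"
    if "wf_fgraph g" "signed_iso s g h" for s :: int and g h :: "(nat, nat) fgraph"
    using boundary_E_iso[OF that] boundary_F_iso[OF that] by (simp add: bchain.scale_right_distrib)
  from step(1) have "boundary_free x = 0"
  proof (elim UnE CollectE exE conjE)
    fix g h :: "(nat, nat) fgraph"
    assume "wf_fgraph g" "oriented_iso g h" and x: "x = Poly_Mapping.single g 1 - Poly_Mapping.single h 1"
    then show ?thesis
      using sgn[of g 1 h] by (simp add: boundary_free_diff oriented_iso_signed)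
  next
    fix g :: "(nat, nat) fgraph" and os
    assume g: "wf_fgraph g" and o: "reordering (-1) (eord g) os"
      and x: "x = Poly_Mapping.single g 1 + Poly_Mapping.single (g\<lparr>eord := os\<rparr>) 1"
    have "signed_iso (-1) g (g\<lparr>eord := os\<rparr>)"
      unfolding signed_iso_def using o
      by (intro exI[of _ id]) (simp add: filtered_iso_def graph_iso_def)
    then show ?thesis
      using sgn[OF g] x by (simp add: boundary_free_add)
  qed
  then show ?case
    using step(2) by (simp add: boundary_free_add boundary_free_scale)
qed

lift_definition boundary :: "bchain \<Rightarrow> bchain" is boundary_free
proof -
  fix a b :: "(nat, nat) fgraph \<Rightarrow>\<^sub>0 rat"
  assume "a - b \<in> relations"
  then have "boundary_free (a - b) = 0"
    by (rule boundary_free_relations)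
  then show "boundary_free a = boundary_free b"
    by (simp add: boundary_free_diff)
qed

lemma linear_boundary: "Vector_Spaces.linear qscale qscale boundary"
proof
  show "boundary (x + y) = boundary x + boundary y" for x y
    by transfer (rule boundary_free_add)
  show "boundary (r *\<^sub>Q x) = r *\<^sub>Q boundary x" for r x
    by transfer (rule boundary_free_scale)
qed

lemma boundary_gen:
  assumes "wf_fgraph g"
  shows "boundary (gen g) = boundary_E g + boundary_F g"
proof -
  obtain h :: "(nat, nat) fgraph" where h: "oriented_iso g h"
    using nat_model_exists[OF assms] by blast
  have "boundary (basis h) = boundary_E h + boundary_F h"
    by transfer simp
  moreover have "signed_iso 1 g h"
    using h by (simp add: oriented_iso_signed)
  ultimately show ?thesis
    using gen_eq_basis[OF assms h] boundary_E_iso[OF assms, of 1 h] boundary_F_iso[OF assms, of 1 h]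
    by simp
qed


section \<open>Homology\<close>

definition chains :: "int \<Rightarrow> int \<Rightarrow> bchain set" where
  "chains r n =
     bchain.span {gen g | g :: (nat, nat) fgraph. filtered_graph r g \<and> fdegree g = n}"

definition cycles :: "int \<Rightarrow> int \<Rightarrow> bchain set" where
  "cycles r n = {z \<in> chains r n. boundary z = 0}"

definition boundaries :: "int \<Rightarrow> int \<Rightarrow> bchain set" where
  "boundaries r n = boundary ` chains r (n + 1)"

definition homologous :: "int \<Rightarrow> int \<Rightarrow> (bchain \<times> bchain) set" where
  "homologous r n = {(z, z'). z \<in> cycles r n \<and> z' \<in> cycles r n \<and> z - z' \<in> boundaries r n}"

definition homology :: "int \<Rightarrow> int \<Rightarrow> bchain set set" where
  "homology r n = cycles r n // homologous r n"

text \<open>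
  This is empty, hence not an element of \<open>homology r n\<close>, if \<open>z\<close> is not a cycle.
\<close>

definition homology_class :: "int \<Rightarrow> int \<Rightarrow> bchain \<Rightarrow> bchain set" where
  "homology_class r n z = homologous r n `` {z}"


section \<open>AB-graphs\<close>

text \<open>
  Vertices outside \<open>typeA\<close> are of type B.  The list \<open>hord s\<close> is the ordering of the half-edges at
  the type A vertex \<open>s\<close> given by the orientation.
\<close>

record ('v, 'e) abgraph = "('v, 'e) graph" +
  typeA :: "'v set"
  hord :: "'v \<Rightarrow> ('e \<times> bool) list"

definition AB_graph :: "('v, 'e) abgraph \<Rightarrow> bool" where
  "AB_graph X \<longleftrightarrow> wf_graph X \<and> connected_graph X \<and>
     (\<forall>v\<in>verts X. 3 \<le> valence X (edges X) v) \<and> typeA X \<subseteq> verts X"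

definition odd_AB_graph :: "('v, 'e) abgraph \<Rightarrow> bool" where
  "odd_AB_graph X \<longleftrightarrow> AB_graph X \<and> (\<forall>s\<in>typeA X. odd (valence X (edges X) s))"

definition oriented_odd_AB_graph :: "('v, 'e) abgraph \<Rightarrow> bool" where
  "oriented_odd_AB_graph X \<longleftrightarrow> odd_AB_graph X \<and>
     (\<forall>s\<in>typeA X. distinct (hord X s) \<and> set (hord X s) = half_edges X (edges X) s)"


section \<open>The chain of an oriented odd AB-graph\<close>

text \<open>
  The vertices of the polygon at \<open>s\<close> are \<open>(s, i)\<close> with \<open>i < v\<close>, where \<open>v\<close> is the valence of \<open>s\<close>
  (numbering from \<open>0\<close>); its edge \<open>(s, i)\<close> joins the vertices \<open>(s, i)\<close> and \<open>(s, i + 1 mod v)\<close>.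
\<close>

definition attachments :: "('v, 'e) abgraph \<Rightarrow> 'v \<Rightarrow> ('e \<times> bool \<Rightarrow> nat) set" where
  "attachments X s =
     {\<iota> \<in> half_edges X (edges X) s \<rightarrow>\<^sub>E {..<valence X (edges X) s}.
        bij_betw \<iota> (half_edges X (edges X) s) {..<valence X (edges X) s}}"

definition attachment_sign :: "('v, 'e) abgraph \<Rightarrow> 'v \<Rightarrow> ('e \<times> bool \<Rightarrow> nat) \<Rightarrow> int" where
  "attachment_sign X s \<iota> = sign_on {..<valence X (edges X) s} (\<lambda>i. \<iota> (hord X s ! i))"

definition polygon :: "('v, 'e) abgraph \<Rightarrow> 'v \<Rightarrow> ('e + 'v \<times> nat) list" where
  "polygon X s = map (\<lambda>i. Inr (s, i)) [0..<valence X (edges X) s]"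

definition polygon_positions :: "('v, 'e) abgraph \<Rightarrow> ('v \<times> nat) set" where
  "polygon_positions X = (SIGMA s:typeA X. {..<valence X (edges X) s})"

definition blowup ::
    "('v, 'e) abgraph \<Rightarrow> ('v \<Rightarrow> 'e \<times> bool \<Rightarrow> nat) \<Rightarrow> ('v + 'v \<times> nat, 'e + 'v \<times> nat) graph" where
  "blowup X \<iota> =
     \<lparr>verts = Inl ` (verts X - typeA X) \<union> Inr ` polygon_positions X,
      edges = Inl ` edges X \<union> Inr ` polygon_positions X,
      ends = (\<lambda>x b. case x of
          Inl e \<Rightarrow> let s = ends X e b in if s \<in> typeA X then Inr (s, \<iota> s (e, b)) else Inl s
        | Inr (s, i) \<Rightarrow> Inr (s, if b then Suc i mod valence X (edges X) s else i))\<rparr>"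

definition Y_graph :: "('v, 'e) abgraph \<Rightarrow> 'e set \<Rightarrow> 'v list \<Rightarrow> 'e list \<Rightarrow>
    ('v \<Rightarrow> 'e \<times> bool \<Rightarrow> nat) \<Rightarrow> (('v + 'v \<times> nat) set, 'e + 'v \<times> nat) fgraph" where
  "Y_graph X T o\<^sub>1 o\<^sub>2 \<iota> =
     (let Q = collapse (blowup X \<iota>) (Inl ` T);
          blocks = map (polygon X) o\<^sub>1 @ map (\<lambda>e. [Inl e]) o\<^sub>2
      in \<lparr>verts = verts Q, edges = edges Q, ends = ends Q,
          filt = map (\<lambda>j. set (concat (take j blocks))) [1..<length blocks],
          eord = concat blocks\<rparr>)"

definition Phi :: "('v, 'e) abgraph \<Rightarrow> 'e set \<Rightarrow> 'v list \<Rightarrow> 'e list \<Rightarrow> bchain" where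
  "Phi X T o\<^sub>1 o\<^sub>2 =
     (\<Sum>\<iota>\<in>Pi\<^sub>E (typeA X) (attachments X).
        of_int (\<Prod>s\<in>typeA X. attachment_sign X s (\<iota> s)) *\<^sub>Q gen (Y_graph X T o\<^sub>1 o\<^sub>2 \<iota>))"

definition Phi_choice :: "('v, 'e) abgraph \<Rightarrow> 'e set \<Rightarrow> 'v list \<Rightarrow> 'e list \<Rightarrow> bool" where
  "Phi_choice X T o\<^sub>1 o\<^sub>2 \<longleftrightarrow> maximal_tree X T \<and>
     distinct o\<^sub>1 \<and> set o\<^sub>1 = typeA X \<and> distinct o\<^sub>2 \<and> set o\<^sub>2 = edges X - T"

text \<open>
  Rank and degree of the graphs \<open>Y_graph X T o\<^sub>1 o\<^sub>2 \<iota>\<close>: replacing a vertex by a polygon raises the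
  rank by one; there are \<open>\<Sum>s. valence s\<close> polygon edges and \<open>card (edges X - T)\<close> other edges, and the
  filtration consists of \<open>card (typeA X) + card (edges X - T)\<close> graphs.
\<close>

definition Phi_rank :: "('v, 'e) abgraph \<Rightarrow> int" where
  "Phi_rank X = rank X + int (card (typeA X))"

definition Phi_degree :: "('v, 'e) abgraph \<Rightarrow> int" where
  "Phi_degree X = (\<Sum>s\<in>typeA X. int (valence X (edges X) s) - 1)"

end

theory Submission
  imports Defs
begin

text \<open>
  The proof rests on two observations.  First, if an edge of a polygon is collapsed, then exchanging the
  two half-edges attached at its ends does not change the resulting graph, but it reverses the sign.
  Hence in a signed sum over all ways of attaching the half-edges, the collapses of polygon edges
  cancel.  Second, as \<open>T\<close> is a tree, a proper part of a polygon together with earlier polygons is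
  never a core graph, so a core subgraph inserted into the filtration is a union of whole polygons and
  edges of \<open>X - T\<close>.  This gives the cycle condition.

  Omitting from the filtration the stage between two adjacent polygons, or two adjacent edges of
  \<open>X - T\<close>, yields a chain whose boundary has two terms for each \<open>\<iota>\<close>: the two orders in which the
  stages can be filled in.  All blocks have an odd number of edges (here the valences have to be odd), so
  the orientations of the two terms differ by a sign, and the boundary is \<open>\<plusminus>\<close> the difference of the
  chains for the two orderings.  If \<open>T'\<close> arises from \<open>T\<close> by replacing \<open>f\<close> with \<open>e\<close>, one collapses only
  \<open>T - f\<close> and adds \<open>e\<close> and \<open>f\<close> to the filtration in a single step after the polygons; the collapses of \<open>f\<close> and
  of \<open>e\<close> give the chains for \<open>T\<close> and \<open>T'\<close> with opposite signs.  Any two maximal trees are connected by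
  such exchanges.
\<close>

section \<open>Joined vertices and forests\<close>

text \<open>Everything about \<open>Y\<close> is read off from joinedness, by comparison with
  \<open>X\<close>. Paths in the blow-up always project to \<open>X\<close>, but a path in
  \<open>X\<close> can only be lifted when whole polygons are available to move around in. Hence the
  polygon part of the filtration needs an argument about the arcs of a polygon, while beyond it
  every question is one about edge sets of \<open>X\<close>. The two kinds of bounding chains are
  complementary. With a maximal tree collapsed, the ends of an edge outside \<open>T\<close> are
  already joined by the stage before its block, so only insertions contribute. In the exchange chain
  the pair of edges comes right after the polygons: there neither edge alone closes a cycle, so
  nothing can be inserted, but both can be collapsed. Iterated collapses have sets of sets as
  vertices, so generators are compared through their half-edges: with valences at least 3 a graph is
  determined by which half-edges meet. Orientation and filtration are kept in one list of blocks of
  edges, so that signs come from moving blocks. The pairing of attachments shows that a sum equals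
  its own negative, and rational coefficients make it 0.\<close>

lemma joined_refl [simp]: "(u, u) \<in> joined G F"
  unfolding joined_def by simp

lemma joined_trans: "(u, v) \<in> joined G F \<Longrightarrow> (v, w) \<in> joined G F \<Longrightarrow> (u, w) \<in> joined G F"
  unfolding joined_def by (rule rtrancl_trans)

lemma joined_ends: "e \<in> F \<Longrightarrow> (ends G e b, ends G e c) \<in> joined G F"
proof (cases "b = c")
  case False
  assume "e \<in> F"
  then have "(ends G e b, ends G e (\<not> b)) \<in> joined G F"
    unfolding joined_def by (intro r_into_rtrancl) blast
  then show ?thesis using False by (cases b; cases c) auto
qed simp

lemma joined_least:
  assumes "(u, v) \<in> joined G F" "refl R" "trans R"
    and "\<And>e b. e \<in> F \<Longrightarrow> (ends G e b, ends G e (\<not> b)) \<in> R"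
  shows "(u, v) \<in> R"
  using assms(1) unfolding joined_def
proof (induction rule: rtrancl_induct)
  case base
  show ?case using assms(2) by (simp add: refl_on_def)
next
  case (step y z)
  then show ?case using assms(3,4) by (auto dest: transD)
qed

lemma joined_closed:
  assumes "(u, v) \<in> joined G F" "u \<in> S"
    and "\<And>e b. e \<in> F \<Longrightarrow> ends G e b \<in> S \<Longrightarrow> ends G e (\<not> b) \<in> S"
  shows "v \<in> S"
  using assms(1) unfolding joined_def
proof (induction rule: rtrancl_induct)
  case (step y z)
  then show ?case using assms(3) by auto
qed (rule assms(2))

lemma joined_mono: "F \<subseteq> F' \<Longrightarrow> joined G F \<subseteq> joined G F'"
  unfolding joined_def by (intro rtrancl_mono) blast

lemma joined_monoD: "(u, v) \<in> joined G F \<Longrightarrow> F \<subseteq> F' \<Longrightarrow> (u, v) \<in> joined G F'"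
  using joined_mono by blast

lemma equiv_joined: "equiv UNIV (joined G F)"
  by (intro equivI refl_onI symI transI) (auto intro: joined_sym joined_trans)

lemma joined_class_eq_iff:
  "joined G F `` {u} = joined G F `` {v} \<longleftrightarrow> (u, v) \<in> joined G F"
  using eq_equiv_class_iff[OF equiv_joined] by simp

lemma joined_class_iff:
  assumes "S \<in> A // joined G F"
  shows "joined G F `` {u} = S \<longleftrightarrow> u \<in> S"
proof -
  obtain v where v: "S = joined G F `` {v}" using assms by (rule quotientE)
  show ?thesis unfolding v joined_class_eq_iff using joined_sym by auto
qed

text \<open>A vertex of the collapse is an \<open>F\<close>-component, so a path in the collapse
  lifts once the gaps between consecutive edges are bridged inside these components. Questions about
  collapsed graphs are moved to the original graph by this equivalence.\<close>

lemma joined_collapse: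
  "(joined G F `` {u}, joined G F `` {v}) \<in> joined (collapse G F) C \<longleftrightarrow> (u, v) \<in> joined G (F \<union> C)"
proof
  define R where "R = {(u, v). (joined G F `` {u}, joined G F `` {v}) \<in> joined (collapse G F) C}"
  assume "(u, v) \<in> joined G (F \<union> C)"
  then have "(u, v) \<in> R"
  proof (rule joined_least)
    fix e b assume "e \<in> F \<union> C"
    then have "e \<in> F \<or> e \<in> C" by simp
    then have "(joined G F `` {ends G e b}, joined G F `` {ends G e (\<not> b)}) \<in> joined (collapse G F) C"
    proof
      assume "e \<in> F"
      then have "joined G F `` {ends G e b} = joined G F `` {ends G e (\<not> b)}"
        unfolding joined_class_eq_iff by (rule joined_ends)
      then show ?thesis by simp
    next
      assume "e \<in> C"
      then show ?thesis
        using joined_ends[of e C "collapse G F" b "\<not> b"] by (simp add: collapse_def)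
    qed
    then show "(ends G e b, ends G e (\<not> b)) \<in> R" unfolding R_def by simp
  qed (auto simp: R_def intro!: refl_onI transI intro: joined_trans)
  then show "(joined G F `` {u}, joined G F `` {v}) \<in> joined (collapse G F) C"
    unfolding R_def by simp
next
  have "\<forall>w\<in>W. (u, w) \<in> joined G (F \<union> C)" if "(joined G F `` {u}, W) \<in> joined (collapse G F) C" for W
    using that unfolding joined_def[of "collapse G F"]
  proof (induction rule: rtrancl_induct)
    case base
    show ?case by (auto intro: joined_monoD)
  next
    case (step Y Z)
    then obtain e b where e: "e \<in> C" "Y = joined G F `` {ends G e b}" "Z = joined G F `` {ends G e (\<not> b)}"
      by (auto simp: collapse_def)
    have "(u, ends G e b) \<in> joined G (F \<union> C)"
      using step.IH e(2) by simp
    then have "(u, ends G e (\<not> b)) \<in> joined G (F \<union> C)"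
      using joined_ends[of e "F \<union> C" G b "\<not> b"] e(1) by (auto intro: joined_trans)
    moreover have "(ends G e (\<not> b), w) \<in> joined G (F \<union> C)" if "w \<in> Z" for w
      using that e(3) by (auto intro: joined_monoD)
    ultimately show ?case by (blast intro: joined_trans)
  qed
  then show "(joined G F `` {u}, joined G F `` {v}) \<in> joined (collapse G F) C \<Longrightarrow>
      (u, v) \<in> joined G (F \<union> C)"
    by auto
qed

lemma ends_collapse: "ends (collapse G F) e b = joined G F `` {ends G e b}"
  by (simp add: collapse_def)

lemma joined_verts:
  assumes "wf_graph G" "F \<subseteq> edges G" "(u, v) \<in> joined G F" "u \<in> verts G"
  shows "v \<in> verts G"
  using assms(3,4) by (rule joined_closed) (use assms(1,2) in \<open>auto simp: wf_graph_def\<close>)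

lemma separating_edge_sym:
  assumes "\<not> separating_edge G C e"
  shows "(ends G e b, ends G e c) \<in> joined G (C - {e})"
  using assms joined_sym[of _ _ G "C - {e}"] unfolding separating_edge_def by (cases b; cases c) auto

section \<open>Forests and their collapse\<close>

definition forest :: "('v, 'e, 'z) graph_scheme \<Rightarrow> 'e set \<Rightarrow> bool" where
  "forest G F \<longleftrightarrow> (\<forall>e\<in>F. separating_edge G F e)"

lemma forest_subset:
  assumes "forest G F" "F' \<subseteq> F"
  shows "forest G F'"
  using assms joined_monoD[of _ _ G "F' - {e}" "F - {e}" for e]
  unfolding forest_def separating_edge_def by blast

lemma joined_insert_cases:
  assumes "(u, v) \<in> joined G (insert e F)"
  shows "(u, v) \<in> joined G F \<or> (\<exists>b. (u, ends G e b) \<in> joined G F \<and> (ends G e (\<not> b), v) \<in> joined G F)"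
  using assms unfolding joined_def[of G "insert e F"]
proof (induction rule: rtrancl_induct)
  case base
  then show ?case by simp
next
  case (step y z)
  then obtain f b where f: "f = e \<or> f \<in> F" "y = ends G f b" "z = ends G f (\<not> b)" by auto
  show ?case
  proof (cases "f \<in> F")
    case True
    then have "(y, z) \<in> joined G F" using f by (simp add: joined_ends)
    then show ?thesis using step.IH by (auto intro: joined_trans)
  next
    case False
    then have [simp]: "f = e" using f by simp
    from step.IH show ?thesis
    proof (elim disjE exE conjE)
      assume "(u, y) \<in> joined G F"
      then show ?thesis using f by auto
    next
      fix c assume c: "(u, ends G e c) \<in> joined G F" "(ends G e (\<not> c), y) \<in> joined G F"
      show ?thesis
      proof (cases "c = b")
        case True
        then show ?thesis using c f by auto
      next
        case False
        then have "c = (\<not> b)" by simp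
        then show ?thesis using c f by auto
      qed
    qed
  qed
qed

text \<open>Each edge of a forest merges exactly two components of the edges added before it, so it
  lowers the number of classes by one. This is the invariance of the Euler characteristic under
  collapsing a forest.\<close>

lemma card_quotient_forest:
  assumes "finite V" "finite F" "\<And>e b. e \<in> F \<Longrightarrow> ends G e b \<in> V" "forest G F"
  shows "card (V // joined G F) + card F = card V"
  using assms(2-4)
proof (induction F rule: finite_induct)
  case empty
  have "joined G {} = Id" by (auto simp: joined_def)
  then have "V // joined G {} = (\<lambda>v. {v}) ` V" by (auto simp: quotient_def)
  then show ?case by (simp add: card_image)
next
  case (insert e F)
  let ?J = "joined G F" and ?K = "joined G (insert e F)"
  define A where "A = ?J `` {ends G e False}"
  define B where "B = ?J `` {ends G e True}"
  have IH: "card (V // ?J) + card F = card V"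
    using insert by (auto intro: forest_subset)
  have nj: "(ends G e False, ends G e True) \<notin> ?J"
    using insert.prems(2) insert.hyps by (simp add: forest_def separating_edge_def)
  then have AB: "A \<noteq> B"
    unfolding A_def B_def joined_class_eq_iff .
  have ABm: "A \<in> V // ?J" "B \<in> V // ?J"
    unfolding A_def B_def using insert.prems(1) by (auto intro: quotientI)
  have K: "?K `` {v} = (if v \<in> A \<union> B then A \<union> B else ?J `` {v})" for v
  proof (intro subset_antisym subsetI)
    fix w assume "w \<in> ?K `` {v}"
    then have "(v, w) \<in> ?J \<or> (\<exists>b. (v, ends G e b) \<in> ?J \<and> (ends G e (\<not> b), w) \<in> ?J)"
      using joined_insert_cases[of v w G e F] by auto
    then show "w \<in> (if v \<in> A \<union> B then A \<union> B else ?J `` {v})"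
      unfolding A_def B_def by (auto simp: ex_bool_eq intro: joined_trans joined_sym)
  next
    fix w assume w: "w \<in> (if v \<in> A \<union> B then A \<union> B else ?J `` {v})"
    have m: "(x, y) \<in> ?K" if "(x, y) \<in> ?J" for x y
      using that by (rule joined_monoD) auto
    have e: "(ends G e b, ends G e c) \<in> ?K" for b c by (simp add: joined_ends)
    have AB': "(ends G e False, x) \<in> ?K" if "x \<in> A \<union> B" for x
      using that m[of _ x] joined_trans[OF e[of False True] m] unfolding A_def B_def by auto
    show "w \<in> ?K `` {v}"
    proof (cases "v \<in> A \<union> B")
      case True
      then show ?thesis using w AB'[of v] AB'[of w] joined_trans[OF joined_sym] by simp
    qed (use w m in simp)
  qed
  have "V // ?K = insert (A \<union> B) (V // ?J - {A, B})"
  proof (intro subset_antisym subsetI)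
    fix S assume "S \<in> V // ?K"
    then obtain v where v: "v \<in> V" "S = ?K `` {v}" by (rule quotientE)
    show "S \<in> insert (A \<union> B) (V // ?J - {A, B})"
    proof (cases "v \<in> A \<union> B")
      case False
      then have S: "S = ?J `` {v}" using v(2) K[of v] by simp
      then have "S \<noteq> A" "S \<noteq> B" using False by auto
      then show ?thesis using v(1) S by (simp add: quotientI)
    next
      case True
      then show ?thesis using v(2) K[of v] by simp
    qed
  next
    fix S assume S: "S \<in> insert (A \<union> B) (V // ?J - {A, B})"
    show "S \<in> V // ?K"
    proof (cases "S = A \<union> B")
      case True
      have "ends G e False \<in> A" unfolding A_def by simp
      then have "S = ?K `` {ends G e False}" using K[of "ends G e False"] True by simp
      then show ?thesis using insert.prems(1)[of e False] by (simp add: quotientI)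
    next
      case False
      then obtain v where v: "v \<in> V" "S = ?J `` {v}" "S \<noteq> A" "S \<noteq> B"
        using S by (auto elim!: quotientE)
      have "v \<notin> A \<union> B"
        using v(2-4) unfolding A_def B_def by (metis Image_singleton_iff UnE joined_class_eq_iff)
      then have "S = ?K `` {v}" using v(2) K[of v] by simp
      then show ?thesis using v(1) by (simp add: quotientI)
    qed
  qed
  moreover have "A \<union> B \<notin> V // ?J - {A, B}"
  proof
    assume *: "A \<union> B \<in> V // ?J - {A, B}"
    have "ends G e False \<in> A \<union> B" "ends G e True \<in> A \<union> B"
      unfolding A_def B_def by auto
    then have "A = A \<union> B" "B = A \<union> B"
      using * joined_class_iff[of "A \<union> B" V G F] unfolding A_def B_def by auto
    then show False using AB by simp
  qed
  moreover have fin: "finite (V // ?J)"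
    using assms(1) unfolding quotient_def by simp
  ultimately have "card (V // ?K) = Suc (card (V // ?J - {A, B}))" by simp
  also have "\<dots> = Suc (card (V // ?J) - 2)"
    using ABm AB fin by (simp add: card_Diff_subset)
  also have "\<dots> = card (V // ?J) - 1"
    using ABm AB fin card_mono[OF fin, of "{A, B}"] by simp
  finally have "card (V // ?K) = card (V // ?J) - 1" .
  moreover have "card (V // ?J) \<ge> 2"
    using ABm AB fin card_mono[OF fin, of "{A, B}"] by simp
  ultimately show ?case using IH insert.hyps by simp
qed

lemma half_edges_collapse:
  assumes "S \<in> A // joined G F"
  shows "half_edges (collapse G F) C S = {(e, b). e \<in> C \<and> ends G e b \<in> S}"
  unfolding half_edges_def using joined_class_iff[OF assms] by (simp add: collapse_def)

text \<open>A component \<open>S\<close> with \<open>n\<close> vertices carries at least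
  \<open>3 n\<close> half-edges. Its fewer than \<open>n\<close> forest edges use up at most
  \<open>2 (n - 1)\<close> of them, so at least \<open>n + 2\<close> remain.\<close>

lemma valence_collapse_forest:
  assumes w: "wf_graph G" and F: "F \<subseteq> edges G" "forest G F"
    and val: "\<And>v. v \<in> verts G \<Longrightarrow> 3 \<le> valence G (edges G) v"
    and S: "S \<in> verts G // joined G F"
  shows "3 \<le> valence (collapse G F) (edges G - F) S"
proof -
  have fin: "finite (verts G)" "finite (edges G)" and ev: "\<And>e b. e \<in> edges G \<Longrightarrow> ends G e b \<in> verts G"
    using w unfolding wf_graph_def by auto
  obtain v where v: "v \<in> verts G" "S = joined G F `` {v}" using S by (rule quotientE)
  have SV: "S \<subseteq> verts G" using v joined_verts[OF w F(1)] by auto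
  then have finS: "finite S" using fin finite_subset by blast
  have "v \<in> S" using v by simp
  define H where "H C = {(e, b). e \<in> C \<and> ends G e b \<in> S}" for C
  define FS where "FS = {e \<in> F. ends G e False \<in> S}"
  have cl: "ends G e b \<in> S \<longleftrightarrow> ends G e c \<in> S" if "e \<in> F" for e b c
    unfolding v(2) using joined_trans[OF _ joined_ends[OF that, of G]] by auto
  have finH: "finite (H C)" if "C \<subseteq> edges G" for C
    by (rule finite_subset[of _ "edges G \<times> UNIV"]) (use that fin in \<open>auto simp: H_def\<close>)
  have "card (S // joined G FS) + card FS = card S"
  proof (rule card_quotient_forest[OF finS])
    show "finite FS" by (rule finite_subset[OF _ fin(2)]) (use F in \<open>auto simp: FS_def\<close>)
    show "forest G FS" using F(2) by (rule forest_subset) (auto simp: FS_def)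
    show "ends G e b \<in> S" if "e \<in> FS" for e b
      using that cl[of e b False] unfolding FS_def by auto
  qed
  moreover have "finite (S // joined G FS)" "S // joined G FS \<noteq> {}"
    using finS \<open>v \<in> S\<close> by (auto simp: quotient_def)
  then have "0 < card (S // joined G FS)" by (simp add: card_gt_0_iff)
  ultimately have FS: "card FS < card S" by simp
  have "H F = FS \<times> UNIV"
    unfolding H_def FS_def using cl by auto
  then have HF: "card (H F) = 2 * card FS" by (simp add: card_cartesian_product)
  have "H (edges G) = (\<Union>u\<in>S. half_edges G (edges G) u)"
    unfolding H_def half_edges_def by auto
  then have "card (H (edges G)) = (\<Sum>u\<in>S. card (half_edges G (edges G) u))"
    using finS finH[of "edges G"]
    by (simp only:, subst card_UN_disjoint) (auto simp: half_edges_def)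
  also have "\<dots> \<ge> (\<Sum>u\<in>S. 3)"
    using SV val unfolding valence_def by (intro sum_mono) auto
  finally have "3 * card S \<le> card (H (edges G))" by simp
  moreover have "H (edges G) = H (edges G - F) \<union> H F" "H (edges G - F) \<inter> H F = {}"
    using F(1) unfolding H_def by auto
  then have "card (H (edges G)) = card (H (edges G - F)) + card (H F)"
    using finH F(1) by (simp add: card_Un_disjoint)
  moreover have "valence (collapse G F) (edges G - F) S = card (H (edges G - F))"
    unfolding valence_def half_edges_collapse[OF S] H_def ..
  ultimately show ?thesis using FS HF by linarith
qed

text \<open>A non-separating edge can be left at either end through a different half-edge, which is
  its own other half if it is a loop. So the valence condition follows; in an infinite set of
  half-edges the count would be 0.\<close>

lemma core_iff:
  assumes "finite C"
  shows "core G C \<longleftrightarrow> C \<noteq> {} \<and> C \<subseteq> edges G \<and> (\<forall>e\<in>C. \<not> separating_edge G C e)"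
proof -
  have "2 \<le> valence G C (ends G e b)" if e: "e \<in> C" "\<not> separating_edge G C e" for e b
  proof -
    have "(ends G e b, ends G e (\<not> b)) \<in> joined G (C - {e})"
      using separating_edge_sym[OF e(2)] .
    then obtain h where h: "h \<in> half_edges G C (ends G e b)" "h \<noteq> (e, b)"
      unfolding joined_def
    proof (cases rule: converse_rtranclE)
      case base
      then show ?thesis using that[of "(e, \<not> b)"] e by (simp add: half_edges_def)
    next
      case (step y)
      then obtain f c where "f \<in> C" "f \<noteq> e" "ends G e b = ends G f c" by auto
      then show ?thesis using that[of "(f, c)"] by (simp add: half_edges_def)
    qed
    have "finite (half_edges G C (ends G e b))"
      by (rule finite_subset[of _ "C \<times> UNIV"]) (auto simp: half_edges_def assms)
    moreover have "{h, (e, b)} \<subseteq> half_edges G C (ends G e b)"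
      using h e by (simp add: half_edges_def)
    ultimately have "card {h, (e, b)} \<le> valence G C (ends G e b)"
      unfolding valence_def by (rule card_mono)
    then show ?thesis using h(2) by simp
  qed
  then show ?thesis unfolding core_def by blast
qed

text \<open>A graph without isolated vertices is determined by its edges and by which half-edges
  meet. This makes graphs comparable whose vertices are classes of different kinds.\<close>

lemma graph_iso_half_edges:
  fixes G :: "('v, 'e, 'y) graph_scheme" and H :: "('w, 'e, 'z) graph_scheme"
  assumes "edges H = edges G"
    and "verts G = {ends G e b | e b. e \<in> edges G}" "verts H = {ends H e b | e b. e \<in> edges H}"
    and eq: "\<And>e b f c. e \<in> edges G \<Longrightarrow> f \<in> edges G \<Longrightarrow>
      ends H e b = ends H f c \<longleftrightarrow> ends G e b = ends G f c"
  obtains \<phi> where "graph_iso \<phi> id G H"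
proof -
  define P where "P v eb \<longleftrightarrow> fst eb \<in> edges G \<and> ends G (fst eb) (snd eb) = v" for v and eb :: "'e \<times> bool"
  \<comment> \<open>The image of a vertex is found from an arbitrary half-edge at it; by
    \<open>eq\<close> the choice does not matter.\<close>
  define \<phi> where "\<phi> v = (let eb = SOME eb. P v eb in ends H (fst eb) (snd eb))" for v
  have \<phi>: "\<phi> (ends G e b) = ends H e b" if "e \<in> edges G" for e b
  proof -
    define eb where "eb = (SOME eb. P (ends G e b) eb)"
    have "P (ends G e b) (e, b)" using that by (simp add: P_def)
    then have "P (ends G e b) eb" unfolding eb_def by (rule someI)
    then show ?thesis unfolding \<phi>_def eb_def[symmetric] Let_def using eq[of "fst eb" e] that
      by (simp add: P_def)
  qed
  have "bij_betw \<phi> (verts G) (verts H)"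
    unfolding bij_betw_def
  proof (intro conjI inj_onI set_eqI iffI)
    fix u v assume "u \<in> verts G" "v \<in> verts G" "\<phi> u = \<phi> v"
    then show "u = v" unfolding assms(2) using eq \<phi> by auto
  next
    fix x assume "x \<in> \<phi> ` verts G"
    then show "x \<in> verts H" unfolding assms(2,3) using \<phi> assms(1) by auto
  next
    fix x assume "x \<in> verts H"
    then obtain e b where "e \<in> edges G" "x = ends H e b" unfolding assms(3) using assms(1) by auto
    then show "x \<in> \<phi> ` verts G" unfolding assms(2) using \<phi>[symmetric] by auto
  qed
  then have "graph_iso \<phi> id G H" unfolding graph_iso_def using assms(1) \<phi> by simp
  then show thesis by (rule that)
qed

lemma wf_collapse:
  assumes "wf_graph G"
  shows "wf_graph (collapse G F)"
  using assms unfolding wf_graph_def collapse_def by (auto simp: quotient_def)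

lemma connected_collapse:
  assumes "connected_graph G" "F \<subseteq> edges G"
  shows "connected_graph (collapse G F)"
proof -
  have "(U, V) \<in> joined (collapse G F) (edges (collapse G F))"
    if UV: "U \<in> verts (collapse G F)" "V \<in> verts (collapse G F)" for U V
  proof -
    obtain u v where "u \<in> verts G" "v \<in> verts G" "U = joined G F `` {u}" "V = joined G F `` {v}"
      using UV unfolding collapse_def by (auto elim!: quotientE)
    moreover have "F \<union> edges (collapse G F) = edges G"
      using assms(2) by (auto simp: collapse_def)
    ultimately show ?thesis
      using assms(1) unfolding connected_graph_def by (simp add: joined_collapse)
  qed
  moreover have "verts (collapse G F) \<noteq> {}"
    using assms(1) unfolding connected_graph_def collapse_def by simp
  ultimately show ?thesis unfolding connected_graph_def by blast
qed

lemma verts_eq_ends: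
  assumes "wf_graph G" "\<And>v. v \<in> verts G \<Longrightarrow> 3 \<le> valence G (edges G) v"
  shows "verts G = {ends G e b | e b. e \<in> edges G}"
proof (intro subset_antisym subsetI)
  fix v assume "v \<in> verts G"
  then have "half_edges G (edges G) v \<noteq> {}"
    using assms(2)[of v] unfolding valence_def by auto
  then show "v \<in> {ends G e b | e b. e \<in> edges G}" unfolding half_edges_def by auto
qed (use assms(1) in \<open>auto simp: wf_graph_def\<close>)

text \<open>The collapsed edge accounts for at most two of the half-edges at a vertex, so valence 3
  leaves another edge there.\<close>

lemma verts_collapse_eq_ends:
  assumes w: "wf_graph G" and v: "\<And>v. v \<in> verts G \<Longrightarrow> 3 \<le> valence G (edges G) v"
  shows "verts (collapse G {x}) = {ends (collapse G {x}) e b | e b. e \<in> edges (collapse G {x})}"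
proof (intro subset_antisym subsetI)
  fix V assume "V \<in> verts (collapse G {x})"
  then obtain v where V: "v \<in> verts G" "V = joined G {x} `` {v}"
    unfolding collapse_def by (auto elim!: quotientE)
  have "\<not> half_edges G (edges G) v \<subseteq> {(x, False), (x, True)}"
    using v[OF V(1)] card_mono[of "{(x, False), (x, True)}" "half_edges G (edges G) v"]
    unfolding valence_def by auto
  then obtain e b where "e \<in> edges G" "ends G e b = v" "e \<noteq> x"
    unfolding half_edges_def by auto
  then show "V \<in> {ends (collapse G {x}) e b | e b. e \<in> edges (collapse G {x})}"
    using V(2) unfolding collapse_def by auto
qed (use w in \<open>auto simp: wf_graph_def collapse_def intro: quotientI\<close>)

lemma ends_collapse_eq_iff:
  "ends (collapse G F) e b = ends (collapse G F) f c \<longleftrightarrow> (ends G e b, ends G f c) \<in> joined G F"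
  unfolding ends_collapse joined_class_eq_iff ..

lemma joined_ends_collapse:
  "(ends (collapse G F) e b, ends (collapse G F) f c) \<in> joined (collapse G F) C \<longleftrightarrow>
    (ends G e b, ends G f c) \<in> joined G (F \<union> C)"
  unfolding ends_collapse joined_collapse ..

lemma joined_cong_iff:
  assumes "(u, a) \<in> joined G F" "(v, b) \<in> joined G F"
  shows "(u, v) \<in> joined G F \<longleftrightarrow> (a, b) \<in> joined G F"
  using assms unfolding joined_class_eq_iff[symmetric] by simp

lemma forest_maximal_tree: "maximal_tree X T \<Longrightarrow> forest X T"
  unfolding maximal_tree_def forest_def by simp

section \<open>Chains of filtered graphs\<close>

lemma filtered_graph_wf: "filtered_graph r g \<Longrightarrow> wf_fgraph g"
  unfolding filtered_graph_def wf_fgraph_def core_def by auto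

lemma filtered_graph_iso:
  assumes g: "filtered_graph r g" and i: "signed_iso s g h"
  shows "filtered_graph r h" "fdegree h = fdegree g"
proof -
  obtain \<phi> \<psi> where fi: "filtered_iso \<phi> \<psi> g h"
    using i unfolding signed_iso_def by auto
  have gi: "graph_iso \<phi> \<psi> g h" and f: "filt h = map (image \<psi>) (filt g)"
    using fi unfolding filtered_iso_def by auto
  have b: "bij_betw \<phi> (verts g) (verts h)" "bij_betw \<psi> (edges g) (edges h)"
    using gi unfolding graph_iso_def by auto
  have inj: "inj_on \<psi> (edges g)" and im: "edges h = \<psi> ` edges g" and vim: "verts h = \<phi> ` verts g"
    using b bij_betw_imp_inj_on bij_betw_imp_surj_on by blast+
  have wg: "wf_fgraph g" using filtered_graph_wf[OF g] .
  have wh: "wf_fgraph h" using signed_iso_wf[OF wg i] .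
  have w: "wf_graph g" and cg: "connected_graph g" and rk: "rank g = r"
    and val: "\<forall>v\<in>verts g. 3 \<le> valence g (edges g) v" and co: "\<forall>C\<in>set (filt g). core g C"
    and so: "sorted_wrt (\<subset>) (stages g)" and sub: "\<forall>C\<in>set (filt g). C \<subseteq> edges g"
    using g unfolding filtered_graph_def core_def by auto
  have st: "stages h = map (image \<psi>) (stages g)"
    unfolding stages_def f im by simp
  have "sorted_wrt (\<subset>) (stages h)"
    unfolding st sorted_wrt_map
  proof (rule sorted_wrt_mono_rel[OF _ so])
    fix A B assume "A \<in> set (stages g)" "B \<in> set (stages g)" "A \<subset> B"
    then show "\<psi> ` A \<subset> \<psi> ` B"
      using psubset_image_iff[OF inj, of A B] sub unfolding stages_def by auto
  qed
  moreover have "connected_graph h"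
    using cg joined_iso[OF gi w subset_refl] unfolding connected_graph_def vim im by auto
  moreover have "rank h = r"
    using rk bij_betw_same_card[OF b(1)] bij_betw_same_card[OF b(2)] unfolding rank_def by simp
  moreover have "\<forall>v\<in>verts h. 3 \<le> valence h (edges h) v"
    using val valence_iso[OF gi w subset_refl] unfolding vim im by auto
  moreover have "\<forall>C\<in>set (filt h). core h C"
    using co core_iso[OF gi w] sub unfolding f by auto
  ultimately show "filtered_graph r h"
    using wh unfolding filtered_graph_def wf_fgraph_def by simp
  show "fdegree h = fdegree g"
    unfolding fdegree_def st using bij_betw_same_card[OF b(2)] by simp
qed

text \<open>\<open>chains\<close> is spanned by graphs on natural numbers; an isomorphic model of
  this kind represents the same element.\<close>

lemma gen_in_chains:
  assumes "filtered_graph r g"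
  shows "gen g \<in> chains r (fdegree g)"
proof -
  have wg: "wf_fgraph g" using filtered_graph_wf[OF assms] .
  obtain h :: "(nat, nat) fgraph" where h: "oriented_iso g h"
    using nat_model_exists[OF wg] by blast
  then have h': "signed_iso 1 g h" by (simp add: oriented_iso_signed)
  have "gen g = gen h"
    using gen_signed_iso[OF wg h'] by simp
  then show ?thesis
    unfolding chains_def using filtered_graph_iso[OF assms h'] by (auto intro!: bchain.span_base)
qed

section \<open>Linearity of the boundary and the homology relation\<close>

lemma chains_sum: "(\<And>i. i \<in> A \<Longrightarrow> f i \<in> chains r n) \<Longrightarrow> (\<Sum>i\<in>A. f i) \<in> chains r n"
  unfolding chains_def by (rule bchain.span_sum)

lemma chains_scale: "x \<in> chains r n \<Longrightarrow> a *\<^sub>Q x \<in> chains r n"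
  unfolding chains_def by (rule bchain.span_scale)

lemma boundary_add: "boundary (x + y) = boundary x + boundary y"
  by (rule linear_boundary[THEN Vector_Spaces.linear.axioms(3), THEN module_hom.add])

lemma boundary_scale: "boundary (a *\<^sub>Q x) = a *\<^sub>Q boundary x"
  by (rule linear_boundary[THEN Vector_Spaces.linear.axioms(3), THEN module_hom.scale])

lemma boundary_sum: "boundary (\<Sum>i\<in>A. f i) = (\<Sum>i\<in>A. boundary (f i))"
  by (rule linear_boundary[THEN Vector_Spaces.linear.axioms(3), THEN module_hom.sum])

lemma boundaries_scale:
  assumes "x \<in> boundaries r n"
  shows "a *\<^sub>Q x \<in> boundaries r n"
  using assms unfolding boundaries_def by (auto intro: chains_scale simp flip: boundary_scale)

lemma boundaries_add:
  assumes "x \<in> boundaries r n" "y \<in> boundaries r n"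
  shows "x + y \<in> boundaries r n"
  using assms unfolding boundaries_def chains_def
  by (auto intro: bchain.span_add simp flip: boundary_add)

lemma boundaries_zero: "0 \<in> boundaries r n"
proof -
  have "boundary (0 *\<^sub>Q 0) = 0 *\<^sub>Q boundary 0" by (rule boundary_scale)
  moreover have "0 \<in> chains r (n + 1)" unfolding chains_def by (rule bchain.span_zero)
  ultimately show ?thesis unfolding boundaries_def by force
qed

lemma homologous_refl: "z \<in> cycles r n \<Longrightarrow> (z, z) \<in> homologous r n"
  unfolding homologous_def using boundaries_zero by simp

lemma homologous_sym: "(z, z') \<in> homologous r n \<Longrightarrow> (z', z) \<in> homologous r n"
  unfolding homologous_def using boundaries_scale[of "z - z'" r n "- 1"] by auto

lemma homologous_trans:
  "(x, y) \<in> homologous r n \<Longrightarrow> (y, z) \<in> homologous r n \<Longrightarrow> (x, z) \<in> homologous r n"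
  unfolding homologous_def using boundaries_add[of "x - y" r n "y - z"] by auto

lemma homology_class_eqI:
  assumes "(z, z') \<in> homologous r n"
  shows "homology_class r n z = homology_class r n z'"
  using homologous_trans[OF assms] homologous_trans[OF homologous_sym[OF assms]]
  unfolding homology_class_def by auto


section \<open>Filtrations by blocks of edges\<close>

text \<open>One list records both orientation and filtration: the stages are the unions of its
  initial segments. The range starts at 1 and stops before the last index because
  \<open>filt\<close> lists neither the empty graph nor the whole one.\<close>

definition block_graph :: "('v, 'e, 'z) graph_scheme \<Rightarrow> 'e list list \<Rightarrow> ('v, 'e) fgraph" where
  "block_graph G bs =
     \<lparr>verts = verts G, edges = edges G, ends = ends G,
      filt = map (\<lambda>j. set (concat (take j bs))) [1..<length bs], eord = concat bs\<rparr>"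

definition block_decomp :: "('v, 'e, 'z) graph_scheme \<Rightarrow> 'e list list \<Rightarrow> bool" where
  "block_decomp G bs \<longleftrightarrow> bs \<noteq> [] \<and> [] \<notin> set bs \<and> distinct (concat bs) \<and> set (concat bs) = edges G"

lemma block_graph_simps [simp]:
  "verts (block_graph G bs) = verts G" "edges (block_graph G bs) = edges G"
  "ends (block_graph G bs) = ends G" "eord (block_graph G bs) = concat bs"
  "joined (block_graph G bs) = joined G" "core (block_graph G bs) = core G"
  "valence (block_graph G bs) = valence G" "wf_graph (block_graph G bs) = wf_graph G"
  "rank (block_graph G bs) = rank G" "connected_graph (block_graph G bs) = connected_graph G"
  unfolding block_graph_def joined_def core_def separating_edge_def valence_def half_edges_def
    wf_graph_def rank_def connected_graph_def fun_eq_iff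
  by simp_all

lemma wf_block_graph:
  assumes "distinct (concat bs)" "set (concat bs) = edges G" "wf_graph G"
  shows "wf_fgraph (block_graph G bs)"
proof -
  have "set (concat (take j bs)) \<subseteq> edges G" for j
    using assms(2) by (auto dest: in_set_takeD)
  then show ?thesis
    using assms unfolding wf_fgraph_def
    by (simp del: set_concat) (simp add: block_graph_def del: set_concat)
qed

lemma stages_block_graph:
  assumes "block_decomp G bs"
  shows "{} # stages (block_graph G bs) = map (\<lambda>j. set (concat (take j bs))) [0..<Suc (length bs)]"
proof -
  have "bs \<noteq> []" using assms unfolding block_decomp_def by simp
  then have "[0..<Suc (length bs)] = 0 # [1..<length bs] @ [length bs]"
    by (simp add: upt_conv_Cons)
  then show ?thesis
    using assms unfolding block_decomp_def stages_def block_graph_def by simp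
qed

lemma length_stages_block_graph:
  assumes "block_decomp G bs"
  shows "length (stages (block_graph G bs)) = length bs"
  using arg_cong[OF stages_block_graph[OF assms], of length] by simp

lemma block_decomp_split:
  assumes "block_decomp G bs" "e \<in> edges G"
  obtains us b vs where "bs = us @ b # vs" "e \<in> set b"
proof -
  obtain b where "b \<in> set bs" "e \<in> set b"
    using assms unfolding block_decomp_def by auto
  then show thesis using that split_list by metis
qed

lemma concat_take_mono: "i \<le> j \<Longrightarrow> set (concat (take i bs)) \<subseteq> set (concat (take j bs))"
  using set_take_subset_set_take[of i j bs] by auto

lemma concat_take_strict:
  assumes "distinct (concat bs)" "[] \<notin> set bs" "i < j" "i < length bs"
  shows "set (concat (take i bs)) \<subset> set (concat (take j bs))"
proof -
  have bs: "bs = take i bs @ bs ! i # drop (Suc i) bs"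
    using assms(4) by (rule id_take_nth_drop)
  have "distinct (concat (take i bs @ bs ! i # drop (Suc i) bs))"
    using assms(1) bs by simp
  then have "set (bs ! i) \<inter> set (concat (take i bs)) = {}"
    by (simp only: concat_append concat.simps distinct_append) auto
  moreover have "bs ! i \<noteq> []" using assms(2,4) nth_mem by metis
  moreover have "set (bs ! i) \<union> set (concat (take i bs)) \<subseteq> set (concat (take (Suc i) bs))"
    using assms(4) by (simp add: take_Suc_conv_app_nth)
  moreover have "set (concat (take (Suc i) bs)) \<subseteq> set (concat (take j bs))"
    using assms(3) by (intro concat_take_mono) simp
  ultimately show ?thesis by (cases "bs ! i") (auto simp del: set_concat)
qed

lemma filtered_block_graph:
  assumes d: "block_decomp G bs"
    and "wf_graph G" "connected_graph G" "rank G = r" "\<forall>v\<in>verts G. 3 \<le> valence G (edges G) v"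
    and core: "\<And>us vs. bs = us @ vs \<Longrightarrow> us \<noteq> [] \<Longrightarrow> vs \<noteq> [] \<Longrightarrow> core G (set (concat us))"
  shows "filtered_graph r (block_graph G bs)"
    and "fdegree (block_graph G bs) = int (card (edges G)) - int (length bs)"
proof -
  have "core G C" if C: "C \<in> set (filt (block_graph G bs))" for C
  proof -
    obtain j where j: "C = set (concat (take j bs))" "1 \<le> j" "j < length bs"
      using C unfolding block_graph_def by (auto simp del: set_concat)
    then show ?thesis
      using core[of "take j bs" "drop j bs"] by (cases bs) auto
  qed
  moreover have "set (concat (take i bs)) \<subset> set (concat (take j bs))"
    if "i < j" "j \<le> length bs" for i j
    using concat_take_strict[of bs i j] d that unfolding block_decomp_def by simp
  then have "sorted_wrt (\<subset>) ({} # stages (block_graph G bs))"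
    unfolding stages_block_graph[OF d] sorted_wrt_map sorted_wrt_iff_nth_less
    by (simp del: upt_Suc set_concat)
  ultimately show "filtered_graph r (block_graph G bs)"
    using assms unfolding filtered_graph_def block_decomp_def by simp
  show "fdegree (block_graph G bs) = int (card (edges G)) - int (length bs)"
    unfolding fdegree_def length_stages_block_graph[OF d] by simp
qed

text \<open>\<open>C\<close> is comparable with every stage, so it lies strictly between two
  consecutive ones and cuts a single block in two.\<close>

lemma insertable_block_graph:
  assumes d: "block_decomp G bs" and C: "insertable (block_graph G bs) C"
  obtains us b vs where "bs = us @ b # vs" "core G C"
    "set (concat us) \<subset> C" "C \<subset> set (concat us) \<union> set b"
proof -
  define S where "S j = set (concat (take j bs))" for j
  have core: "core G C" "C \<subset> edges G"
    using C unfolding insertable_def by auto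
  have ne: "C \<noteq> {}" using core(1) unfolding core_def by blast
  have len: "S (length bs) = edges G" using d unfolding S_def block_decomp_def by simp
  have cmp: "S j \<subset> C \<or> C \<subset> S j" if "j \<le> length bs" for j
  proof (cases "j = 0 \<or> j = length bs")
    case True
    then show ?thesis
    proof
      assume "j = 0"
      then show ?thesis using ne by (auto simp: S_def)
    next
      assume "j = length bs"
      then show ?thesis using core(2) len by simp
    qed
  next
    case False
    then have "S j \<in> set (filt (block_graph G bs))"
      using that unfolding block_graph_def S_def by (auto simp del: set_concat)
    then show ?thesis using C unfolding insertable_def by auto
  qed
  \<comment> \<open>The block is the one that completes the first stage strictly containing
    \<open>C\<close>. Such a stage exists since the last one is the whole graph.\<close>
  define j where "j = (LEAST j. C \<subset> S j)"
  have j: "C \<subset> S j" "j \<le> length bs"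
    using core(2) len unfolding j_def by (metis LeastI, metis Least_le)
  have "j \<noteq> 0" using j(1) by (auto simp: S_def)
  then obtain i where i: "j = Suc i" by (cases j) auto
  have "\<not> C \<subset> S i" using not_less_Least[of i "\<lambda>j. C \<subset> S j"] i unfolding j_def by simp
  then have "S i \<subset> C" using cmp[of i] j(2) i by auto
  moreover have "C \<subset> S i \<union> set (bs ! i)"
    using j i by (simp add: S_def take_Suc_conv_app_nth)
  moreover have "bs = take i bs @ bs ! i # drop (Suc i) bs"
    using j(2) i by (intro id_take_nth_drop) simp
  ultimately show thesis using that core(1) unfolding S_def by blast
qed

text \<open>The stages avoiding \<open>e\<close> are those before its block, and joinedness grows
  with the stage, so only the last of them has to be tested. If \<open>us\<close> is empty, the test
  says that \<open>e\<close> is not a loop.\<close>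

lemma collapsible_block_graph:
  assumes d: "block_decomp G bs" and bs: "bs = us @ b # vs" and e: "e \<in> set b"
  shows "collapsible (block_graph G bs) e \<longleftrightarrow>
    b \<noteq> [e] \<and> (ends G e False, ends G e True) \<notin> joined G (set (concat us))"
proof -
  let ?S = "\<lambda>j. set (concat (take j bs))" and ?n = "length us"
  have dist: "distinct (concat bs)" and eE: "e \<in> edges G"
    using d bs e unfolding block_decomp_def by auto
  have ne: "e \<notin> set (concat us)" "distinct b" using dist bs e by auto
  have S_small: "?S j \<subseteq> set (concat us)" if "j \<le> ?n" for j
    using concat_take_mono[of j ?n us] that bs by simp
  have S_big: "e \<in> ?S j" if "j > ?n" for j
    using concat_take_mono[of "Suc ?n" j bs] that bs e by auto
  have diff: "({} # stages (block_graph G bs)) ! Suc i - ({} # stages (block_graph G bs)) ! i = set (bs ! i)"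
    if i: "i < length bs" for i
  proof -
    have "bs = take i bs @ bs ! i # drop (Suc i) bs"
      using i by (rule id_take_nth_drop)
    then have "distinct (concat (take i bs @ bs ! i # drop (Suc i) bs))"
      using dist by simp
    then have "set (concat (take i bs)) \<inter> set (bs ! i) = {}"
      by (simp only: concat_append concat.simps distinct_append) auto
    moreover have "?S (Suc i) = ?S i \<union> set (bs ! i)"
      using i by (simp add: take_Suc_conv_app_nth)
    ultimately show ?thesis
      unfolding stages_block_graph[OF d] using i by (simp del: upt_Suc) blast
  qed
  have "(\<exists>i < length bs. set (bs ! i) = {e}) \<longleftrightarrow> b = [e]"
  proof
    assume "\<exists>i < length bs. set (bs ! i) = {e}"
    then obtain i where i: "i < length bs" "set (bs ! i) = {e}" by blast
    have "i = ?n"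
    proof (rule ccontr)
      assume "i \<noteq> ?n"
      then have "bs ! i \<in> set us \<union> set vs"
        using i(1) bs by (auto simp: nth_append nth_Cons split: nat.splits)
      then have "e \<in> set (concat us) \<union> set (concat vs)" using i(2) by auto
      then show False using dist bs e by auto
    qed
    then have "set b = {e}" using i bs by simp
    then show "b = [e]" using ne(2) by (cases b; cases "tl b") auto
  next
    assume "b = [e]"
    then show "\<exists>i < length bs. set (bs ! i) = {e}" using bs by (intro exI[of _ ?n]) simp
  qed
  then have 1: "(\<forall>i < length (stages (block_graph G bs)).
      ({} # stages (block_graph G bs)) ! Suc i - ({} # stages (block_graph G bs)) ! i \<noteq> {e}) \<longleftrightarrow> b \<noteq> [e]"
    unfolding length_stages_block_graph[OF d] using diff by auto
  have filt: "set (filt (block_graph G bs)) = ?S ` {1..<length bs}"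
    by (simp add: block_graph_def)
  have 2: "(ends G e False \<noteq> ends G e True \<and>
      (\<forall>F\<in>set (filt (block_graph G bs)). e \<notin> F \<longrightarrow> (ends G e False, ends G e True) \<notin> joined G F)) \<longleftrightarrow>
      (ends G e False, ends G e True) \<notin> joined G (set (concat us))" (is "?L \<longleftrightarrow> ?R")
  proof
    assume R: ?R
    then have "ends G e False \<noteq> ends G e True" by auto
    moreover have "(ends G e False, ends G e True) \<notin> joined G (?S j)" if "e \<notin> ?S j" for j
    proof -
      have "j \<le> ?n" using that S_big[of j] by (cases "j \<le> ?n") auto
      then show ?thesis using R joined_monoD[OF _ S_small[of j]] by metis
    qed
    ultimately show ?L unfolding filt by blast
  next
    assume L: ?L
    show ?R
    proof (cases "us = []")
      case True
      then show ?thesis using L by (simp add: joined_def)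
    next
      case False
      then have "?S ?n \<in> set (filt (block_graph G bs))"
        unfolding filt using bs False by (intro image_eqI[of _ _ ?n]) (auto simp: Suc_le_eq)
      moreover have "?S ?n = set (concat us)" using bs by simp
      ultimately show ?thesis using L ne(1) by simp
    qed
  qed
  show ?thesis
    unfolding collapsible_def 1 using 2 eE by auto
qed

lemma collapse_edge_block_graph:
  "collapse_edge (block_graph G bs) e = block_graph (collapse G {e}) (map (filter (\<lambda>x. x \<noteq> e)) bs)"
  unfolding collapse_edge_def block_graph_def Let_def collapse_def
  by (auto simp: filter_concat take_map joined_def)

text \<open>The isomorphism is the identity on edges, so it keeps all blocks and their order and no
  sign arises.\<close>

lemma gen_block_graph_cong:
  assumes d: "distinct (concat bs)" "set (concat bs) = edges G" and w: "wf_graph G" and E: "edges H = edges G"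
    and v: "verts G = {ends G e b | e b. e \<in> edges G}" "verts H = {ends H e b | e b. e \<in> edges H}"
    and eq: "\<And>e b f c. e \<in> edges G \<Longrightarrow> f \<in> edges G \<Longrightarrow>
      ends H e b = ends H f c \<longleftrightarrow> ends G e b = ends G f c"
  shows "gen (block_graph H bs) = gen (block_graph G bs)"
proof -
  obtain \<phi> where \<phi>: "graph_iso \<phi> id G H"
    using graph_iso_half_edges[OF E v eq] .
  then have "filtered_iso \<phi> id (block_graph G bs) (block_graph H bs)"
    unfolding filtered_iso_def graph_iso_def by (simp add: block_graph_def)
  then have "signed_iso 1 (block_graph G bs) (block_graph H bs)"
    unfolding signed_iso_def using reordering_refl[of "concat bs"] by (intro exI[of _ \<phi>] exI[of _ id]) simp
  from gen_signed_iso[OF wf_block_graph[OF d w] this] show ?thesis by simp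
qed

section \<open>Moving blocks and refining a filtration\<close>

lemma reordering_append: "reordering s xs ys \<Longrightarrow> reordering s (us @ xs) (us @ ys)"
  by (induction us) (auto intro: reordering_Cons)

lemma reordering_swap_lists:
  "reordering ((-1) ^ (length xs * length ys)) (xs @ ys @ zs) (ys @ xs @ zs)"
proof (induction ys)
  case Nil
  show ?case by (simp add: reordering_refl)
next
  case (Cons y ys)
  show ?case
    using reordering_trans[OF reordering_front[of xs y "ys @ zs"] reordering_Cons[OF Cons, of y]]
    by (simp add: power_add)
qed

lemma gen_reorder:
  assumes "wf_fgraph g" "filt h = filt g" "graph_iso id id g h" "reordering s (eord g) (eord h)"
  shows "gen h = of_int s *\<^sub>Q gen g"
proof -
  have "filtered_iso id id g h"
    using assms(2,3) unfolding filtered_iso_def by simp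
  then have "signed_iso s g h"
    unfolding signed_iso_def using assms(4) by (metis list.map_id)
  then show ?thesis by (rule gen_signed_iso[OF assms(1)])
qed

text \<open>Cutting a block in two amounts to inserting one stage. The stages before it are the
  nonempty initial segments of \<open>us\<close>, which explains the position
  \<open>Suc (length us)\<close> and later the sign.\<close>

lemma filt_split_block:
  fixes G :: "('v, 'e, 'z) graph_scheme"
  assumes d: "block_decomp G (us @ (b @ b') # vs)" and b: "b \<noteq> []" "b' \<noteq> []"
  defines "C \<equiv> set (concat us) \<union> set b"
  defines "M \<equiv> us @ (b @ b') # vs"
  shows "insert_core (block_graph G M) C = block_graph G (us @ b # b' # vs)"
    and "position C (filt (insert_core (block_graph G M) C)) = Suc (length us)"
    and "\<And>F. F \<in> set (filt (block_graph G M)) \<Longrightarrow> F \<subset> C \<or> C \<subset> F"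
    and "C \<subset> edges G"
proof -
  let ?n = "length us"
  have dist: "distinct (concat M)" and ne: "[] \<notin> set M" and E: "set (concat M) = edges G"
    using d unfolding block_decomp_def M_def by simp_all
  \<comment> \<open>\<open>Lo\<close> and \<open>Hi\<close> are the stages below and above
    \<open>C\<close>. \<open>Hi\<close> begins with the end of the merged block; its range stops
    before \<open>length vs\<close>, where the whole graph would appear.\<close>
  define Lo where "Lo = map (\<lambda>j. set (concat (take j us))) [1..<Suc ?n]"
  define Hi where "Hi = map (\<lambda>j. C \<union> set b' \<union> set (concat (take j vs))) [0..<length vs]"
  have range1: "[1..<length M] = [1..<Suc ?n] @ map (\<lambda>j. j + Suc ?n) [0..<length vs]"
  proof -
    have "[1..<length M] = [1..<Suc ?n] @ [Suc ?n..<Suc ?n + length vs]"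
      unfolding M_def using upt_add_eq_append[of 1 "Suc ?n" "length vs"] by (simp del: upt_Suc)
    then show ?thesis by (simp only: map_add_upt add.commute)
  qed
  have range2: "[1..<length (us @ b # b' # vs)] =
      [1..<Suc ?n] @ Suc ?n # map (\<lambda>j. j + Suc (Suc ?n)) [0..<length vs]"
  proof -
    have "[1..<length (us @ b # b' # vs)] = [1..<Suc ?n] @ [Suc ?n..<Suc ?n + Suc (length vs)]"
      using upt_add_eq_append[of 1 "Suc ?n" "Suc (length vs)"] by (simp del: upt_Suc)
    moreover have "[Suc ?n..<Suc ?n + Suc (length vs)] = Suc ?n # [Suc (Suc ?n)..<Suc (Suc ?n) + length vs]"
      by (simp add: upt_conv_Cons del: upt_Suc)
    moreover have "[Suc (Suc ?n)..<Suc (Suc ?n) + length vs] = map (\<lambda>j. j + Suc (Suc ?n)) [0..<length vs]"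
      by (simp only: map_add_upt add.commute)
    ultimately show ?thesis by simp
  qed
  have filtM: "filt (block_graph G M) = Lo @ Hi"
  proof -
    have "map (\<lambda>j. set (concat (take j M))) [1..<Suc ?n] = Lo"
      "map (\<lambda>j. set (concat (take (j + Suc ?n) M))) [0..<length vs] = Hi"
      unfolding Lo_def Hi_def C_def M_def by (auto simp del: upt_Suc)
    then show ?thesis
      by (simp only: block_graph_def fgraph.simps range1 map_append map_map comp_def)
  qed
  have filtS: "filt (block_graph G (us @ b # b' # vs)) = Lo @ C # Hi"
  proof -
    let ?N = "us @ b # b' # vs"
    have "map (\<lambda>j. set (concat (take j ?N))) [1..<Suc ?n] = Lo" "set (concat (take (Suc ?n) ?N)) = C"
      "map (\<lambda>j. set (concat (take (j + Suc (Suc ?n)) ?N))) [0..<length vs] = Hi"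
      unfolding Lo_def Hi_def C_def by (auto simp del: upt_Suc)
    then show ?thesis
      by (simp only: block_graph_def fgraph.simps range2 map_append list.map map_map comp_def)
  qed
  have disj: "set (concat us) \<inter> set b = {}" "(set (concat us) \<union> set b) \<inter> set b' = {}"
    using dist unfolding M_def by auto
  have lo: "F \<subset> C" if "F \<in> set Lo" for F
  proof -
    obtain j where "F = set (concat (take j us))" using \<open>F \<in> set Lo\<close> unfolding Lo_def by (auto simp del: set_concat)
    then have "F \<subseteq> set (concat us)" using concat_take_mono[of j "length us" us] by (cases "j \<le> length us") (auto simp del: set_concat)
    then show ?thesis using disj(1) b(1) unfolding C_def by (cases b) (auto simp del: set_concat)
  qed
  have hi: "C \<subset> F" if "F \<in> set Hi" for F
  proof -
    have "C \<union> set b' \<subseteq> F" using that unfolding Hi_def by (auto simp del: set_concat)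
    then show ?thesis using disj(2) b(2) unfolding C_def by (cases b') (auto simp del: set_concat)
  qed
  have "filter (\<lambda>F. F \<subset> C) (Lo @ Hi) = Lo" "filter (\<lambda>F. C \<subset> F) (Lo @ Hi) = Hi"
    using lo hi by (auto simp: filter_id_conv filter_empty_conv)
  then have ins: "filt (insert_core (block_graph G M) C) = Lo @ C # Hi"
    unfolding insert_core_def filtM by simp
  then show "insert_core (block_graph G M) C = block_graph G (us @ b # b' # vs)"
    using filtS unfolding insert_core_def by (simp add: block_graph_def M_def)
  have "takeWhile (\<lambda>y. y \<noteq> C) (Lo @ C # Hi) = Lo"
    using lo[of C] by (subst takeWhile_append2) auto
  then show "position C (filt (insert_core (block_graph G M) C)) = Suc (length us)"
    unfolding ins position_def by (simp add: Lo_def del: upt_Suc)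
  show "F \<subset> C \<or> C \<subset> F" if "F \<in> set (filt (block_graph G M))" for F
    using that lo hi unfolding filtM by auto
  show "C \<subset> edges G"
    using E disj(2) b(2) unfolding M_def C_def by (cases b') auto
qed

text \<open>Both refinements arise from the same graph by an insertion at the same position. One of
  them inherits the edge order \<open>b @ b'\<close> where its own blocks would prescribe
  \<open>b' @ b\<close>, and interchanging two adjacent lists of odd length is an odd
  permutation.\<close>

lemma boundary_F_merged_blocks:
  fixes G :: "('v, 'e, 'z) graph_scheme"
  assumes d: "block_decomp G (us @ (b @ b') # vs)" and w: "wf_graph G"
    and odd: "odd (length b)" "odd (length b')"
    and core: "core G (set (concat us) \<union> set b)" "core G (set (concat us) \<union> set b')"
    and only: "\<And>C. insertable (block_graph G (us @ (b @ b') # vs)) C \<Longrightarrow>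
      C = set (concat us) \<union> set b \<or> C = set (concat us) \<union> set b'"
  shows "boundary_F (block_graph G (us @ (b @ b') # vs)) =
    (-1) ^ Suc (length us) *\<^sub>Q
      (gen (block_graph G (us @ b # b' # vs)) - gen (block_graph G (us @ b' # b # vs)))"
proof -
  let ?M = "us @ (b @ b') # vs" and ?M' = "us @ (b' @ b) # vs"
  let ?C = "set (concat us) \<union> set b" and ?C' = "set (concat us) \<union> set b'"
  have ne: "b \<noteq> []" "b' \<noteq> []" using odd by auto
  have d': "block_decomp G ?M'" using d ne unfolding block_decomp_def by auto
  note s = filt_split_block[OF d ne] and s' = filt_split_block[OF d' ne(2,1)]
  \<comment> \<open>The order inside a block affects the orientation only, so the same graph may be
    described by either order.\<close>
  have filt_eq: "filt (block_graph G ?M') = filt (block_graph G ?M)"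
  proof -
    have "set (concat (take j ?M')) = set (concat (take j ?M))" for j
      by (cases "j - length us") auto
    then show ?thesis unfolding block_graph_def by simp
  qed
  then have M': "block_graph G ?M' = (block_graph G ?M)\<lparr>eord := concat ?M'\<rparr>"
    by (simp add: block_graph_def)
  have i1: "insertable (block_graph G ?M) ?C"
    unfolding insertable_def using core(1) s(3,4) by simp
  have i2: "insertable (block_graph G ?M) ?C'"
    unfolding insertable_def using core(2) s'(3,4) filt_eq by simp
  have Ins: "{C. insertable (block_graph G ?M) C} = {?C, ?C'}"
    using i1 i2 only by auto
  have CC: "?C \<noteq> ?C'"
  proof -
    have "set b \<inter> (set (concat us) \<union> set b') = {}" using d unfolding block_decomp_def by auto
    then show ?thesis using ne(1) by (cases b) auto
  qed
  have "filt (insert_core (block_graph G ?M) ?C') = filt (insert_core (block_graph G ?M') ?C')"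
    unfolding insert_core_def using filt_eq by simp
  moreover have "insert_core (block_graph G ?M) ?C' =
      (insert_core (block_graph G ?M') ?C')\<lparr>eord := concat ?M\<rparr>"
    unfolding insert_core_def M' by (simp add: block_graph_def)
  ultimately have I': "insert_core (block_graph G ?M) ?C' = (block_graph G (us @ b' # b # vs))\<lparr>eord := concat ?M\<rparr>"
    and p': "position ?C' (filt (insert_core (block_graph G ?M) ?C')) = Suc (length us)"
    using s'(1,2) by simp_all
  have "block_decomp G (us @ b' # b # vs)"
    using d ne unfolding block_decomp_def by auto
  then have wf': "wf_fgraph (block_graph G (us @ b' # b # vs))"
    using w unfolding block_decomp_def by (auto intro!: wf_block_graph)
  have "reordering ((-1) ^ (length b' * length b)) (concat (us @ b' # b # vs)) (concat ?M)"
    using reordering_append[OF reordering_swap_lists[of b' b "concat vs"], of "concat us"] by simp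
  then have "reordering (-1) (concat (us @ b' # b # vs)) (concat ?M)"
    using odd by simp
  then have g': "gen (insert_core (block_graph G ?M) ?C') = - gen (block_graph G (us @ b' # b # vs))"
    unfolding I' using gen_reorder[OF wf', of "(block_graph G (us @ b' # b # vs))\<lparr>eord := concat ?M\<rparr>" "-1"]
    by (simp add: graph_iso_def)
  show ?thesis
    unfolding boundary_F_def Ins using CC s(1,2) p' g'
    by (simp add: bchain.scale_right_diff_distrib bchain.scale_minus_right)
qed

text \<open>Insertion sort. \<open>refl\<close> and \<open>swap\<close> are asked only for lists
  with the given multiset, since in the applications these are exactly the admissible
  orderings.\<close>

lemma adjacent_swaps:
  assumes "mset xs = mset ys"
    and refl: "\<And>zs. mset zs = mset xs \<Longrightarrow> R zs zs"
    and trans: "\<And>as bs cs. R as bs \<Longrightarrow> R bs cs \<Longrightarrow> R as cs"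
    and swap: "\<And>us x y vs. mset (us @ x # y # vs) = mset xs \<Longrightarrow> R (us @ x # y # vs) (us @ y # x # vs)"
  shows "R xs ys"
proof -
  have front: "R (ps @ us @ x # vs) (ps @ x # us @ vs)" if "mset (ps @ us @ x # vs) = mset xs" for ps us x vs
    using that
  proof (induction us arbitrary: vs rule: rev_induct)
    case Nil
    then show ?case by (simp add: refl)
  next
    case (snoc u us)
    have "R (ps @ us @ u # x # vs) (ps @ us @ x # u # vs)"
      using swap[of "ps @ us" u x vs] snoc.prems by simp
    moreover have "R (ps @ us @ x # u # vs) (ps @ x # us @ u # vs)"
      using snoc.IH[of "u # vs"] snoc.prems by (simp add: add_mset_commute)
    ultimately show ?case using trans by fastforce
  qed
  have "R (ps @ as) (ps @ bs)" if "mset as = mset bs" "mset (ps @ as) = mset xs" for ps as bs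
    using that
  proof (induction bs arbitrary: ps as)
    case Nil
    then show ?case using refl by simp
  next
    case (Cons x bs)
    then have "x \<in> set as" by (metis list.set_intros(1) mset_eq_setD)
    then obtain us vs where as: "as = us @ x # vs" by (auto dest: split_list)
    have "R (ps @ as) (ps @ x # us @ vs)"
      unfolding as using Cons.prems(2) by (intro front) (simp add: as)
    moreover have "R ((ps @ [x]) @ us @ vs) ((ps @ [x]) @ bs)"
      using Cons.prems by (intro Cons.IH) (simp_all add: as)
    ultimately show ?case using trans by fastforce
  qed
  from this[of xs ys "[]"] show ?thesis using assms(1) by simp
qed

section \<open>Blowing up type A vertices\<close>

text \<open>On vertices, the contraction of every polygon to the vertex it came from.\<close>

definition proj :: "'v + 'v \<times> nat \<Rightarrow> 'v" where
  "proj = case_sum id fst"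

lemma proj_simps [simp]: "proj (Inl v) = v" "proj (Inr p) = fst p"
  by (simp_all add: proj_def)

lemma ends_blowup_Inl:
  "ends (blowup X \<iota>) (Inl e) b =
    (if ends X e b \<in> typeA X then Inr (ends X e b, \<iota> (ends X e b) (e, b)) else Inl (ends X e b))"
  by (simp add: blowup_def Let_def)

lemma ends_blowup_Inr:
  "ends (blowup X \<iota>) (Inr (s, i)) b = Inr (s, if b then Suc i mod valence X (edges X) s else i)"
  by (simp add: blowup_def)

lemma edges_blowup: "edges (blowup X \<iota>) = Inl ` edges X \<union> Inr ` polygon_positions X"
  by (simp add: blowup_def)

lemma verts_blowup: "verts (blowup X \<iota>) = Inl ` (verts X - typeA X) \<union> Inr ` polygon_positions X"
  by (simp add: blowup_def)

lemma proj_ends_blowup [simp]: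
  "proj (ends (blowup X \<iota>) (Inl e) b) = ends X e b"
  "proj (ends (blowup X \<iota>) (Inr p) b) = fst p"
  by (simp add: ends_blowup_Inl, cases p, simp add: ends_blowup_Inr)

text \<open>A polygon edge has both ends over the same vertex, so it disappears from the projected
  path. The converse, \<open>joined_blowup\<close>, requires all polygons to be in
  \<open>F\<close>.\<close>

lemma proj_joined:
  assumes "(u, v) \<in> joined (blowup X \<iota>) F"
  shows "(proj u, proj v) \<in> joined X (Inl -` F)"
proof -
  define R where "R = {(u, v). (proj u, proj v) \<in> joined X (Inl -` F)}"
  have "(u, v) \<in> R"
    using assms
  proof (rule joined_least)
    fix x b assume "x \<in> F"
    then show "(ends (blowup X \<iota>) x b, ends (blowup X \<iota>) x (\<not> b)) \<in> R"
      by (cases x) (auto simp: R_def intro!: joined_ends)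
  qed (auto simp: R_def intro!: refl_onI transI intro: joined_trans)
  then show ?thesis by (simp add: R_def)
qed

lemma polygon_segment:
  assumes "i \<le> j" "j < valence X (edges X) s" "\<And>k. i \<le> k \<Longrightarrow> k < j \<Longrightarrow> Inr (s, k) \<in> F"
  shows "(Inr (s, i), Inr (s, j)) \<in> joined (blowup X \<iota>) F"
  using assms
proof (induction j)
  case (Suc j)
  show ?case
  proof (cases "i = Suc j")
    case False
    then have "(Inr (s, i), Inr (s, j)) \<in> joined (blowup X \<iota>) F"
      using Suc by simp
    moreover have "Inr (s, j) \<in> F" using Suc.prems False by simp
    then have "(Inr (s, j), Inr (s, Suc j)) \<in> joined (blowup X \<iota>) F"
      using joined_ends[of "Inr (s, j)" F "blowup X \<iota>" False True] Suc.prems(2)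
      by (simp add: ends_blowup_Inr)
    ultimately show ?thesis by (rule joined_trans)
  qed simp
qed simp

text \<open>The ends are joined the other way round: from \<open>k\<close> down to 0, and from
  \<open>k + 1\<close> up to the last vertex, whose edge returns to 0.\<close>

lemma polygon_edge_not_separating:
  assumes k: "k < valence X (edges X) s"
    and F: "\<And>i. i < valence X (edges X) s \<Longrightarrow> i \<noteq> k \<Longrightarrow> Inr (s, i) \<in> F"
  shows "(ends (blowup X \<iota>) (Inr (s, k)) False, ends (blowup X \<iota>) (Inr (s, k)) True)
    \<in> joined (blowup X \<iota>) F"
proof -
  let ?v = "valence X (edges X) s"
  have k0: "(Inr (s, k), Inr (s, 0)) \<in> joined (blowup X \<iota>) F"
    using polygon_segment[of 0 k X s F \<iota>] k F by (auto intro: joined_sym)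
  show ?thesis
  proof (cases "Suc k = ?v")
    case True
    then show ?thesis using k0 by (simp add: ends_blowup_Inr)
  next
    case False
    then have "(Inr (s, Suc k), Inr (s, ?v - 1)) \<in> joined (blowup X \<iota>) F"
      using k F by (intro polygon_segment) auto
    moreover have "Inr (s, ?v - 1) \<in> F" using False k F by simp
    then have "(Inr (s, ?v - 1), Inr (s, 0)) \<in> joined (blowup X \<iota>) F"
      using joined_ends[of "Inr (s, ?v - 1)" F "blowup X \<iota>" False True] k by (simp add: ends_blowup_Inr)
    ultimately have "(Inr (s, k), Inr (s, Suc k)) \<in> joined (blowup X \<iota>) F"
      using k0 by (meson joined_sym joined_trans)
    then show ?thesis using False k by (simp add: ends_blowup_Inr)
  qed
qed

section \<open>The blow-up of a fixed oriented odd AB-graph\<close>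

locale odd_AB =
  fixes X :: "('v, 'e) abgraph"
  assumes X: "oriented_odd_AB_graph X"
begin

abbreviation val :: "'v \<Rightarrow> nat" where "val s \<equiv> valence X (edges X) s"

abbreviation I where "I \<equiv> Pi\<^sub>E (typeA X) (attachments X)"

abbreviation polys :: "('e + 'v \<times> nat) set" where "polys \<equiv> Inr ` polygon_positions X"

lemma wf_X: "wf_graph X" and connected_X: "connected_graph X"
  and val3: "\<And>v. v \<in> verts X \<Longrightarrow> 3 \<le> val v" and A_verts: "typeA X \<subseteq> verts X"
  and odd_val: "\<And>s. s \<in> typeA X \<Longrightarrow> odd (val s)"
  and hord: "\<And>s. s \<in> typeA X \<Longrightarrow> distinct (hord X s)"
    "\<And>s. s \<in> typeA X \<Longrightarrow> set (hord X s) = half_edges X (edges X) s"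
  using X unfolding oriented_odd_AB_graph_def odd_AB_graph_def AB_graph_def by auto

lemma fin_X: "finite (verts X)" "finite (edges X)" "finite (typeA X)"
  and ends_X: "\<And>e b. e \<in> edges X \<Longrightarrow> ends X e b \<in> verts X"
  using wf_X A_verts finite_subset unfolding wf_graph_def by auto

lemma val3_A: "s \<in> typeA X \<Longrightarrow> 3 \<le> val s"
  using val3 A_verts by blast

lemma finite_polygon_positions: "finite (polygon_positions X)"
  unfolding polygon_positions_def using fin_X(3) by simp

lemma attachment:
  assumes "\<iota> \<in> I" "s \<in> typeA X"
  shows "\<iota> s \<in> attachments X s" "bij_betw (\<iota> s) (half_edges X (edges X) s) {..<val s}"
  using assms unfolding attachments_def by auto

lemma attachment_less:
  assumes "\<iota> \<in> I" "e \<in> edges X" "ends X e b \<in> typeA X"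
  shows "\<iota> (ends X e b) (e, b) < val (ends X e b)"
proof -
  have "(e, b) \<in> half_edges X (edges X) (ends X e b)"
    using assms(2) by (simp add: half_edges_def)
  then show ?thesis
    using bij_betwE[OF attachment(2)[OF assms(1,3)]] by blast
qed

lemma ends_blowup_verts:
  assumes "\<iota> \<in> I" "x \<in> edges (blowup X \<iota>)"
  shows "ends (blowup X \<iota>) x b \<in> verts (blowup X \<iota>)"
proof (cases x)
  case (Inl e)
  then show ?thesis
    using assms attachment_less[OF assms(1)] ends_X
    by (auto simp: edges_blowup verts_blowup ends_blowup_Inl polygon_positions_def)
next
  case (Inr p)
  obtain s i where "p = (s, i)" by force
  then show ?thesis
    using assms(2) Inr by (auto simp: edges_blowup verts_blowup ends_blowup_Inr polygon_positions_def)
qed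

lemma wf_blowup: "\<iota> \<in> I \<Longrightarrow> wf_graph (blowup X \<iota>)"
  unfolding wf_graph_def using ends_blowup_verts fin_X finite_polygon_positions
  by (simp add: edges_blowup verts_blowup)

lemma finite_half_edges: "finite C \<Longrightarrow> finite (half_edges G C v)"
  by (rule finite_subset[of _ "C \<times> UNIV"]) (auto simp: half_edges_def)

text \<open>At a polygon vertex there are the attached half-edge of \<open>X\<close> and one
  half-edge of each of the two adjacent polygon edges. A type B vertex keeps its half-edges.\<close>

lemma valence_blowup:
  assumes \<iota>: "\<iota> \<in> I" and u: "u \<in> verts (blowup X \<iota>)"
  shows "3 \<le> valence (blowup X \<iota>) (edges (blowup X \<iota>)) u"
proof -
  let ?H = "half_edges (blowup X \<iota>) (edges (blowup X \<iota>)) u"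
  have fin: "finite ?H"
    using wf_blowup[OF \<iota>] unfolding wf_graph_def by (intro finite_half_edges) simp
  show ?thesis
  proof (cases u)
    case (Inl v)
    then have v: "v \<in> verts X" "v \<notin> typeA X" using u by (auto simp: verts_blowup)
    let ?f = "map_prod Inl id :: 'e \<times> bool \<Rightarrow> ('e + 'v \<times> nat) \<times> bool"
    have "?f ` half_edges X (edges X) v \<subseteq> ?H"
      using Inl v by (auto simp: half_edges_def edges_blowup ends_blowup_Inl)
    then have "card (?f ` half_edges X (edges X) v) \<le> card ?H"
      using fin by (intro card_mono)
    moreover have "inj_on ?f (half_edges X (edges X) v)"
      by (auto intro!: inj_onI)
    ultimately show ?thesis
      using val3[OF v(1)] unfolding valence_def by (simp add: card_image)
  next
    case (Inr p)
    obtain s i where p: "p = (s, i)" by force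
    then have s: "s \<in> typeA X" "i < val s" using u Inr by (auto simp: verts_blowup polygon_positions_def)
    obtain e b where eb: "(e, b) \<in> half_edges X (edges X) s" "\<iota> s (e, b) = i"
      using bij_betw_imp_surj_on[OF attachment(2)[OF \<iota> s(1)]] s(2) by (metis imageE lessThan_iff surj_pair)
    \<comment> \<open>The polygon edge arriving at vertex \<open>i\<close> carries the number of the
      cyclic predecessor of \<open>i\<close>.\<close>
    define j where "j = (if i = 0 then val s - 1 else i - 1)"
    have j: "j < val s" "Suc j mod val s = i" using s(2) unfolding j_def by auto
    let ?T = "{(Inl e, b), (Inr (s, i), False), (Inr (s, j), True)}"
    have "?T \<subseteq> ?H"
      using eb s j Inr p
      by (auto simp: half_edges_def edges_blowup ends_blowup_Inl ends_blowup_Inr polygon_positions_def)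
    then have "card ?T \<le> card ?H" using fin by (intro card_mono)
    then show ?thesis by (simp add: valence_def)
  qed
qed

lemma fibre_joined:
  assumes "polys \<subseteq> F" "u \<in> verts (blowup X \<iota>)" "v \<in> verts (blowup X \<iota>)" "proj u = proj v"
  shows "(u, v) \<in> joined (blowup X \<iota>) F"
proof (cases "u \<in> Inl ` UNIV \<or> v \<in> Inl ` UNIV")
  case True
  then have "u = v" using assms(2-4) by (auto simp: verts_blowup polygon_positions_def)
  then show ?thesis by simp
next
  case False
  then obtain s i j where ij: "u = Inr (s, i)" "v = Inr (s, j)" "i < val s" "j < val s" "s \<in> typeA X"
    using assms(2-4) by (auto simp: verts_blowup polygon_positions_def)
  have "(Inr (s, i), Inr (s, j)) \<in> joined (blowup X \<iota>) F" if "i \<le> j" "j < val s" for i j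
    using that assms(1) ij(5) by (intro polygon_segment) (auto simp: polygon_positions_def)
  then show ?thesis using ij by (cases "i \<le> j") (auto intro: joined_sym)
qed

text \<open>A path in \<open>X\<close> may enter and leave a type A vertex by half-edges attached at
  different vertices of the polygon; \<open>fibre_joined\<close> closes this gap inside the
  polygon.\<close>

lemma joined_blowup:
  assumes \<iota>: "\<iota> \<in> I" and F: "polys \<subseteq> F" "F \<subseteq> edges (blowup X \<iota>)"
    and uv: "u \<in> verts (blowup X \<iota>)" "v \<in> verts (blowup X \<iota>)"
  shows "(u, v) \<in> joined (blowup X \<iota>) F \<longleftrightarrow> (proj u, proj v) \<in> joined X (Inl -` F)"
proof
  have "\<forall>v\<in>verts (blowup X \<iota>). proj v = y \<longrightarrow> (u, v) \<in> joined (blowup X \<iota>) F"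
    if "(proj u, y) \<in> joined X (Inl -` F)" for y
    using that unfolding joined_def[of X]
  proof (induction rule: rtrancl_induct)
    case base
    then show ?case using fibre_joined[OF F(1) uv(1)] by simp
  next
    case (step y z)
    then obtain e b where e: "Inl e \<in> F" "y = ends X e b" "z = ends X e (\<not> b)" by auto
    let ?u = "\<lambda>b. ends (blowup X \<iota>) (Inl e) b"
    have m: "?u c \<in> verts (blowup X \<iota>)" for c using ends_blowup_verts[OF \<iota>] e(1) F(2) by blast
    have "(u, ?u b) \<in> joined (blowup X \<iota>) F" using step.IH m e(2) by simp
    moreover have "(?u b, ?u (\<not> b)) \<in> joined (blowup X \<iota>) F" using e(1) by (rule joined_ends)
    moreover have "(?u (\<not> b), v) \<in> joined (blowup X \<iota>) F"
      if "v \<in> verts (blowup X \<iota>)" "proj v = z" for v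
      using fibre_joined[OF F(1) m that(1)] that(2) e(3) by simp
    ultimately show ?case by (blast intro: joined_trans)
  qed
  then show "(proj u, proj v) \<in> joined X (Inl -` F) \<Longrightarrow> (u, v) \<in> joined (blowup X \<iota>) F"
    using uv(2) by blast
qed (rule proj_joined)

text \<open>
  Removing two edges from the polygon at \<open>s\<close> leaves two arcs.  Each half-edge of the tree at \<open>s\<close>
  leads to a branch of its own, so the branches attached to the first arc do not meet those
  attached to the second.
\<close>

lemma polygon_edges_separate:
  assumes \<iota>: "\<iota> \<in> I" and T: "maximal_tree X T" and s: "s \<in> typeA X"
    and ij: "i < val s" "j < val s" "i \<noteq> j"
    and C: "C \<subseteq> polys" "Inr (s, i) \<notin> C" "Inr (s, j) \<notin> C"
  shows "(ends (blowup X \<iota>) (Inr (s, i)) False, ends (blowup X \<iota>) (Inr (s, i)) True)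
    \<notin> joined (blowup X \<iota>) (Inl ` T \<union> C)"
proof
  \<comment> \<open>Edge \<open>(s, k)\<close> runs from vertex \<open>k\<close> to vertex
    \<open>k + 1\<close>, so the arc following edge \<open>i\<close> consists of the vertices
    \<open>i + 1\<close>, ..., \<open>j\<close> in cyclic order. Indices beyond the valence do no
    harm.\<close>
  define A where "A = (if i < j then {i<..j} else {..j} \<union> {i<..})"
  \<comment> \<open>\<open>S\<close> is this arc with everything hanging from it: a vertex outside
    the polygon is included if it is on the far side of a tree edge attached to the arc. No edge of
    \<open>Inl\<close> followed by \<open>T\<close>, or of \<open>C\<close>, leaves
    \<open>S\<close>, as \<open>closed\<close> shows.\<close>
  define S where "S = {x. if \<exists>k. x = Inr (s, k) then (\<exists>k\<in>A. x = Inr (s, k)) else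
    (\<exists>e b. e \<in> T \<and> ends X e b = s \<and> \<iota> s (e, b) \<in> A \<and>
       (ends X e (\<not> b), proj x) \<in> joined X (T - {e}))}"
  have sep: "(ends X e b, ends X e (\<not> b)) \<notin> joined X (T - {e})" if "e \<in> T" for e b
    using T that joined_sym[of _ _ X "T - {e}"] unfolding maximal_tree_def separating_edge_def
    by (cases b) auto
  have arc: "Suc k mod val s \<in> A \<longleftrightarrow> k \<in> A" if "k < val s" "k \<noteq> i" "k \<noteq> j" for k
  proof (cases "Suc k = val s")
    case True
    then show ?thesis using that ij unfolding A_def by auto
  next
    case False
    then have "Suc k mod val s = Suc k" using that by simp
    then show ?thesis using that ij unfolding A_def by auto
  qed
  have Sr: "Inr (s, k) \<in> S \<longleftrightarrow> k \<in> A" for k unfolding S_def by auto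
  have So: "x \<in> S \<longleftrightarrow> (\<exists>e b. e \<in> T \<and> ends X e b = s \<and> \<iota> s (e, b) \<in> A \<and>
       (ends X e (\<not> b), proj x) \<in> joined X (T - {e}))" if "\<forall>k. x \<noteq> Inr (s, k)" for x
    using that unfolding S_def by auto
  have not_s: "\<forall>k. ends (blowup X \<iota>) (Inl f) b \<noteq> Inr (s, k)" if "ends X f b \<noteq> s" for f b
    using that by (auto simp: ends_blowup_Inl)
  have at_s: "ends (blowup X \<iota>) (Inl f) b \<in> S \<longleftrightarrow> \<iota> s (f, b) \<in> A" if "ends X f b = s" for f b
    using that s Sr by (simp add: ends_blowup_Inl)
  have closed: "ends (blowup X \<iota>) x (\<not> b) \<in> S"
    if x: "x \<in> Inl ` T \<union> C" and b: "ends (blowup X \<iota>) x b \<in> S" for x b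
  proof (cases x)
    case (Inl f)
    then have f: "f \<in> T" using x C(1) by auto
    note b = b[unfolded Inl]
    consider "ends X f b = s" | "ends X f b \<noteq> s" "ends X f (\<not> b) = s"
      | "ends X f b \<noteq> s" "ends X f (\<not> b) \<noteq> s" by blast
    then show ?thesis
    proof cases
      case 1
      then have A: "\<iota> s (f, b) \<in> A" using b at_s by simp
      have "ends X f (\<not> b) \<noteq> s" using sep[OF f, of b] 1 by auto
      then show ?thesis
        unfolding Inl using f 1 A by (subst So[OF not_s]) (auto intro!: exI[of _ f] exI[of _ b])
    next
      case 2
      obtain e c where e: "e \<in> T" "ends X e c = s" "\<iota> s (e, c) \<in> A"
        "(ends X e (\<not> c), ends X f b) \<in> joined X (T - {e})"
        using b So[OF not_s[OF 2(1)]] by auto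
      \<comment> \<open>A branch can return to \<open>s\<close> only through the edge by which it
        was entered; otherwise that edge would not separate the tree.\<close>
      have "e = f"
      proof (rule ccontr)
        assume "e \<noteq> f"
        then have "(ends X f b, ends X f (\<not> b)) \<in> joined X (T - {e})" using f by (intro joined_ends) simp
        then have "(ends X e (\<not> c), ends X e c) \<in> joined X (T - {e})"
          using e(2,4) 2(2) by (auto intro: joined_trans)
        then show False using sep[OF e(1), of c] by (auto dest: joined_sym)
      qed
      moreover have "c = (\<not> b)" using e(2) 2 \<open>e = f\<close> by (cases c; cases b) auto
      ultimately show ?thesis using e(3) at_s[OF 2(2)] Inl by simp
    next
      case 3
      obtain e c where e: "e \<in> T" "ends X e c = s" "\<iota> s (e, c) \<in> A"
        "(ends X e (\<not> c), ends X f b) \<in> joined X (T - {e})"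
        using b So[OF not_s[OF 3(1)]] by auto
      have "e \<noteq> f" using e(2) 3 by (cases c; cases b) auto
      then have "(ends X f b, ends X f (\<not> b)) \<in> joined X (T - {e})" using f by (intro joined_ends) simp
      then have "(ends X e (\<not> c), ends X f (\<not> b)) \<in> joined X (T - {e})"
        using e(4) by (auto intro: joined_trans)
      then show ?thesis
        unfolding Inl using e by (subst So[OF not_s[OF 3(2)]]) auto
    qed
  next
    case (Inr p)
    obtain s' k where p: "p = (s', k)" by force
    have k: "Inr (s', k) \<in> C" "k < val s'" using x C(1) Inr p by (auto simp: polygon_positions_def)
    show ?thesis
    proof (cases "s' = s")
      case True
      then have "k \<noteq> i" "k \<noteq> j" using k C(2,3) by auto
      then show ?thesis
        using b arc[of k] k(2) True unfolding Inr p ends_blowup_Inr by (cases b) (auto simp: Sr)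
    next
      case False
      then show ?thesis
        using b unfolding Inr p ends_blowup_Inr by (simp add: So)
    qed
  qed
  have "Suc i mod val s \<in> A" "i \<notin> A"
  proof -
    show "i \<notin> A" using ij unfolding A_def by auto
    show "Suc i mod val s \<in> A"
      using ij unfolding A_def by (cases "Suc i = val s") auto
  qed
  then have "ends (blowup X \<iota>) (Inr (s, i)) True \<in> S" "ends (blowup X \<iota>) (Inr (s, i)) False \<notin> S"
    by (simp_all add: ends_blowup_Inr Sr)
  moreover assume "(ends (blowup X \<iota>) (Inr (s, i)) False, ends (blowup X \<iota>) (Inr (s, i)) True)
    \<in> joined (blowup X \<iota>) (Inl ` T \<union> C)"
  then have "(ends (blowup X \<iota>) (Inr (s, i)) True, ends (blowup X \<iota>) (Inr (s, i)) False)
    \<in> joined (blowup X \<iota>) (Inl ` T \<union> C)"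
    by (rule joined_sym)
  ultimately show False using joined_closed[OF _ _ closed] by blast
qed

end

section \<open>Collapsing tree edges in a blow-up\<close>

context odd_AB
begin

text \<open>In the applications \<open>F\<close> is a maximal tree or a maximal tree without one
  edge.\<close>

definition Q :: "'e set \<Rightarrow> ('v \<Rightarrow> 'e \<times> bool \<Rightarrow> nat) \<Rightarrow> (('v + 'v \<times> nat) set, 'e + 'v \<times> nat) graph" where
  "Q F \<iota> = collapse (blowup X \<iota>) (Inl ` F)"

lemma edges_Q: "edges (Q F \<iota>) = Inl ` (edges X - F) \<union> polys"
  unfolding Q_def collapse_def edges_blowup by auto

lemma Q_ends_eq_iff:
  "ends (Q F \<iota>) x b = ends (Q F \<iota>) y c \<longleftrightarrow>
    (ends (blowup X \<iota>) x b, ends (blowup X \<iota>) y c) \<in> joined (blowup X \<iota>) (Inl ` F)"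
  unfolding Q_def ends_collapse_eq_iff ..

lemma Q_joined_iff:
  "(ends (Q F \<iota>) x b, ends (Q F \<iota>) y c) \<in> joined (Q F \<iota>) C \<longleftrightarrow>
    (ends (blowup X \<iota>) x b, ends (blowup X \<iota>) y c) \<in> joined (blowup X \<iota>) (Inl ` F \<union> C)"
  unfolding Q_def joined_ends_collapse ..

text \<open>A detour around a forest edge in the blow-up would project to a detour in
  \<open>X\<close>.\<close>

lemma forest_blowup:
  assumes "forest X F"
  shows "forest (blowup X \<iota>) (Inl ` F)"
proof -
  have "(ends (blowup X \<iota>) (Inl e) False, ends (blowup X \<iota>) (Inl e) True)
      \<notin> joined (blowup X \<iota>) (Inl ` F - {Inl e})" if "e \<in> F" for e
  proof
    assume "(ends (blowup X \<iota>) (Inl e) False, ends (blowup X \<iota>) (Inl e) True)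
      \<in> joined (blowup X \<iota>) (Inl ` F - {Inl e})"
    from proj_joined[OF this]
    have "(ends X e False, ends X e True) \<in> joined X (Inl -` (Inl ` F - {Inl e :: 'e + 'v \<times> nat}))" by simp
    moreover have "Inl -` (Inl ` F - {Inl e :: 'e + 'v \<times> nat}) = F - {e}" by auto
    ultimately show False using assms that unfolding forest_def separating_edge_def by auto
  qed
  then show ?thesis unfolding forest_def separating_edge_def by auto
qed

lemma connected_blowup:
  assumes \<iota>: "\<iota> \<in> I"
  shows "connected_graph (blowup X \<iota>)"
proof -
  obtain v where v: "v \<in> verts X" using connected_X unfolding connected_graph_def by auto
  have "verts (blowup X \<iota>) \<noteq> {}"
  proof (cases "v \<in> typeA X")
    case True
    then have "(v, 0) \<in> polygon_positions X" using val3_A[of v] by (auto simp: polygon_positions_def)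
    then show ?thesis by (auto simp: verts_blowup)
  qed (use v in \<open>auto simp: verts_blowup\<close>)
  moreover have "(u, w) \<in> joined (blowup X \<iota>) (edges (blowup X \<iota>))"
    if "u \<in> verts (blowup X \<iota>)" "w \<in> verts (blowup X \<iota>)" for u w
  proof -
    have "proj u \<in> verts X" "proj w \<in> verts X"
      using that A_verts by (auto simp: verts_blowup polygon_positions_def)
    moreover have "Inl -` edges (blowup X \<iota>) = edges X" by (auto simp: edges_blowup)
    moreover have "polys \<subseteq> edges (blowup X \<iota>)" by (auto simp: edges_blowup)
    ultimately show ?thesis
      using joined_blowup[OF \<iota> _ subset_refl that] connected_X unfolding connected_graph_def by simp
  qed
  ultimately show ?thesis unfolding connected_graph_def by blast
qed

context
  fixes F assumes F: "F \<subseteq> edges X" "forest X F"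
begin

lemma F_edges: "Inl ` F \<subseteq> edges (blowup X \<iota>)"
  using F(1) by (auto simp: edges_blowup)

lemma wf_Q: "\<iota> \<in> I \<Longrightarrow> wf_graph (Q F \<iota>)"
  unfolding Q_def by (intro wf_collapse wf_blowup)

lemma connected_Q: "\<iota> \<in> I \<Longrightarrow> connected_graph (Q F \<iota>)"
  unfolding Q_def by (intro connected_collapse connected_blowup F_edges)

lemma valence_Q: "\<iota> \<in> I \<Longrightarrow> v \<in> verts (Q F \<iota>) \<Longrightarrow> 3 \<le> valence (Q F \<iota>) (edges (Q F \<iota>)) v"
  using valence_collapse_forest[OF wf_blowup F_edges forest_blowup[OF F(2)] valence_blowup, of \<iota> v]
  unfolding Q_def by (simp add: collapse_def)

text \<open>A type A vertex of valence \<open>v\<close> is replaced by \<open>v\<close> vertices and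
  \<open>v\<close> new edges, which raises the rank by one. Collapsing a forest removes equally many
  edges and vertices.\<close>

lemma rank_Q:
  assumes \<iota>: "\<iota> \<in> I"
  shows "rank (Q F \<iota>) = Phi_rank X"
proof -
  have finF: "finite F" using F(1) fin_X(2) finite_subset by blast
  have "card (verts (Q F \<iota>)) + card (Inl ` F :: ('e + 'v \<times> nat) set) = card (verts (blowup X \<iota>))"
    unfolding Q_def collapse_def graph.simps
  proof (rule card_quotient_forest)
    show "finite (verts (blowup X \<iota>))" using wf_blowup[OF \<iota>] by (simp add: wf_graph_def)
    show "ends (blowup X \<iota>) e b \<in> verts (blowup X \<iota>)" if "e \<in> Inl ` F" for e b
      using ends_blowup_verts[OF \<iota>] that F_edges by blast
  qed (use finF forest_blowup[OF F(2)] in simp_all)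
  moreover have "card (Inl ` F :: ('e + 'v \<times> nat) set) = card F" by (simp add: card_image)
  moreover have "card (verts (blowup X \<iota>)) = card (verts X) - card (typeA X) + card (polygon_positions X)"
    unfolding verts_blowup using fin_X finite_polygon_positions A_verts
    by (subst card_Un_disjoint) (auto simp: card_image card_Diff_subset)
  moreover have "card (edges (Q F \<iota>)) = card (edges X) - card F + card (polygon_positions X)"
    unfolding edges_Q using fin_X finite_polygon_positions F(1) finF
    by (subst card_Un_disjoint) (auto simp: card_image card_Diff_subset)
  moreover have "card F \<le> card (edges X)" "card (typeA X) \<le> card (verts X)"
    using F(1) A_verts fin_X by (auto intro: card_mono)
  ultimately show ?thesis unfolding rank_def Phi_rank_def by linarith
qed

lemma card_edges_Q:
  "int (card (edges (Q F \<iota>))) = int (card (edges X - F)) + (\<Sum>s\<in>typeA X. int (val s))"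
proof -
  have "card (edges (Q F \<iota>)) = card (edges X - F) + card (polygon_positions X)"
    unfolding edges_Q using fin_X finite_polygon_positions
    by (subst card_Un_disjoint) (auto simp: card_image)
  moreover have "card (polygon_positions X) = (\<Sum>s\<in>typeA X. val s)"
    unfolding polygon_positions_def using fin_X(3) by simp
  ultimately show ?thesis by simp
qed

end

section \<open>Core subgraphs of the collapsed blow-up\<close>

definition polygonal :: "('e + 'v \<times> nat) set \<Rightarrow> bool" where
  "polygonal C \<longleftrightarrow> (\<forall>s\<in>typeA X. set (polygon X s) \<subseteq> C \<or> set (polygon X s) \<inter> C = {})"

lemma set_polygon: "set (polygon X s) = {Inr (s, i) | i. i < val s}"
  unfolding polygon_def by auto

text \<open>A polygon edge is bypassed along the rest of its polygon, which lies in \<open>C\<close>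
  by polygonality. For an edge of \<open>X\<close> the bypass is found in \<open>X\<close>; it lifts
  because in this case all polygons lie in \<open>C\<close>.\<close>

lemma core_Q_I:
  assumes \<iota>: "\<iota> \<in> I" and C: "C \<noteq> {}" "C \<subseteq> edges (Q F \<iota>)" "polygonal C" and F: "F \<subseteq> edges X"
    and crit: "\<And>e. Inl e \<in> C \<Longrightarrow>
      polys \<subseteq> C \<and> (ends X e False, ends X e True) \<in> joined X (F \<union> (Inl -` C - {e}))"
  shows "core (Q F \<iota>) C"
proof -
  have CB: "C \<subseteq> edges (blowup X \<iota>)" "Inl ` F \<subseteq> edges (blowup X \<iota>)"
    using C(2) F unfolding edges_Q edges_blowup by auto
  have fin: "finite C"
    using CB(1) wf_blowup[OF \<iota>] finite_subset unfolding wf_graph_def by blast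
  have "(ends (blowup X \<iota>) x False, ends (blowup X \<iota>) x True) \<in> joined (blowup X \<iota>) (Inl ` F \<union> (C - {x}))"
    if x: "x \<in> C" for x
  proof (cases x)
    case (Inl e)
    then have e: "polys \<subseteq> C - {x}" "(ends X e False, ends X e True) \<in> joined X (F \<union> (Inl -` C - {e}))"
      using crit[of e] x by auto
    have xE: "x \<in> edges (blowup X \<iota>)" using x CB by blast
    have "Inl -` (Inl ` F \<union> (C - {x})) = F \<union> (Inl -` C - {e})" using Inl by auto
    moreover have "polys \<subseteq> Inl ` F \<union> (C - {x})" using e(1) by blast
    moreover have "Inl ` F \<union> (C - {x}) \<subseteq> edges (blowup X \<iota>)" using CB by blast
    ultimately show ?thesis
      using joined_blowup[OF \<iota> _ _ ends_blowup_verts[OF \<iota> xE] ends_blowup_verts[OF \<iota> xE]] e(2) Inl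
      by simp
  next
    case (Inr p)
    obtain s k where p: "p = (s, k)" by force
    then have s: "s \<in> typeA X" "k < val s"
      using x CB(1) Inr by (auto simp: edges_blowup polygon_positions_def)
    then have "Inr (s, k) \<in> set (polygon X s) \<inter> C" using x Inr p by (auto simp: set_polygon)
    then have "set (polygon X s) \<subseteq> C" using C(3) s(1) unfolding polygonal_def by blast
    then show ?thesis
      unfolding Inr p using s(2) by (intro polygon_edge_not_separating) (auto simp: set_polygon)
  qed
  then have "\<not> separating_edge (Q F \<iota>) C x" if "x \<in> C" for x
    using that unfolding separating_edge_def Q_joined_iff by simp
  then show ?thesis unfolding core_iff[OF fin] using C by blast
qed

lemma polygon_edges_separate_Q:
  assumes "\<iota> \<in> I" "maximal_tree X T" "F \<subseteq> T" "s \<in> typeA X"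
    and "i < val s" "j < val s" "i \<noteq> j"
    and "C \<subseteq> polys" "Inr (s, i) \<notin> C" "Inr (s, j) \<notin> C"
  shows "(ends (Q F \<iota>) (Inr (s, i)) False, ends (Q F \<iota>) (Inr (s, i)) True) \<notin> joined (Q F \<iota>) C"
proof -
  have "Inl ` F \<union> C \<subseteq> Inl ` T \<union> C" using assms(3) by blast
  from polygon_edges_separate[OF assms(1,2,4-10)] joined_monoD[OF _ this]
  show ?thesis unfolding Q_joined_iff by (rule contrapos_nn)
qed

text \<open>If \<open>C\<close> misses one edge of a polygon, every edge of that polygon in
  \<open>C\<close> separates \<open>C\<close>. The restriction to subsets of \<open>polys\<close>
  matters, as edges outside the tree could reconnect the two arcs.\<close>

lemma core_Q_polygonal:
  assumes \<iota>: "\<iota> \<in> I" and T: "maximal_tree X T" "F \<subseteq> T"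
    and C: "core (Q F \<iota>) C" "C \<subseteq> polys"
  shows "polygonal C"
proof (rule ccontr)
  assume "\<not> polygonal C"
  then obtain s i j where s: "s \<in> typeA X" "i < val s" "j < val s" "Inr (s, i) \<in> C" "Inr (s, j) \<notin> C"
    unfolding polygonal_def set_polygon by auto
  then have "(ends (Q F \<iota>) (Inr (s, i)) False, ends (Q F \<iota>) (Inr (s, i)) True)
      \<notin> joined (Q F \<iota>) (C - {Inr (s, i)})"
    using C(2) by (intro polygon_edges_separate_Q[OF \<iota> T, where j = j]) auto
  then show False using C(1) s(4) unfolding core_def separating_edge_def by blast
qed

section \<open>Exchanging the half-edges at the two ends of a polygon edge\<close>

definition attachments_sign :: "('v \<Rightarrow> 'e \<times> bool \<Rightarrow> nat) \<Rightarrow> int" where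
  "attachments_sign \<iota> = (\<Prod>s\<in>typeA X. attachment_sign X s (\<iota> s))"

text \<open>\<open>restrict\<close> keeps the new bijection extensional, so that the result stays in
  the index set \<open>I\<close> of the sum.\<close>

definition swap_at :: "'v \<Rightarrow> nat \<Rightarrow> ('v \<Rightarrow> 'e \<times> bool \<Rightarrow> nat) \<Rightarrow> ('v \<Rightarrow> 'e \<times> bool \<Rightarrow> nat)" where
  "swap_at s i \<iota> = \<iota>(s := restrict (transpose i (Suc i mod val s) \<circ> \<iota> s) (half_edges X (edges X) s))"

context
  fixes s i assumes s: "s \<in> typeA X" "i < val s"
begin

lemma next_less: "Suc i mod val s < val s" and next_neq: "Suc i mod val s \<noteq> i"
  using s val3_A[OF s(1)] by (auto simp: mod_Suc)

lemma bij_next: "bij_betw (transpose i (Suc i mod val s)) {..<val s} {..<val s}"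
  using permutes_imp_bij[OF permutes_swap_id[of i "{..<val s}" "Suc i mod val s"]] s(2) next_less by simp

lemma swap_at_attachments:
  assumes \<iota>: "\<iota> \<in> I"
  shows "swap_at s i \<iota> \<in> I"
proof -
  let ?f = "restrict (transpose i (Suc i mod val s) \<circ> \<iota> s) (half_edges X (edges X) s)"
  have "bij_betw (transpose i (Suc i mod val s) \<circ> \<iota> s) (half_edges X (edges X) s) {..<val s}"
    using bij_betw_trans[OF attachment(2)[OF \<iota> s(1)] bij_next] .
  then have b: "bij_betw ?f (half_edges X (edges X) s) {..<val s}"
    by (subst bij_betw_cong[where g = "transpose i (Suc i mod val s) \<circ> \<iota> s"]) simp_all
  then have "?f \<in> attachments X s"
    unfolding attachments_def using bij_betwE[OF b] by (simp add: PiE_def Pi_def)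
  then show ?thesis using \<iota> s(1) unfolding swap_at_def by (auto simp: PiE_def Pi_def extensional_def)
qed

lemma swap_at_swap_at:
  assumes \<iota>: "\<iota> \<in> I"
  shows "swap_at s i (swap_at s i \<iota>) = \<iota>"
proof -
  have "\<iota> s \<in> extensional (half_edges X (edges X) s)"
    using attachment(1)[OF \<iota> s(1)] unfolding attachments_def by (simp add: PiE_def)
  then have "restrict (transpose i (Suc i mod val s) \<circ> restrict (transpose i (Suc i mod val s) \<circ> \<iota> s)
      (half_edges X (edges X) s)) (half_edges X (edges X) s) = \<iota> s"
    by (intro ext) (auto simp: extensional_def restrict_def)
  then show ?thesis unfolding swap_at_def by simp
qed

text \<open>Only the factor at \<open>s\<close> changes, by the sign of a transposition; its two
  vertices are different because the valence is at least 3.\<close>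

lemma sign_swap_at:
  assumes \<iota>: "\<iota> \<in> I"
  shows "attachments_sign (swap_at s i \<iota>) = - attachments_sign \<iota>"
proof -
  let ?\<tau> = "transpose i (Suc i mod val s)" and ?h = "\<lambda>k. \<iota> s (hord X s ! k)"
  have len: "length (hord X s) = val s"
    using hord[OF s(1)] distinct_card unfolding valence_def by metis
  have mem: "hord X s ! k \<in> half_edges X (edges X) s" if "k < val s" for k
    using that len hord(2)[OF s(1)] nth_mem by metis
  have "bij_betw ((!) (hord X s)) {..<val s} (half_edges X (edges X) s)"
    using bij_betw_nth[OF hord(1)[OF s(1)]] len hord(2)[OF s(1)] by simp
  from bij_betw_trans[OF this attachment(2)[OF \<iota> s(1)]]
  have b: "bij_betw ?h {..<val s} {..<val s}" by (simp add: comp_def)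
  have "attachment_sign X s (swap_at s i \<iota> s) = sign_on {..<val s} (?\<tau> \<circ> ?h)"
    unfolding attachment_sign_def swap_at_def using mem by (intro sign_on_cong) auto
  also have "\<dots> = sign_on {..<val s} ?\<tau> * sign_on {..<val s} ?h"
    using bij_next b by (intro sign_on_compose) auto
  also have "\<dots> = - attachment_sign X s (\<iota> s)"
    unfolding attachment_sign_def using s(2) next_less next_neq by (subst sign_on_transpose) auto
  finally have "attachment_sign X s (swap_at s i \<iota> s) = - attachment_sign X s (\<iota> s)" .
  moreover have "attachment_sign X t (swap_at s i \<iota> t) = attachment_sign X t (\<iota> t)" if "t \<noteq> s" for t
    using that by (simp add: swap_at_def)
  ultimately show ?thesis
    unfolding attachments_sign_def prod.remove[OF fin_X(3) s(1)]
    using prod.cong[of "typeA X - {s}" _ "\<lambda>t. attachment_sign X t (swap_at s i \<iota> t)"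
        "\<lambda>t. attachment_sign X t (\<iota> t)"] by simp
qed

text \<open>
  The two ways of attaching differ only in the two vertices that the collapse of \<open>(s, i)\<close> identifies.
\<close>

lemma ends_swap_at:
  assumes F: "Inr (s, i) \<in> F" and x: "x \<in> edges (blowup X \<iota>)"
  shows "(ends (blowup X (swap_at s i \<iota>)) x b, ends (blowup X \<iota>) x b) \<in> joined (blowup X \<iota>') F"
proof (cases "\<exists>e. x = Inl e \<and> ends X e b = s")
  case True
  then obtain e where e: "x = Inl e" "ends X e b = s" by blast
  then have "(e, b) \<in> half_edges X (edges X) s" using x by (auto simp: edges_blowup half_edges_def)
  then have eq: "ends (blowup X (swap_at s i \<iota>)) x b = Inr (s, transpose i (Suc i mod val s) (\<iota> s (e, b)))"
    "ends (blowup X \<iota>) x b = Inr (s, \<iota> s (e, b))"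
    using e s by (simp_all add: ends_blowup_Inl swap_at_def)
  \<comment> \<open>Polygon edges have the same ends for all attachments, so this holds in the
    blow-up for any \<iota>'.\<close>
  have "(Inr (s, i), Inr (s, Suc i mod val s)) \<in> joined (blowup X \<iota>') F"
    using joined_ends[OF F, of "blowup X \<iota>'" False True] by (simp add: ends_blowup_Inr)
  moreover from this have "(Inr (s, Suc i mod val s), Inr (s, i)) \<in> joined (blowup X \<iota>') F"
    by (rule joined_sym)
  ultimately show ?thesis unfolding eq by (simp add: transpose_def)
next
  case False
  then have "ends (blowup X (swap_at s i \<iota>)) x b = ends (blowup X \<iota>) x b"
    by (cases x) (auto simp: ends_blowup_Inl ends_blowup_Inr swap_at_def)
  then show ?thesis by simp
qed

text \<open>Each end of an edge is joined to its former position through the polygon edge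
  \<open>(s, i)\<close>, so either relation contains the generators of the other.\<close>

lemma joined_swap_at:
  assumes F: "Inr (s, i) \<in> F" "F \<subseteq> edges (blowup X \<iota>)"
  shows "joined (blowup X (swap_at s i \<iota>)) F = joined (blowup X \<iota>) F"
proof -
  let ?B = "blowup X \<iota>" and ?B' = "blowup X (swap_at s i \<iota>)"
  have sub: "joined G F \<subseteq> joined H F"
    if "\<And>x b. x \<in> F \<Longrightarrow> (ends G x b, ends H x b) \<in> joined H F" for G H :: "('v + 'v \<times> nat, 'e + 'v \<times> nat) graph"
  proof (intro subrelI)
    fix u v assume "(u, v) \<in> joined G F"
    then show "(u, v) \<in> joined H F"
    proof (rule joined_least)
      fix x b assume x: "x \<in> F"
      have "(ends H x b, ends H x (\<not> b)) \<in> joined H F" using x by (rule joined_ends)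
      then show "(ends G x b, ends G x (\<not> b)) \<in> joined H F"
        using that[OF x, of b] joined_sym[OF that[OF x, of "\<not> b"]] by (blast intro: joined_trans)
    qed (auto intro!: refl_onI transI intro: joined_trans)
  qed
  have "joined ?B' F \<subseteq> joined ?B F"
    using F by (intro sub ends_swap_at) auto
  moreover have "joined ?B F \<subseteq> joined ?B' F"
    using F by (intro sub joined_sym[OF ends_swap_at]) auto
  ultimately show ?thesis by blast
qed

text \<open>\<open>swap_at\<close> is an involution of \<open>I\<close> that reverses the sign and
  preserves the generator, so the sum equals its own negative.\<close>

lemma polygon_edge_cancels:
  assumes F: "F \<subseteq> edges X" "forest X F"
    and bs: "distinct (concat bs)" "set (concat bs) = Inl ` (edges X - F) \<union> polys - {Inr (s, i)}"
  shows "(\<Sum>\<iota>\<in>I. of_int (attachments_sign \<iota>) *\<^sub>Q gen (block_graph (collapse (Q F \<iota>) {Inr (s, i)}) bs)) = 0"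
    (is "(\<Sum>\<iota>\<in>I. ?t \<iota>) = 0")
proof -
  let ?H = "\<lambda>\<iota>. collapse (Q F \<iota>) {Inr (s, i)}"
  let ?F = "Inl ` F \<union> {Inr (s, i)}"
  have FE: "?F \<subseteq> edges (blowup X \<iota>)" for \<iota>
    using F(1) s by (auto simp: edges_blowup polygon_positions_def)
  have EH: "edges (?H \<iota>) = Inl ` (edges X - F) \<union> polys - {Inr (s, i)}" for \<iota>
    unfolding collapse_def[of "Q F \<iota>"] by (simp add: edges_Q)
  have iff: "ends (?H \<iota>) x b = ends (?H \<iota>) y c \<longleftrightarrow>
      (ends (blowup X \<iota>) x b, ends (blowup X \<iota>) y c) \<in> joined (blowup X \<iota>) ?F" for \<iota> x b y c
    unfolding ends_collapse_eq_iff Q_joined_iff ..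
  have g: "gen (block_graph (?H (swap_at s i \<iota>)) bs) = gen (block_graph (?H \<iota>) bs)" if \<iota>: "\<iota> \<in> I" for \<iota>
  proof (rule gen_block_graph_cong)
    have v: "verts (?H \<kappa>) = {ends (?H \<kappa>) e b | e b. e \<in> edges (?H \<kappa>)}" if "\<kappa> \<in> I" for \<kappa>
      using wf_Q[OF F that] valence_Q[OF F that] by (rule verts_collapse_eq_ends)
    show "verts (?H \<iota>) = {ends (?H \<iota>) e b | e b. e \<in> edges (?H \<iota>)}" by (rule v[OF \<iota>])
    show "verts (?H (swap_at s i \<iota>)) = {ends (?H (swap_at s i \<iota>)) e b | e b. e \<in> edges (?H (swap_at s i \<iota>))}"
      by (rule v[OF swap_at_attachments[OF \<iota>]])
    show "wf_graph (?H \<iota>)" using wf_Q[OF F \<iota>] by (rule wf_collapse)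
    fix x b y c assume xy: "x \<in> edges (?H \<iota>)" "y \<in> edges (?H \<iota>)"
    have "edges (?H \<iota>) \<subseteq> edges (blowup X \<iota>)" unfolding EH edges_blowup by blast
    then have "(ends (blowup X (swap_at s i \<iota>)) z d, ends (blowup X \<iota>) z d) \<in> joined (blowup X \<iota>) ?F"
      if "z \<in> edges (?H \<iota>)" for z d
      using that by (intro ends_swap_at) auto
    note e = this[OF xy(1), of b] this[OF xy(2), of c]
    have "joined (blowup X (swap_at s i \<iota>)) ?F = joined (blowup X \<iota>) ?F"
      using FE by (intro joined_swap_at) auto
    then show "ends (?H (swap_at s i \<iota>)) x b = ends (?H (swap_at s i \<iota>)) y c \<longleftrightarrow>
        ends (?H \<iota>) x b = ends (?H \<iota>) y c"
      unfolding iff using joined_cong_iff[OF e] by simp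
  qed (use bs in \<open>simp_all add: EH\<close>)
  have "(\<Sum>\<iota>\<in>I. ?t \<iota>) = (\<Sum>\<iota>\<in>I. ?t (swap_at s i \<iota>))"
    by (rule sum.reindex_bij_witness[of _ "swap_at s i" "swap_at s i"])
      (use swap_at_swap_at swap_at_attachments in auto)
  also have "\<dots> = - (\<Sum>\<iota>\<in>I. ?t \<iota>)"
    unfolding sum_negf[symmetric] using sign_swap_at g by (intro sum.cong) auto
  finally have "(\<Sum>\<iota>\<in>I. ?t \<iota>) + (\<Sum>\<iota>\<in>I. ?t \<iota>) = 0" by (simp add: eq_neg_iff_add_eq_0)
  then have "(2::rat) *\<^sub>Q (\<Sum>\<iota>\<in>I. ?t \<iota>) = 0"
    using bchain.scale_left_distrib[of 1 1 "\<Sum>\<iota>\<in>I. ?t \<iota>"] by simp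
  then show ?thesis by simp
qed

end

text \<open>The coefficient of a collapse depends on the position of the edge and not on \<iota>, so
  the terms for one polygon edge form a multiple of the sum in \<open>polygon_edge_cancels\<close>.
  There remain the insertions and the collapses in \<open>D\<close>, which will be empty for a
  maximal tree and the pair of exchanged edges in the other case.\<close>

lemma boundary_sum_attachments:
  assumes F: "F \<subseteq> edges X" "forest X F"
    and bs: "bs \<noteq> []" "[] \<notin> set bs" "distinct (concat bs)"
      "set (concat bs) = Inl ` (edges X - F) \<union> polys"
    and poly: "\<And>\<iota> x. \<iota> \<in> I \<Longrightarrow> x \<in> polys \<Longrightarrow> collapsible (block_graph (Q F \<iota>) bs) x"
    and Inl: "\<And>\<iota> e. \<iota> \<in> I \<Longrightarrow> e \<in> edges X - F \<Longrightarrow>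
      collapsible (block_graph (Q F \<iota>) bs) (Inl e) \<longleftrightarrow> e \<in> D"
    and D: "D \<subseteq> edges X - F"
  shows "boundary (\<Sum>\<iota>\<in>I. of_int (attachments_sign \<iota>) *\<^sub>Q gen (block_graph (Q F \<iota>) bs)) =
    (\<Sum>\<iota>\<in>I. of_int (attachments_sign \<iota>) *\<^sub>Q (boundary_F (block_graph (Q F \<iota>) bs) +
       (\<Sum>e\<in>D. (-1) ^ (position (Inl e) (concat bs) + length bs - 1) *\<^sub>Q
          gen (collapse_edge (block_graph (Q F \<iota>) bs) (Inl e)))))"
proof -
  have d: "block_decomp (Q F \<iota>) bs" for \<iota>
    unfolding block_decomp_def edges_Q using bs by simp
  define c where "c x = (-1 :: rat) ^ (position x (concat bs) + length bs - 1)" for x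
  define t where "t \<iota> x = gen (collapse_edge (block_graph (Q F \<iota>) bs) x)" for \<iota> x
  have finD: "finite D" using D fin_X(2) finite_subset by blast
  have b: "boundary (gen (block_graph (Q F \<iota>) bs)) =
      (\<Sum>x\<in>polys. c x *\<^sub>Q t \<iota> x) + (boundary_F (block_graph (Q F \<iota>) bs) + (\<Sum>e\<in>D. c (Inl e) *\<^sub>Q t \<iota> (Inl e)))"
    if \<iota>: "\<iota> \<in> I" for \<iota>
  proof -
    have "wf_fgraph (block_graph (Q F \<iota>) bs)"
      using bs wf_Q[OF F \<iota>] by (intro wf_block_graph) (auto simp: edges_Q)
    from boundary_gen[OF this]
    have "boundary (gen (block_graph (Q F \<iota>) bs)) =
        boundary_E (block_graph (Q F \<iota>) bs) + boundary_F (block_graph (Q F \<iota>) bs)" .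
    moreover have "{x. collapsible (block_graph (Q F \<iota>) bs) x} = polys \<union> Inl ` D"
    proof (intro set_eqI iffI)
      fix x assume x: "x \<in> {x. collapsible (block_graph (Q F \<iota>) bs) x}"
      then have "x \<in> edges (Q F \<iota>)" unfolding collapsible_def by simp
      then show "x \<in> polys \<union> Inl ` D" using x Inl[OF \<iota>] unfolding edges_Q by auto
    next
      fix x assume "x \<in> polys \<union> Inl ` D"
      then show "x \<in> {x. collapsible (block_graph (Q F \<iota>) bs) x}"
        using Inl[OF \<iota>] D poly[OF \<iota>, of x] by auto
    qed
    then have "boundary_E (block_graph (Q F \<iota>) bs) = (\<Sum>x\<in>polys \<union> Inl ` D. c x *\<^sub>Q t \<iota> x)"
      unfolding boundary_E_def length_stages_block_graph[OF d] c_def t_def by simp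
    moreover have "\<dots> = (\<Sum>x\<in>polys. c x *\<^sub>Q t \<iota> x) + (\<Sum>x\<in>Inl ` D. c x *\<^sub>Q t \<iota> x)"
      using finD finite_polygon_positions by (intro sum.union_disjoint) auto
    moreover have "(\<Sum>x\<in>Inl ` D. c x *\<^sub>Q t \<iota> x) = (\<Sum>e\<in>D. c (Inl e) *\<^sub>Q t \<iota> (Inl e))"
      by (subst sum.reindex) auto
    ultimately show ?thesis by (simp add: algebra_simps)
  qed
  have cancel: "(\<Sum>\<iota>\<in>I. of_int (attachments_sign \<iota>) *\<^sub>Q t \<iota> x) = 0" if x: "x \<in> polys" for x
  proof -
    obtain s i where si: "x = Inr (s, i)" "s \<in> typeA X" "i < val s"
      using x unfolding polygon_positions_def by auto
    have "concat (map (filter (\<lambda>y. y \<noteq> x)) bs) = filter (\<lambda>y. y \<noteq> x) (concat bs)"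
      by (simp add: filter_concat)
    then have "distinct (concat (map (filter (\<lambda>y. y \<noteq> x)) bs))"
      "set (concat (map (filter (\<lambda>y. y \<noteq> x)) bs)) = Inl ` (edges X - F) \<union> polys - {x}"
      using bs(3,4) by (simp_all only: distinct_filter set_filter) auto
    from polygon_edge_cancels[OF si(2,3) F this[unfolded si(1)]]
    show ?thesis unfolding t_def collapse_edge_block_graph si(1) .
  qed
  have "(\<Sum>\<iota>\<in>I. of_int (attachments_sign \<iota>) *\<^sub>Q (\<Sum>x\<in>polys. c x *\<^sub>Q t \<iota> x)) =
      (\<Sum>x\<in>polys. c x *\<^sub>Q (\<Sum>\<iota>\<in>I. of_int (attachments_sign \<iota>) *\<^sub>Q t \<iota> x))"
    unfolding bchain.scale_sum_right bchain.scale_scale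
    by (subst sum.swap) (simp add: mult.commute)
  then have 0: "(\<Sum>\<iota>\<in>I. of_int (attachments_sign \<iota>) *\<^sub>Q (\<Sum>x\<in>polys. c x *\<^sub>Q t \<iota> x)) = 0"
    using cancel by simp
  have "boundary (\<Sum>\<iota>\<in>I. of_int (attachments_sign \<iota>) *\<^sub>Q gen (block_graph (Q F \<iota>) bs)) =
    (\<Sum>\<iota>\<in>I. of_int (attachments_sign \<iota>) *\<^sub>Q ((\<Sum>x\<in>polys. c x *\<^sub>Q t \<iota> x) +
      (boundary_F (block_graph (Q F \<iota>) bs) + (\<Sum>e\<in>D. c (Inl e) *\<^sub>Q t \<iota> (Inl e)))))"
    unfolding boundary_sum boundary_scale using b by (intro sum.cong) auto
  also have "\<dots> = (\<Sum>\<iota>\<in>I. of_int (attachments_sign \<iota>) *\<^sub>Q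
      (boundary_F (block_graph (Q F \<iota>) bs) + (\<Sum>e\<in>D. c (Inl e) *\<^sub>Q t \<iota> (Inl e))))"
    using 0 unfolding bchain.scale_right_distrib[of _ "\<Sum>x\<in>polys. c x *\<^sub>Q t _ x"] sum.distrib by simp
  finally show ?thesis unfolding c_def t_def .
qed

end

section \<open>Grouping polygons and edges into blocks\<close>

context odd_AB
begin

text \<open>Each entry of \<open>g\<close> or \<open>h\<close> becomes one step of the filtration.
  \<open>Phi\<close> has one vertex or edge in every entry; in a bounding chain one entry has
  two.\<close>

definition blocks :: "'v list list \<Rightarrow> 'e list list \<Rightarrow> ('e + 'v \<times> nat) list list" where
  "blocks g h = map (\<lambda>ss. concat (map (polygon X) ss)) g @ map (map Inl) h"

definition grouping :: "'e set \<Rightarrow> 'v list list \<Rightarrow> 'e list list \<Rightarrow> bool" where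
  "grouping F g h \<longleftrightarrow> [] \<notin> set g \<and> [] \<notin> set h \<and> distinct (concat g) \<and> set (concat g) = typeA X \<and>
     distinct (concat h) \<and> set (concat h) = edges X - F"

lemma set_concat_blocks:
  "set (concat (blocks g h)) = Inr ` (SIGMA s:set (concat g). {..<val s}) \<union> Inl ` set (concat h)"
  unfolding blocks_def by (auto simp: set_polygon)

lemma polys_eq: "polys = Inr ` (SIGMA s:typeA X. {..<val s})"
  unfolding polygon_positions_def ..

lemma polygonal_blocks: "polygonal (set (concat (blocks g h)))"
  unfolding polygonal_def set_concat_blocks set_polygon by auto

lemma blocks_Nil: "grouping F g h \<Longrightarrow> [] \<notin> set (blocks g h)"
proof
  assume g: "grouping F g h" and "[] \<in> set (blocks g h)"
  then obtain ss where ss: "ss \<in> set g" "concat (map (polygon X) ss) = []"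
    unfolding grouping_def blocks_def by auto
  have "ss \<noteq> []" using ss(1) g unfolding grouping_def by auto
  then obtain s where s: "s \<in> set ss" by (cases ss) auto
  then have "s \<in> typeA X" using ss(1) g unfolding grouping_def by auto
  then have "polygon X s \<noteq> []" using val3_A[of s] unfolding polygon_def by auto
  then show False using ss(2) s by auto
qed

lemma distinct_polygons: "distinct ss \<Longrightarrow> distinct (concat (map (polygon X) ss))"
  by (induction ss) (auto simp: set_polygon, simp add: polygon_def distinct_map inj_on_def)

lemma distinct_blocks:
  assumes "grouping F g h"
  shows "distinct (concat (blocks g h))"
proof -
  have "concat (blocks g h) = concat (map (polygon X) (concat g)) @ map Inl (concat h)"
    unfolding blocks_def by (simp add: map_concat) (induction g, auto)
  moreover have "set (concat (map (polygon X) (concat g))) \<inter> set (map Inl (concat h)) = {}"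
    by (auto simp: set_polygon)
  ultimately show ?thesis
    using assms distinct_polygons[of "concat g"] unfolding grouping_def
    by (simp add: distinct_map inj_on_def del: set_concat)
qed

lemma set_concat_polygons:
  "set (concat (map (polygon X) ss)) = Inr ` (SIGMA s:set ss. {..<val s})"
  by (auto simp: set_polygon)

context
  notes set_concat [simp del]
begin

lemma set_blocks:
  assumes "grouping F g h"
  shows "set (concat (blocks g h)) = Inl ` (edges X - F) \<union> polys"
  using assms unfolding grouping_def set_concat_blocks polys_eq by (simp add: Un_commute)

text \<open>Otherwise the collapsed blow-up would have a vertex but no edges, against the bound on
  the valences.\<close>

lemma blocks_nonempty:
  assumes "F \<subseteq> edges X" "forest X F" "grouping F g h"
  shows "blocks g h \<noteq> []"
proof
  assume 0: "blocks g h = []"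
  then have "typeA X = {}" "edges X - F = {}" using assms(3) unfolding blocks_def grouping_def by auto
  then have E: "edges (Q F \<iota>) = {}" for \<iota> unfolding edges_Q polys_eq by auto
  \<comment> \<open>Without type A vertices \<open>I\<close> has a single element, the function that
    is \<open>undefined\<close> everywhere.\<close>
  have \<iota>: "(\<lambda>_. undefined) \<in> I" using \<open>typeA X = {}\<close> by simp
  obtain v where "v \<in> verts (Q F (\<lambda>_. undefined))"
    using connected_Q[OF assms(1,2) \<iota>] unfolding connected_graph_def by auto
  then show False using valence_Q[OF assms(1,2) \<iota>] E unfolding valence_def half_edges_def by fastforce
qed

lemma decomp_blocks:
  assumes "F \<subseteq> edges X" "forest X F" "grouping F g h"
  shows "block_decomp (Q F \<iota>) (blocks g h)"
  unfolding block_decomp_def edges_Q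
  using blocks_nonempty[OF assms] blocks_Nil[OF assms(3)] distinct_blocks[OF assms(3)] set_blocks[OF assms(3)]
  by blast

text \<open>A block of polygons is preceded by polygons only, a block of edges by all polygons. The
  two situations need different arguments throughout.\<close>

lemma blocks_split:
  assumes "blocks g h = us @ b # vs"
  obtains (poly) g1 ss g2 where "g = g1 @ ss # g2" "us = blocks g1 []" "b = concat (map (polygon X) ss)"
  | (edge) h1 es h2 where "h = h1 @ es # h2" "us = blocks g h1" "b = map Inl es"
proof -
  let ?n = "length us"
  have us: "us = take ?n (blocks g h)" and b: "b = blocks g h ! ?n" and n: "?n < length (blocks g h)"
    using assms by simp_all
  show thesis
  proof (cases "?n < length g")
    case True
    have "us = blocks (take ?n g) []"
      using us True by (simp add: blocks_def take_map)
    moreover have "b = concat (map (polygon X) (g ! ?n))"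
      using b True by (simp add: blocks_def nth_append)
    ultimately show ?thesis using poly id_take_nth_drop[OF True] by blast
  next
    case False
    let ?m = "?n - length g"
    have m: "?m < length h" using n False by (simp add: blocks_def)
    have "us = blocks g (take ?m h)"
      using us False by (simp add: blocks_def take_map)
    moreover have "b = map Inl (h ! ?m)"
      using b False m by (simp add: blocks_def nth_append)
    ultimately show ?thesis using edge id_take_nth_drop[OF m] by blast
  qed
qed

text \<open>For a stage that contains all polygons, being core reduces to this condition on
  \<open>X\<close>: no edge of the stage is a bridge of the stage together with the collapsed
  edges.\<close>

definition bridgeless :: "'e set \<Rightarrow> 'e list list \<Rightarrow> bool" where
  "bridgeless F h \<longleftrightarrow> (\<forall>h1 h2. h = h1 @ h2 \<longrightarrow> (\<forall>e\<in>set (concat h1).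
     (ends X e False, ends X e True) \<in> joined X (F \<union> (set (concat h1) - {e}))))"

lemma core_prefix:
  assumes F: "F \<subseteq> edges X" "forest X F" and g: "grouping F g h" and br: "bridgeless F h"
    and \<iota>: "\<iota> \<in> I" and us: "blocks g h = us @ vs" "us \<noteq> []" "vs \<noteq> []"
  shows "core (Q F \<iota>) (set (concat us))"
proof -
  \<comment> \<open>The kind of the block after the prefix tells whether the prefix has polygons
    only, or all polygons and possibly some edges.\<close>
  obtain v vs' where v: "vs = v # vs'" using us(3) by (cases vs) auto
  have ne: "set (concat us) \<noteq> {}"
    using us(1,2) blocks_Nil[OF g] by (cases us; cases "hd us") auto
  have sub: "set (concat us) \<subseteq> edges (Q F \<iota>)"
    unfolding edges_Q set_blocks[OF g, symmetric] us(1) by auto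
  from us(1) show ?thesis
    unfolding v
  proof (cases rule: blocks_split)
    case (poly g1 ss g2)
    then have "Inl e \<notin> set (concat us)" for e
      unfolding poly(2) set_concat_blocks by auto
    moreover have "polygonal (set (concat us))" unfolding poly(2) by (rule polygonal_blocks)
    ultimately show ?thesis
      using ne sub F by (intro core_Q_I[OF \<iota>]) (auto)
  next
    case (edge h1 es h2)
    have U: "set (concat us) = polys \<union> Inl ` set (concat h1)"
      using g unfolding edge(2) set_concat_blocks polys_eq grouping_def by simp
    have "Inl -` set (concat us) = set (concat h1)" unfolding U by auto
    moreover have "polys \<subseteq> set (concat us)" unfolding U by simp
    moreover have "polygonal (set (concat us))" unfolding edge(2) by (rule polygonal_blocks)
    moreover have "\<forall>e\<in>set (concat h1). (ends X e False, ends X e True) \<in> joined X (F \<union> (set (concat h1) - {e}))"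
      using br edge(1) unfolding bridgeless_def by blast
    ultimately show ?thesis
      using ne sub F(1) U by (intro core_Q_I[OF \<iota>]) (auto)
  qed
qed

lemma filtered_blocks:
  assumes F: "F \<subseteq> edges X" "forest X F" and g: "grouping F g h" and br: "bridgeless F h" and \<iota>: "\<iota> \<in> I"
  shows "filtered_graph (Phi_rank X) (block_graph (Q F \<iota>) (blocks g h))"
    and "fdegree (block_graph (Q F \<iota>) (blocks g h)) =
      int (card (edges X - F)) + (\<Sum>s\<in>typeA X. int (val s)) - int (length g + length h)"
proof -
  have "\<forall>v\<in>verts (Q F \<iota>). 3 \<le> valence (Q F \<iota>) (edges (Q F \<iota>)) v"
    using valence_Q[OF F \<iota>] by blast
  note fb = filtered_block_graph[OF decomp_blocks[OF F g] wf_Q[OF F \<iota>] connected_Q[OF F \<iota>] rank_Q[OF F \<iota>] this]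
  show "filtered_graph (Phi_rank X) (block_graph (Q F \<iota>) (blocks g h))"
    by (rule fb(1)) (rule core_prefix[OF F g br \<iota>])
  have "fdegree (block_graph (Q F \<iota>) (blocks g h)) =
      int (card (edges (Q F \<iota>))) - int (length (blocks g h))"
    by (rule fb(2)) (rule core_prefix[OF F g br \<iota>])
  moreover have "int (length (blocks g h)) = int (length g + length h)" by (simp add: blocks_def)
  ultimately show "fdegree (block_graph (Q F \<iota>) (blocks g h)) =
      int (card (edges X - F)) + (\<Sum>s\<in>typeA X. int (val s)) - int (length g + length h)"
    unfolding card_edges_Q[OF F] by simp
qed

section \<open>Signed sums over attachments: collapses and insertions\<close>

definition chain :: "'e set \<Rightarrow> 'v list list \<Rightarrow> 'e list list \<Rightarrow> bchain" where
  "chain F g h = (\<Sum>\<iota>\<in>I. of_int (attachments_sign \<iota>) *\<^sub>Q gen (block_graph (Q F \<iota>) (blocks g h)))"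

lemma chain_in_chains:
  assumes F: "F \<subseteq> edges X" "forest X F" and g: "grouping F g h" and br: "bridgeless F h"
    and n: "n = int (card (edges X - F)) + (\<Sum>s\<in>typeA X. int (val s)) - int (length g + length h)"
  shows "chain F g h \<in> chains (Phi_rank X) n"
  unfolding chain_def
proof (intro chains_sum chains_scale)
  fix \<iota> assume \<iota>: "\<iota> \<in> I"
  show "gen (block_graph (Q F \<iota>) (blocks g h)) \<in> chains (Phi_rank X) n"
    using gen_in_chains[OF filtered_blocks(1)[OF F g br \<iota>]] filtered_blocks(2)[OF F g br \<iota>] n by simp
qed

text \<open>Earlier blocks contain no edge of the polygon of \<open>x\<close>. With \<open>x\<close>
  and a second edge of that polygon missing, the ends of \<open>x\<close> lie on different arcs and
  stay apart.\<close>

lemma collapsible_polygon_edge: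
  assumes T: "maximal_tree X T" "F \<subseteq> T" and g: "grouping F g h" and \<iota>: "\<iota> \<in> I" and x: "x \<in> polys"
  shows "collapsible (block_graph (Q F \<iota>) (blocks g h)) x"
proof -
  have F: "F \<subseteq> edges X" "forest X F"
    using T forest_subset[OF forest_maximal_tree] unfolding maximal_tree_def by auto
  note d = decomp_blocks[OF F g]
  obtain s i where si: "x = Inr (s, i)" "s \<in> typeA X" "i < val s"
    using x unfolding polys_eq by auto
  have "x \<in> edges (Q F \<iota>)" using x by (simp add: edges_Q)
  then obtain us b vs where b: "blocks g h = us @ b # vs" "x \<in> set b"
    using block_decomp_split[OF d] by blast
  from b(1) show ?thesis
  proof (cases rule: blocks_split)
    case (poly g1 ss g2)
    have s: "s \<in> set ss" "s \<notin> set (concat g1)"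
    proof -
      show "s \<in> set ss" using b(2) si(1) unfolding poly(3) set_concat_polygons by auto
      then show "s \<notin> set (concat g1)" using g unfolding grouping_def poly(1) by auto
    qed
    \<comment> \<open>Any index other than \<open>i\<close> would do.\<close>
    define j where "j = (if i = 0 then 1 else 0 :: nat)"
    have j: "j < val s" "i \<noteq> j" using val3_A[OF si(2)] unfolding j_def by auto
    have "Inr (s, j) \<in> set b" using s(1) j(1) unfolding poly(3) set_concat_polygons by auto
    then have "b \<noteq> [x]" using j(2) si(1) by auto
    moreover have "set (concat us) = Inr ` (SIGMA s:set (concat g1). {..<val s})"
      unfolding poly(2) set_concat_blocks by simp
    moreover have "set (concat g1) \<subseteq> typeA X" using g unfolding grouping_def poly(1) by auto
    ultimately have "set (concat us) \<subseteq> polys" "Inr (s, i) \<notin> set (concat us)" "Inr (s, j) \<notin> set (concat us)"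
      using s(2) unfolding polys_eq by auto
    from polygon_edges_separate_Q[OF \<iota> T si(2,3) j this] show ?thesis
      using \<open>b \<noteq> [x]\<close> si(1) unfolding collapsible_block_graph[OF d b] by simp
  next
    case (edge h1 es h2)
    then show ?thesis using b(2) si(1) by auto
  qed
qed

text \<open>Among the polygons, the core property forces \<open>C\<close> to consist of whole
  polygons, so a set \<open>W\<close> of vertices describes it. Among the edges any subset has the
  required shape; there the core property is passed on, to rule out candidates in the exchange
  chain.\<close>

lemma insertable_blocks:
  assumes T: "maximal_tree X T" "F \<subseteq> T" and g: "grouping F g h" and \<iota>: "\<iota> \<in> I"
    and C: "insertable (block_graph (Q F \<iota>) (blocks g h)) C"
  obtains (poly) g1 ss g2 W where "g = g1 @ ss # g2" "W \<noteq> {}" "W \<subset> set ss"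
      "C = Inr ` (SIGMA s:set (concat g1) \<union> W. {..<val s})"
  | (edge) h1 es h2 W where "h = h1 @ es # h2" "W \<noteq> {}" "W \<subset> set es"
      "C = polys \<union> Inl ` (set (concat h1) \<union> W)" "core (Q F \<iota>) C"
proof -
  have F: "F \<subseteq> edges X" "forest X F"
    using T forest_subset[OF forest_maximal_tree] unfolding maximal_tree_def by auto
  obtain us b vs where b: "blocks g h = us @ b # vs" and core: "core (Q F \<iota>) C"
    and C: "set (concat us) \<subset> C" "C \<subset> set (concat us) \<union> set b"
    using insertable_block_graph[OF decomp_blocks[OF F g] C] .
  from b show thesis
  proof (cases rule: blocks_split)
    case 1: (poly g1 ss g2)
    have U: "set (concat us) = Inr ` (SIGMA s:set (concat g1). {..<val s})"
      unfolding 1(2) set_concat_blocks by simp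
    have B: "set b = Inr ` (SIGMA s:set ss. {..<val s})"
      unfolding 1(3) by (rule set_concat_polygons)
    have A: "set (concat g1) \<union> set ss \<subseteq> typeA X" using g unfolding grouping_def 1(1) by auto
    have "C \<subseteq> polys" using C(2) A unfolding U B polys_eq by blast
    then have pol: "polygonal C" using core_Q_polygonal[OF \<iota> T core] by simp
    define W where "W = {s \<in> set ss. set (polygon X s) \<subseteq> C}"
    have CW: "C = Inr ` (SIGMA s:set (concat g1) \<union> W. {..<val s})"
    proof (intro subset_antisym subsetI)
      fix x assume x: "x \<in> C"
      then have "x \<in> set (concat us) \<or> x \<in> set b" using C(2) by auto
      then show "x \<in> Inr ` (SIGMA s:set (concat g1) \<union> W. {..<val s})"
      proof
        assume "x \<in> set b"
        then obtain s i where s: "x = Inr (s, i)" "s \<in> set ss" "i < val s" unfolding B by auto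
        then have "x \<in> set (polygon X s) \<inter> C" "s \<in> typeA X" using x A by (auto simp: set_polygon)
        then have "set (polygon X s) \<subseteq> C" using pol unfolding polygonal_def by blast
        then show ?thesis using s unfolding W_def by auto
      qed (auto simp: U)
    next
      fix x :: "'e + 'v \<times> nat"
      assume "x \<in> Inr ` (SIGMA s:set (concat g1) \<union> W. {..<val s})"
      then obtain s i where s: "x = Inr (s, i)" "i < val s" "s \<in> set (concat g1) \<or> s \<in> W" by blast
      then show "x \<in> C" using C(1) unfolding U W_def set_polygon by blast
    qed
    have "W \<noteq> {}" using CW C(1) unfolding U by auto
    moreover have "W \<noteq> set ss"
    proof
      assume "W = set ss"
      then have "C = set (concat us) \<union> set b" unfolding CW U B by auto
      then show False using C(2) by blast
    qed
    then have "W \<subset> set ss" unfolding W_def by auto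
    ultimately show ?thesis using poly 1(1) CW by blast
  next
    case 2: (edge h1 es h2)
    have U: "set (concat us) = polys \<union> Inl ` set (concat h1)"
      using g unfolding 2(2) set_concat_blocks polys_eq grouping_def by simp
    define W where "W = {e \<in> set es. Inl e \<in> C}"
    have CW: "C = polys \<union> Inl ` (set (concat h1) \<union> W)"
      using C unfolding U 2(3) W_def by auto
    have "W \<noteq> {}" using CW C(1) unfolding U by auto
    moreover have "W \<noteq> set es"
    proof
      assume "W = set es"
      then have "C = set (concat us) \<union> set b" unfolding CW U 2(3) by auto
      then show False using C(2) by blast
    qed
    then have "W \<subset> set es" unfolding W_def by auto
    ultimately show ?thesis using edge 2(1) CW core by blast
  qed
qed

end

section \<open>Singleton blocks and the cycle condition\<close>

abbreviation singles :: "'a list \<Rightarrow> 'a list list" where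
  "singles xs \<equiv> map (\<lambda>x. [x]) xs"

lemma concat_singles [simp]: "concat (singles xs) = xs"
  by (induction xs) auto

text \<open>Only an entry with at least two elements has a nonempty proper subset, so the cut goes
  through the pair.\<close>

lemma split_singles_pair:
  assumes "singles us @ [x, y] # singles vs = g1 @ ss # g2" "W \<noteq> {}" "W \<subset> set ss"
  shows "g1 = singles us" "W = {x} \<or> W = {y}"
proof -
  have "ss \<in> set (singles us @ [x, y] # singles vs)" unfolding assms(1) by simp
  moreover have "ss \<noteq> [z]" for z using assms(2,3) by auto
  ultimately have ss: "ss = [x, y]" by auto
  then show "W = {x} \<or> W = {y}" using assms(2,3) by auto
  have "[x, y] \<notin> set (singles us)" "[x, y] \<notin> set (singles vs)" by auto
  then show "g1 = singles us" using assms(1) append_Cons_eq_iff unfolding ss by metis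
qed

lemma split_singles:
  assumes "singles xs = g1 @ ss # g2" "W \<noteq> {}" "W \<subset> set ss"
  shows False
proof -
  have "ss \<in> set (singles xs)" unfolding assms(1) by simp
  then show False using assms(2,3) by auto
qed

lemma Phi_eq_chain: "Phi X T o\<^sub>1 o\<^sub>2 = chain T (singles o\<^sub>1) (singles o\<^sub>2)"
proof -
  have "Y_graph X T o\<^sub>1 o\<^sub>2 \<iota> = block_graph (Q T \<iota>) (blocks (singles o\<^sub>1) (singles o\<^sub>2))" for \<iota>
    unfolding Y_graph_def block_graph_def blocks_def Q_def Let_def by (simp add: comp_def)
  then show ?thesis unfolding Phi_def chain_def attachments_sign_def by simp
qed

lemma choice_grouping:
  "Phi_choice X T o\<^sub>1 o\<^sub>2 \<Longrightarrow> grouping T (singles o\<^sub>1) (singles o\<^sub>2)"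
  unfolding Phi_choice_def grouping_def by auto

lemma tree_facts:
  assumes "maximal_tree X T"
  shows "T \<subseteq> edges X" "forest X T" "e \<in> edges X \<Longrightarrow> T \<subseteq> F \<Longrightarrow> (ends X e b, ends X e c) \<in> joined X F"
  using assms forest_maximal_tree joined_monoD[of _ _ X T F] ends_X unfolding maximal_tree_def by auto

lemma bridgeless_tree:
  assumes T: "maximal_tree X T" and g: "grouping T g h"
  shows "bridgeless T h"
proof -
  have "e \<in> edges X" if "h = h1 @ h2" "e \<in> set (concat h1)" for h1 h2 e
    using g that unfolding grouping_def by auto
  then show ?thesis unfolding bridgeless_def using tree_facts(3)[OF T] by blast
qed

text \<open>The stage before a block of edges contains all polygons, and together with the collapsed
  tree it joins the ends of every edge of \<open>X\<close>. So no edge of \<open>X - T\<close> is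
  collapsible, and only insertions are left.\<close>

lemma boundary_chain_tree:
  assumes T: "maximal_tree X T" and g: "grouping T g h"
  shows "boundary (chain T g h) =
    (\<Sum>\<iota>\<in>I. of_int (attachments_sign \<iota>) *\<^sub>Q boundary_F (block_graph (Q T \<iota>) (blocks g h)))"
proof -
  note F = tree_facts(1,2)[OF T]
  have nc: "\<not> collapsible (block_graph (Q T \<iota>) (blocks g h)) (Inl e)" if \<iota>: "\<iota> \<in> I" and e: "e \<in> edges X - T" for \<iota> e
  proof -
    note d = decomp_blocks[OF F g]
    have eE: "Inl e \<in> edges (blowup X \<iota>)" using e by (simp add: edges_blowup)
    have "Inl e \<in> edges (Q T \<iota>)" using e by (simp add: edges_Q)
    then obtain us b vs where b: "blocks g h = us @ b # vs" "Inl e \<in> set b"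
      using block_decomp_split[OF d] by blast
    from b(1) show ?thesis
    proof (cases rule: blocks_split)
      case (poly g1 ss g2)
      then show ?thesis using b(2) by (auto simp: set_polygon)
    next
      case (edge h1 es h2)
      have U: "set (concat us) = polys \<union> Inl ` set (concat h1)"
        using g unfolding edge(2) set_concat_blocks polys_eq grouping_def by simp
      have "set (concat h1) \<subseteq> edges X" using g unfolding grouping_def edge(1) by auto
      then have "Inl ` T \<union> set (concat us) \<subseteq> edges (blowup X \<iota>)" "polys \<subseteq> Inl ` T \<union> set (concat us)"
        unfolding U edges_blowup using F(1) by auto
      moreover have "T \<subseteq> Inl -` (Inl ` T \<union> set (concat us))" by auto
      then have "(ends X e False, ends X e True) \<in> joined X (Inl -` (Inl ` T \<union> set (concat us)))"
        using tree_facts(3)[OF T] e by blast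
      ultimately have "(ends (blowup X \<iota>) (Inl e) False, ends (blowup X \<iota>) (Inl e) True)
          \<in> joined (blowup X \<iota>) (Inl ` T \<union> set (concat us))"
        using joined_blowup[OF \<iota> _ _ ends_blowup_verts[OF \<iota> eE] ends_blowup_verts[OF \<iota> eE]] by simp
      then show ?thesis unfolding collapsible_block_graph[OF d b] Q_joined_iff by simp
    qed
  qed
  show ?thesis
    unfolding chain_def
    by (subst boundary_sum_attachments[OF F blocks_nonempty[OF F g] blocks_Nil[OF g] distinct_blocks[OF g]
          set_blocks[OF g], where D = "{}"])
      (use nc collapsible_polygon_edge[OF T subset_refl g] in auto)
qed

text \<open>Every block is one polygon or one edge, so there is no room for an insertion. In the
  degree, a polygon counts its valence minus one for its stage, and an edge of \<open>X - T\<close>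
  cancels with its own stage.\<close>

lemma Phi_cycle:
  assumes c: "Phi_choice X T o\<^sub>1 o\<^sub>2"
  shows "Phi X T o\<^sub>1 o\<^sub>2 \<in> cycles (Phi_rank X) (Phi_degree X)"
proof -
  have T: "maximal_tree X T" using c unfolding Phi_choice_def by simp
  note F = tree_facts(1,2)[OF T] and g = choice_grouping[OF c]
  have len: "length o\<^sub>1 = card (typeA X)" "length o\<^sub>2 = card (edges X - T)"
    using c distinct_card unfolding Phi_choice_def by metis+
  have "Phi X T o\<^sub>1 o\<^sub>2 \<in> chains (Phi_rank X) (Phi_degree X)"
    unfolding Phi_eq_chain
    by (rule chain_in_chains[OF F g bridgeless_tree[OF T g]])
      (simp add: len Phi_degree_def sum_subtractf)
  moreover have "boundary_F (block_graph (Q T \<iota>) (blocks (singles o\<^sub>1) (singles o\<^sub>2))) = 0" if \<iota>: "\<iota> \<in> I" for \<iota>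
  proof -
    have "\<not> insertable (block_graph (Q T \<iota>) (blocks (singles o\<^sub>1) (singles o\<^sub>2))) C" for C
    proof
      assume "insertable (block_graph (Q T \<iota>) (blocks (singles o\<^sub>1) (singles o\<^sub>2))) C"
      then show False
      proof (cases rule: insertable_blocks[OF T subset_refl g \<iota>, consumes 1, case_names poly edge])
        case (poly g1 ss g2 W)
        then show False using split_singles by metis
      next
        case (edge h1 es h2 W)
        then show False using split_singles by metis
      qed
    qed
    then show ?thesis unfolding boundary_F_def by (intro sum.neutral) blast
  qed
  then have "boundary (Phi X T o\<^sub>1 o\<^sub>2) = 0"
    unfolding Phi_eq_chain boundary_chain_tree[OF T g] by simp
  ultimately show ?thesis unfolding cycles_def by simp
qed

end

section \<open>Exchanging tree edges\<close>

text \<open>The path of \<open>T\<close> between the ends of \<open>e\<close> crosses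
  \<open>f\<close>, so conversely \<open>f\<close> is bypassed through \<open>e\<close> and the new
  set still spans. If some other edge \<open>d\<close> no longer separated, a bypass of
  \<open>d\<close> would use \<open>e\<close>; completed by \<open>d\<close> itself, it would join
  the ends of \<open>e\<close> within \<open>T - {f}\<close>.\<close>

lemma exchange_tree:
  assumes T: "maximal_tree X T" and f: "f \<in> T" and e: "e \<in> edges X" "e \<notin> T"
    and nj: "(ends X e False, ends X e True) \<notin> joined X (T - {f})"
    and w: "wf_graph X"
  shows "maximal_tree X (insert e (T - {f}))"
proof -
  let ?F = "T - {f}" and ?T = "insert e (T - {f})"
  have insT: "insert f ?F = T" using f by blast
  have sep: "(ends X d b, ends X d (\<not> b)) \<notin> joined X (T - {d})" if "d \<in> T" for d b
    using T that joined_sym[of _ _ X "T - {d}"] unfolding maximal_tree_def separating_edge_def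
    by (cases b) auto
  have m: "(u, v) \<in> joined X ?T" if "(u, v) \<in> joined X ?F" for u v
    using that by (rule joined_monoD) blast
  have "(ends X e False, ends X e True) \<in> joined X (insert f ?F)"
    using T e(1) w unfolding insT maximal_tree_def wf_graph_def by blast
  from joined_insert_cases[OF this] nj obtain b where
    b: "(ends X e False, ends X f b) \<in> joined X ?F" "(ends X f (\<not> b), ends X e True) \<in> joined X ?F"
    by blast
  have "(ends X f b, ends X e False) \<in> joined X ?T" using b(1) by (intro joined_sym[OF m])
  moreover have "(ends X e False, ends X e True) \<in> joined X ?T" by (simp add: joined_ends)
  moreover have "(ends X e True, ends X f (\<not> b)) \<in> joined X ?T" using b(2) by (intro joined_sym[OF m])
  ultimately have fb: "(ends X f b, ends X f (\<not> b)) \<in> joined X ?T" by (blast intro: joined_trans)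
  have f2: "(ends X f c, ends X f (\<not> c)) \<in> joined X ?T" for c
    using fb joined_sym[OF fb] by (cases "c = b") auto
  have span: "(u, v) \<in> joined X ?T" if "(u, v) \<in> joined X T" for u v
    using that
  proof (rule joined_least)
    fix d c assume "d \<in> T"
    then show "(ends X d c, ends X d (\<not> c)) \<in> joined X ?T"
      using f2 by (cases "d = f") (auto intro: joined_ends)
  qed (auto intro!: refl_onI transI intro: joined_trans)
  have "separating_edge X ?T d" if d: "d \<in> ?T" for d
  proof (cases "d = e")
    case True
    then have "?T - {d} = ?F" using e(2) by blast
    then show ?thesis using nj True unfolding separating_edge_def by simp
  next
    case False
    then have dT: "d \<in> T" "d \<noteq> f" using d by auto
    have eq: "?T - {d} = insert e (?F - {d})" using False by blast
    have sub: "(u, v) \<in> joined X ?F" if "(u, v) \<in> joined X (?F - {d})" for u v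
      using that by (rule joined_monoD) blast
    show ?thesis
      unfolding separating_edge_def
    proof
      assume "(ends X d False, ends X d True) \<in> joined X (?T - {d})"
      from joined_insert_cases[OF this[unfolded eq]] show False
      proof (elim disjE exE conjE)
        assume "(ends X d False, ends X d True) \<in> joined X (?F - {d})"
        then have "(ends X d False, ends X d True) \<in> joined X (T - {d})"
          by (rule joined_monoD) blast
        then show False using sep[OF dT(1), of False] by simp
      next
        fix c assume c: "(ends X d False, ends X e c) \<in> joined X (?F - {d})"
          "(ends X e (\<not> c), ends X d True) \<in> joined X (?F - {d})"
        have "(ends X e c, ends X d False) \<in> joined X ?F" using c(1) by (intro joined_sym[OF sub])
        moreover have "(ends X d False, ends X d True) \<in> joined X ?F" using dT by (intro joined_ends) simp
        moreover have "(ends X d True, ends X e (\<not> c)) \<in> joined X ?F" using c(2) by (intro joined_sym[OF sub])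
        ultimately have "(ends X e c, ends X e (\<not> c)) \<in> joined X ?F" by (blast intro: joined_trans)
        then show False using nj joined_sym[of _ _ X ?F] by (cases c) auto
      qed
    qed
  qed
  then show ?thesis
    using T span e(1) unfolding maximal_tree_def by auto
qed

text \<open>Without \<open>f\<close> the tree \<open>T\<close> no longer joins the ends of
  \<open>f\<close>, but \<open>T'\<close> does, so some edge of \<open>T'\<close> crosses the
  gap.\<close>

lemma tree_exchange_exists:
  assumes T: "maximal_tree X T" and T': "maximal_tree X T'" and ne: "T \<noteq> T'" and w: "wf_graph X"
  obtains e f where "f \<in> T" "f \<notin> T'" "e \<in> T'" "e \<notin> T"
    "(ends X e False, ends X e True) \<notin> joined X (T - {f})"
proof -
  have j: "(ends X e False, ends X e True) \<in> joined X S" if "maximal_tree X S" "e \<in> edges X" for e S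
    using that w unfolding maximal_tree_def wf_graph_def by auto
  \<comment> \<open>One maximal tree cannot properly contain another, since its additional edges
    would not separate.\<close>
  have "\<not> T \<subseteq> T'"
  proof
    assume sub: "T \<subseteq> T'"
    then obtain e where e: "e \<in> T'" "e \<notin> T" using ne by blast
    then have "(ends X e False, ends X e True) \<in> joined X T"
      using j[OF T] T' unfolding maximal_tree_def by blast
    then have "(ends X e False, ends X e True) \<in> joined X (T' - {e})"
      by (rule joined_monoD) (use sub e in blast)
    then show False using T' e(1) unfolding maximal_tree_def separating_edge_def by blast
  qed
  then obtain f where f: "f \<in> T" "f \<notin> T'" by blast
  have "\<exists>e\<in>T'. (ends X e False, ends X e True) \<notin> joined X (T - {f})"
  proof (rule ccontr)
    assume "\<not> ?thesis"
    then have all: "(ends X e False, ends X e True) \<in> joined X (T - {f})" if "e \<in> T'" for e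
      using that by blast
    have "(ends X f False, ends X f True) \<in> joined X T'"
      using j[OF T'] f(1) T unfolding maximal_tree_def by blast
    then have "(ends X f False, ends X f True) \<in> joined X (T - {f})"
    proof (rule joined_least)
      show "(ends X e b, ends X e (\<not> b)) \<in> joined X (T - {f})" if "e \<in> T'" for e b
        using all[OF that] joined_sym[OF all[OF that]] by (cases b) auto
    qed (auto intro!: refl_onI transI intro: joined_trans)
    then show False using T f(1) unfolding maximal_tree_def separating_edge_def by blast
  qed
  then obtain e where e: "e \<in> T'" "(ends X e False, ends X e True) \<notin> joined X (T - {f})" by blast
  have "e \<notin> T - {f}" using e(2) joined_ends[of e "T - {f}" X False True] by blast
  then have "e \<notin> T" using e(1) f(2) by blast
  then show thesis using that f e by blast
qed


section \<open>Independence of the choices\<close>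

context odd_AB
begin

lemma scale_sum_diff:
  "(\<Sum>i\<in>S. a i *\<^sub>Q c *\<^sub>Q (x i - y i)) = c *\<^sub>Q ((\<Sum>i\<in>S. a i *\<^sub>Q x i) - (\<Sum>i\<in>S. a i *\<^sub>Q y i))"
  by (simp add: bchain.scale_sum_right bchain.scale_right_diff_distrib sum_subtractf mult.commute)

lemma length_choice:
  assumes "Phi_choice X T o\<^sub>1 o\<^sub>2"
  shows "length o\<^sub>1 = card (typeA X)" "length o\<^sub>2 = card (edges X - T)"
  using assms distinct_card unfolding Phi_choice_def by metis+

text \<open>The two stages that can be inserted are core because they already occur in the
  filtrations of the two refined graphs. Merging two blocks removes a stage, which raises the degree
  by one.\<close>

lemma homologous_swap_blocks:
  assumes c: "Phi_choice X T o\<^sub>1 o\<^sub>2" "Phi_choice X T o\<^sub>1' o\<^sub>2'" and g: "grouping T g h"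
    and M: "blocks g h = us @ (b @ b') # vs"
    and A: "blocks (singles o\<^sub>1) (singles o\<^sub>2) = us @ b # b' # vs"
    and B: "blocks (singles o\<^sub>1') (singles o\<^sub>2') = us @ b' # b # vs"
    and odd: "odd (length b)" "odd (length b')"
    and only: "\<And>\<iota> C. \<iota> \<in> I \<Longrightarrow> insertable (block_graph (Q T \<iota>) (blocks g h)) C \<Longrightarrow>
      C = set (concat us) \<union> set b \<or> C = set (concat us) \<union> set b'"
  shows "(Phi X T o\<^sub>1 o\<^sub>2, Phi X T o\<^sub>1' o\<^sub>2') \<in> homologous (Phi_rank X) (Phi_degree X)"
proof -
  have T: "maximal_tree X T" using c unfolding Phi_choice_def by simp
  note F = tree_facts(1,2)[OF T]
  note gA = choice_grouping[OF c(1)] and gB = choice_grouping[OF c(2)]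
  have core: "core (Q T \<iota>) (set (concat us) \<union> set b)" "core (Q T \<iota>) (set (concat us) \<union> set b')"
    if \<iota>: "\<iota> \<in> I" for \<iota>
    using core_prefix[OF F gA bridgeless_tree[OF T gA] \<iota>, of "us @ [b]" "b' # vs"]
      core_prefix[OF F gB bridgeless_tree[OF T gB] \<iota>, of "us @ [b']" "b # vs"] A B by simp_all
  have bF: "boundary_F (block_graph (Q T \<iota>) (blocks g h)) = (-1) ^ Suc (length us) *\<^sub>Q
      (gen (block_graph (Q T \<iota>) (blocks (singles o\<^sub>1) (singles o\<^sub>2))) -
       gen (block_graph (Q T \<iota>) (blocks (singles o\<^sub>1') (singles o\<^sub>2'))))" if \<iota>: "\<iota> \<in> I" for \<iota>
    unfolding M A B
    using boundary_F_merged_blocks[OF _ wf_Q[OF F \<iota>] odd core[OF \<iota>], of vs] only[OF \<iota>]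
      decomp_blocks[OF F g, of \<iota>] unfolding M by blast
  have "boundary (chain T g h) = (-1) ^ Suc (length us) *\<^sub>Q (Phi X T o\<^sub>1 o\<^sub>2 - Phi X T o\<^sub>1' o\<^sub>2')"
    unfolding boundary_chain_tree[OF T g] unfolding Phi_eq_chain chain_def scale_sum_diff[symmetric]
    using bF by (intro sum.cong) auto
  then have "Phi X T o\<^sub>1 o\<^sub>2 - Phi X T o\<^sub>1' o\<^sub>2' = (-1) ^ Suc (length us) *\<^sub>Q boundary (chain T g h)"
    by (simp flip: power_mult_distrib)
  moreover have "chain T g h \<in> chains (Phi_rank X) (Phi_degree X + 1)"
  proof (rule chain_in_chains[OF F g bridgeless_tree[OF T g]])
    have "Suc (length (blocks g h)) = length (blocks (singles o\<^sub>1) (singles o\<^sub>2))" unfolding M A by simp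
    then have "Suc (length g + length h) = card (typeA X) + card (edges X - T)"
      using length_choice[OF c(1)] unfolding blocks_def by simp
    then show "Phi_degree X + 1 = int (card (edges X - T)) + (\<Sum>s\<in>typeA X. int (val s)) - int (length g + length h)"
      unfolding Phi_degree_def by (simp add: sum_subtractf)
  qed
  then have "boundary (chain T g h) \<in> boundaries (Phi_rank X) (Phi_degree X)"
    unfolding boundaries_def by (rule imageI)
  ultimately have "Phi X T o\<^sub>1 o\<^sub>2 - Phi X T o\<^sub>1' o\<^sub>2' \<in> boundaries (Phi_rank X) (Phi_degree X)"
    by (simp only: boundaries_scale)
  then show ?thesis
    using Phi_cycle[OF c(1)] Phi_cycle[OF c(2)] unfolding homologous_def by simp
qed

lemma homologous_swap_vertices:
  assumes c: "Phi_choice X T (us @ x # y # vs) o\<^sub>2"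
  shows "(Phi X T (us @ x # y # vs) o\<^sub>2, Phi X T (us @ y # x # vs) o\<^sub>2) \<in> homologous (Phi_rank X) (Phi_degree X)"
proof (rule homologous_swap_blocks[OF c])
  have T: "maximal_tree X T" using c unfolding Phi_choice_def by simp
  show "Phi_choice X T (us @ y # x # vs) o\<^sub>2" using c unfolding Phi_choice_def by auto
  let ?g = "singles us @ [x, y] # singles vs"
  show g: "grouping T ?g (singles o\<^sub>2)"
    using c unfolding Phi_choice_def grouping_def by auto
  show "blocks ?g (singles o\<^sub>2) =
    map (polygon X) us @ (polygon X x @ polygon X y) # (map (polygon X) vs @ map (\<lambda>e. [Inl e]) o\<^sub>2)"
    "blocks (singles (us @ x # y # vs)) (singles o\<^sub>2) =
    map (polygon X) us @ polygon X x # polygon X y # (map (polygon X) vs @ map (\<lambda>e. [Inl e]) o\<^sub>2)"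
    "blocks (singles (us @ y # x # vs)) (singles o\<^sub>2) =
    map (polygon X) us @ polygon X y # polygon X x # (map (polygon X) vs @ map (\<lambda>e. [Inl e]) o\<^sub>2)"
    unfolding blocks_def by (simp_all add: comp_def)
  show "odd (length (polygon X x))" "odd (length (polygon X y))"
    using c odd_val unfolding Phi_choice_def polygon_def by auto
  fix \<iota> C assume \<iota>: "\<iota> \<in> I" and "insertable (block_graph (Q T \<iota>) (blocks ?g (singles o\<^sub>2))) C"
  from this(2) show "C = set (concat (map (polygon X) us)) \<union> set (polygon X x) \<or>
      C = set (concat (map (polygon X) us)) \<union> set (polygon X y)"
  proof (cases rule: insertable_blocks[OF T subset_refl g \<iota>, consumes 1, case_names poly edge])
    case (poly g1 ss g2 W)
    note s = split_singles_pair[OF poly(1-3)]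
    have "C = set (concat (map (polygon X) (us @ [z])))" if "W = {z}" for z
      unfolding poly(4) set_concat_polygons s(1) that by simp
    then show ?thesis using s(2) by auto
  next
    case (edge h1 es h2 W)
    then show ?thesis using split_singles by metis
  qed
qed

lemma homologous_swap_edges:
  assumes c: "Phi_choice X T o\<^sub>1 (us @ x # y # vs)"
  shows "(Phi X T o\<^sub>1 (us @ x # y # vs), Phi X T o\<^sub>1 (us @ y # x # vs)) \<in> homologous (Phi_rank X) (Phi_degree X)"
proof (rule homologous_swap_blocks[OF c])
  have T: "maximal_tree X T" using c unfolding Phi_choice_def by simp
  show "Phi_choice X T o\<^sub>1 (us @ y # x # vs)" using c unfolding Phi_choice_def by auto
  let ?h = "singles us @ [x, y] # singles vs"
  let ?us = "map (polygon X) o\<^sub>1 @ map (\<lambda>e. [Inl e]) us"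
  show g: "grouping T (singles o\<^sub>1) ?h"
    using c unfolding Phi_choice_def grouping_def by auto
  show "blocks (singles o\<^sub>1) ?h = ?us @ ([Inl x] @ [Inl y]) # map (\<lambda>e. [Inl e]) vs"
    "blocks (singles o\<^sub>1) (singles (us @ x # y # vs)) = ?us @ [Inl x] # [Inl y] # map (\<lambda>e. [Inl e]) vs"
    "blocks (singles o\<^sub>1) (singles (us @ y # x # vs)) = ?us @ [Inl y] # [Inl x] # map (\<lambda>e. [Inl e]) vs"
    unfolding blocks_def by (simp_all add: comp_def)
  show "odd (length [Inl x])" "odd (length [Inl y])" by simp_all
  fix \<iota> C assume \<iota>: "\<iota> \<in> I" and "insertable (block_graph (Q T \<iota>) (blocks (singles o\<^sub>1) ?h)) C"
  from this(2) show "C = set (concat ?us) \<union> set [Inl x] \<or> C = set (concat ?us) \<union> set [Inl y]"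
  proof (cases rule: insertable_blocks[OF T subset_refl g \<iota>, consumes 1, case_names poly edge])
    case (poly g1 ss g2 W)
    then show ?thesis using split_singles by metis
  next
    case (edge h1 es h2 W)
    note s = split_singles_pair[OF edge(1-3)]
    have "set (concat ?us) = polys \<union> Inl ` set us"
      using c unfolding concat_append set_append set_concat_polygons polys_eq Phi_choice_def by auto
    then show ?thesis
      using s(2) unfolding edge(4) s(1) by (auto simp del: set_concat)
  qed
qed

text \<open>The two orderings are changed one after the other; the mixed choice in between is
  admissible because admissibility depends only on the multisets.\<close>

lemma homologous_reorder:
  assumes c: "Phi_choice X T o\<^sub>1 o\<^sub>2" and c': "Phi_choice X T o\<^sub>1' o\<^sub>2'"
  shows "(Phi X T o\<^sub>1 o\<^sub>2, Phi X T o\<^sub>1' o\<^sub>2') \<in> homologous (Phi_rank X) (Phi_degree X)"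
proof -
  have ms: "mset o\<^sub>1 = mset o\<^sub>1'" "mset o\<^sub>2 = mset o\<^sub>2'"
    using c c' unfolding Phi_choice_def by (metis set_eq_iff_mset_eq_distinct)+
  have choice: "Phi_choice X T p q" if "mset p = mset o\<^sub>1" "mset q = mset o\<^sub>2" for p q
    using c that mset_eq_imp_distinct_iff[OF that(1)] mset_eq_imp_distinct_iff[OF that(2)]
      mset_eq_setD[OF that(1)] mset_eq_setD[OF that(2)] unfolding Phi_choice_def by simp
  let ?h = "homologous (Phi_rank X) (Phi_degree X)"
  have "(Phi X T o\<^sub>1 o\<^sub>2, Phi X T o\<^sub>1' o\<^sub>2) \<in> ?h"
  proof (rule adjacent_swaps[where R = "\<lambda>p q. (Phi X T p o\<^sub>2, Phi X T q o\<^sub>2) \<in> ?h", OF ms(1)])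
    show "(Phi X T zs o\<^sub>2, Phi X T zs o\<^sub>2) \<in> ?h" if "mset zs = mset o\<^sub>1" for zs
      using choice[OF that refl] by (intro homologous_refl Phi_cycle)
    show "(Phi X T (us @ x # y # vs) o\<^sub>2, Phi X T (us @ y # x # vs) o\<^sub>2) \<in> ?h"
      if "mset (us @ x # y # vs) = mset o\<^sub>1" for us x y vs
      using choice[OF that refl] by (rule homologous_swap_vertices)
  qed (rule homologous_trans)
  moreover have "(Phi X T o\<^sub>1' o\<^sub>2, Phi X T o\<^sub>1' o\<^sub>2') \<in> ?h"
  proof (rule adjacent_swaps[where R = "\<lambda>p q. (Phi X T o\<^sub>1' p, Phi X T o\<^sub>1' q) \<in> ?h", OF ms(2)])
    show "(Phi X T o\<^sub>1' zs, Phi X T o\<^sub>1' zs) \<in> ?h" if "mset zs = mset o\<^sub>2" for zs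
      using choice[OF ms(1)[symmetric] that] by (intro homologous_refl Phi_cycle)
    show "(Phi X T o\<^sub>1' (us @ x # y # vs), Phi X T o\<^sub>1' (us @ y # x # vs)) \<in> ?h"
      if "mset (us @ x # y # vs) = mset o\<^sub>2" for us x y vs
      using choice[OF ms(1)[symmetric] that] by (rule homologous_swap_edges)
  qed (rule homologous_trans)
  ultimately show ?thesis by (rule homologous_trans)
qed

text \<open>Collapsing in two steps changes only what the vertices are called: half-edges meet under
  the same condition in both graphs.\<close>

lemma gen_collapse_tree_edge:
  assumes F: "insert f F \<subseteq> edges X" "forest X (insert f F)" and f: "f \<notin> F" and \<iota>: "\<iota> \<in> I"
    and bs: "distinct (concat bs)" "set (concat bs) = Inl ` (edges X - insert f F) \<union> polys"
  shows "gen (block_graph (collapse (Q F \<iota>) {Inl f}) bs) = gen (block_graph (Q (insert f F) \<iota>) bs)"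
proof (rule gen_block_graph_cong)
  have F': "F \<subseteq> edges X" "forest X F" using F forest_subset[OF F(2)] by auto
  let ?H = "collapse (Q F \<iota>) {Inl f}" and ?G = "Q (insert f F) \<iota>"
  show "verts ?G = {ends ?G e b | e b. e \<in> edges ?G}"
    using wf_Q[OF F \<iota>] valence_Q[OF F \<iota>] by (rule verts_eq_ends)
  show "verts ?H = {ends ?H e b | e b. e \<in> edges ?H}"
    using wf_Q[OF F' \<iota>] valence_Q[OF F' \<iota>] by (rule verts_collapse_eq_ends)
  show "edges ?H = edges ?G"
    unfolding collapse_def[of "Q F \<iota>"] by (auto simp: edges_Q)
  show "wf_graph ?G" using F \<iota> by (rule wf_Q)
  have "Inl ` F \<union> {Inl f} = Inl ` insert f F" by auto
  then show "ends ?H x b = ends ?H y c \<longleftrightarrow> ends ?G x b = ends ?G y c" for x b y c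
    unfolding ends_collapse_eq_iff Q_joined_iff Q_ends_eq_iff by simp
qed (use bs in \<open>simp_all add: edges_Q\<close>)

text \<open>Placing \<open>e\<close> and \<open>f\<close> directly after the polygons has two
  effects. The preceding stage joins the ends of neither edge, so both can be collapsed and neither
  can be inserted alone; and they are neighbours in the edge ordering, so their collapses get
  opposite signs. This is why the exchanged edge stands first in both orderings.\<close>

lemma homologous_exchange:
  assumes c: "Phi_choice X T o\<^sub>1 (e # os)" and f: "f \<in> T"
    and nj: "(ends X e False, ends X e True) \<notin> joined X (T - {f})"
  defines "T' \<equiv> insert e (T - {f})"
  shows "Phi_choice X T' o\<^sub>1 (f # os)"
    and "(Phi X T o\<^sub>1 (e # os), Phi X T' o\<^sub>1 (f # os)) \<in> homologous (Phi_rank X) (Phi_degree X)"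
proof -
  have T: "maximal_tree X T" and os: "distinct (e # os)" "insert e (set os) = edges X - T"
    and o1: "distinct o\<^sub>1" "set o\<^sub>1 = typeA X"
    using c unfolding Phi_choice_def by auto
  have e: "e \<in> edges X" "e \<notin> T" using os(2) by auto
  have T': "maximal_tree X T'"
    unfolding T'_def using exchange_tree[OF T f e nj wf_X] .
  have fe: "f \<noteq> e" "f \<in> edges X" "f \<notin> set os" using f e(2) os(2) tree_facts(1)[OF T] by auto
  have eos: "e \<notin> set os" "set os \<subseteq> edges X" using os by auto
  show c': "Phi_choice X T' o\<^sub>1 (f # os)"
    using T' os o1 fe eos f unfolding Phi_choice_def T'_def by auto
  define F where "F = T - {f}"
  have FT: "F \<subseteq> T" "F \<subseteq> T'" "insert f F = T" "insert e F = T'" "f \<notin> F" "e \<notin> F"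
    using f e(2) unfolding F_def T'_def by auto
  have F: "F \<subseteq> edges X" "forest X F"
    using tree_facts(1,2)[OF T] forest_subset FT(1) by blast+
  let ?g = "singles o\<^sub>1" and ?h = "[e, f] # singles os"
  let ?P = "map (polygon X) o\<^sub>1" and ?R = "map (\<lambda>d. [Inl d]) os :: ('e + 'v \<times> nat) list list"
  have bs: "blocks ?g ?h = ?P @ [Inl e, Inl f] # ?R"
    unfolding blocks_def by (simp add: comp_def)
  have EF: "edges X - F = insert e (insert f (set os))"
    using os(2) f fe e(1) tree_facts(1)[OF T] unfolding F_def by auto
  have g: "grouping F ?g ?h"
    using o1 os(1) fe unfolding grouping_def EF by auto
  have sepf: "(ends X f False, ends X f True) \<notin> joined X F"
    using T f unfolding maximal_tree_def separating_edge_def F_def by blast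
  have br: "bridgeless F ?h"
    unfolding bridgeless_def
  proof (intro allI impI ballI)
    fix h1 h2 d assume h: "?h = h1 @ h2" and d: "d \<in> set (concat h1)"
    then obtain h1' where h1: "h1 = [e, f] # h1'" by (cases h1) auto
    have "d \<in> set (concat (h1 @ h2))" using d by simp
    then have dE: "d \<in> edges X" unfolding h[symmetric] using e fe eos(2) by auto
    \<comment> \<open>Without \<open>f\<close> the stage still contains \<open>e\<close> and, with
      \<open>F\<close>, the tree \<open>T'\<close>; if any other edge is removed, it contains
      \<open>T\<close>.\<close>
    show "(ends X d False, ends X d True) \<in> joined X (F \<union> (set (concat h1) - {d}))"
    proof (cases "d = f")
      case True
      then have "T' \<subseteq> F \<union> (set (concat h1) - {d})" using fe FT h1 by auto
      then show ?thesis by (rule tree_facts(3)[OF T' dE])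
    next
      case False
      have "T \<subseteq> F \<union> (set (concat h1) - {d})" using False FT h1 by auto
      then show ?thesis by (rule tree_facts(3)[OF T dE])
    qed
  qed
  have U: "set (concat ?P) = polys"
    unfolding set_concat_polygons polys_eq o1(2) ..
  have nsep: "(ends (Q F \<iota>) (Inl d) False, ends (Q F \<iota>) (Inl d) True) \<notin> joined (Q F \<iota>) polys"
    if d: "d = e \<or> d = f" for d \<iota>
  proof
    assume "(ends (Q F \<iota>) (Inl d) False, ends (Q F \<iota>) (Inl d) True) \<in> joined (Q F \<iota>) polys"
    then have "(ends X d False, ends X d True) \<in> joined X (Inl -` (Inl ` F \<union> polys))"
      unfolding Q_joined_iff by (auto dest: proj_joined)
    moreover have "Inl -` (Inl ` F \<union> polys) = F" by auto
    ultimately show False using d nj sepf unfolding F_def by auto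
  qed
  have coll: "collapsible (block_graph (Q F \<iota>) (blocks ?g ?h)) (Inl d) \<longleftrightarrow> d \<in> {e, f}"
    if d: "d \<in> edges X - F" for \<iota> d
  proof (cases "d \<in> {e, f}")
    case True
    then show ?thesis
      using collapsible_block_graph[OF decomp_blocks[OF F g, of \<iota>] bs, of "Inl d"] nsep[of d \<iota>] U
      by (auto simp del: set_concat)
  next
    case False
    \<comment> \<open>The remaining edges are blocks of their own, so their collapse would lose a
      stage.\<close>
    then have "d \<in> set os" using d EF by auto
    then obtain os1 os2 where "os = os1 @ d # os2" by (auto dest: split_list)
    then have "blocks ?g ?h = (?P @ [Inl e, Inl f] # map (\<lambda>d. [Inl d]) os1) @ [Inl d] # map (\<lambda>d. [Inl d]) os2"
      unfolding bs by simp
    from collapsible_block_graph[OF decomp_blocks[OF F g, of \<iota>] this, of "Inl d"]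
    show ?thesis using False by simp
  qed
  have bF: "boundary_F (block_graph (Q F \<iota>) (blocks ?g ?h)) = 0" if \<iota>: "\<iota> \<in> I" for \<iota>
  proof -
    have "\<not> insertable (block_graph (Q F \<iota>) (blocks ?g ?h)) C" for C
    proof
      assume "insertable (block_graph (Q F \<iota>) (blocks ?g ?h)) C"
      then show False
      proof (cases rule: insertable_blocks[OF T FT(1) g \<iota>, consumes 1, case_names poly edge])
        case (poly g1 ss g2 W)
        then show False using split_singles by metis
      next
        case (edge h1 es h2 W)
        have "singles [] @ [e, f] # singles os = h1 @ es # h2" using edge(1) by simp
        note s = split_singles_pair[OF this edge(2,3)]
        obtain d where d: "d = e \<or> d = f" "W = {d}" using s(2) by auto
        \<comment> \<open>A stage with only one of the two edges would have that edge as a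
          bridge.\<close>
        have C: "C = polys \<union> {Inl d}" unfolding edge(4) s(1) d(2) by simp
        then have "C - {Inl d} = polys" by auto
        then show False
          using edge(5) nsep[OF d(1), of \<iota>] C unfolding core_def separating_edge_def by auto
      qed
    qed
    then show ?thesis unfolding boundary_F_def by (intro sum.neutral) blast
  qed
  \<comment> \<open>This is the exponent at \<open>e\<close>: the \<open>Suc\<close> from counting
    positions cancels the \<open>- 1\<close> in \<open>boundary_E\<close>. At \<open>f\<close> the
    exponent is larger by one.\<close>
  define k where "k = length (concat ?P) + length (blocks ?g ?h)"
  have pos: "position (Inl e) (concat (blocks ?g ?h)) = Suc (length (concat ?P))"
    "position (Inl f) (concat (blocks ?g ?h)) = Suc (Suc (length (concat ?P)))"
  proof -
    have ni: "Inl d \<notin> set (concat ?P)" for d unfolding U by auto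
    have "takeWhile (\<lambda>y. y \<noteq> Inl d) (concat ?P @ zs) = concat ?P @ takeWhile (\<lambda>y. y \<noteq> Inl d) zs" for d zs
      using ni[of d] by (intro takeWhile_append2) auto
    then show "position (Inl e) (concat (blocks ?g ?h)) = Suc (length (concat ?P))"
      "position (Inl f) (concat (blocks ?g ?h)) = Suc (Suc (length (concat ?P)))"
      unfolding bs position_def using fe(1) by (simp_all del: length_concat)
  qed
  have coe: "gen (collapse_edge (block_graph (Q F \<iota>) (blocks ?g ?h)) (Inl f)) =
      gen (block_graph (Q T \<iota>) (blocks ?g (singles (e # os))))"
    "gen (collapse_edge (block_graph (Q F \<iota>) (blocks ?g ?h)) (Inl e)) =
      gen (block_graph (Q T' \<iota>) (blocks ?g (singles (f # os))))" if \<iota>: "\<iota> \<in> I" for \<iota>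
  proof -
    have P: "map (filter (\<lambda>x. x \<noteq> Inl d)) ?P = ?P" for d
      by (auto simp: set_polygon intro!: map_idI filter_True)
    have R: "map (filter (\<lambda>x. x \<noteq> Inl d)) ?R = ?R" if "d \<notin> set os" for d
      using that by auto
    have 1: "map (filter (\<lambda>x. x \<noteq> Inl f)) (blocks ?g ?h) = blocks ?g (singles (e # os))"
      unfolding bs map_append list.map P R[OF fe(3)] using fe(1) by (simp add: blocks_def comp_def)
    have 2: "map (filter (\<lambda>x. x \<noteq> Inl e)) (blocks ?g ?h) = blocks ?g (singles (f # os))"
      unfolding bs map_append list.map P R[OF eos(1)] using fe(1) by (simp add: blocks_def comp_def)
    note gT = choice_grouping[OF c] and gT' = choice_grouping[OF c']
    show "gen (collapse_edge (block_graph (Q F \<iota>) (blocks ?g ?h)) (Inl f)) =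
        gen (block_graph (Q T \<iota>) (blocks ?g (singles (e # os))))"
      using gen_collapse_tree_edge[of f F, unfolded FT(3), OF tree_facts(1,2)[OF T] FT(5) \<iota>
          distinct_blocks[OF gT] set_blocks[OF gT]]
      unfolding collapse_edge_block_graph 1 .
    show "gen (collapse_edge (block_graph (Q F \<iota>) (blocks ?g ?h)) (Inl e)) =
        gen (block_graph (Q T' \<iota>) (blocks ?g (singles (f # os))))"
      using gen_collapse_tree_edge[of e F, unfolded FT(4), OF tree_facts(1,2)[OF T'] FT(6) \<iota>
          distinct_blocks[OF gT'] set_blocks[OF gT']]
      unfolding collapse_edge_block_graph 2 .
  qed
  have "boundary (chain F ?g ?h) = (\<Sum>\<iota>\<in>I. of_int (attachments_sign \<iota>) *\<^sub>Q
      (boundary_F (block_graph (Q F \<iota>) (blocks ?g ?h)) +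
       (\<Sum>d\<in>{e, f}. (-1) ^ (position (Inl d) (concat (blocks ?g ?h)) + length (blocks ?g ?h) - 1) *\<^sub>Q
          gen (collapse_edge (block_graph (Q F \<iota>) (blocks ?g ?h)) (Inl d)))))"
    unfolding chain_def
    using collapsible_polygon_edge[OF T FT(1) g] coll EF
    by (intro boundary_sum_attachments[OF F blocks_nonempty[OF F g] blocks_Nil[OF g] distinct_blocks[OF g]
          set_blocks[OF g]]) auto
  also have "\<dots> = (\<Sum>\<iota>\<in>I. of_int (attachments_sign \<iota>) *\<^sub>Q (-1) ^ k *\<^sub>Q
      (gen (block_graph (Q T' \<iota>) (blocks ?g (singles (f # os)))) -
       gen (block_graph (Q T \<iota>) (blocks ?g (singles (e # os))))))"
  proof (intro sum.cong refl arg_cong[where f = "qscale _"])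
    fix \<iota> assume \<iota>: "\<iota> \<in> I"
    show "boundary_F (block_graph (Q F \<iota>) (blocks ?g ?h)) +
       (\<Sum>d\<in>{e, f}. (-1) ^ (position (Inl d) (concat (blocks ?g ?h)) + length (blocks ?g ?h) - 1) *\<^sub>Q
          gen (collapse_edge (block_graph (Q F \<iota>) (blocks ?g ?h)) (Inl d))) =
      (-1) ^ k *\<^sub>Q (gen (block_graph (Q T' \<iota>) (blocks ?g (singles (f # os)))) -
       gen (block_graph (Q T \<iota>) (blocks ?g (singles (e # os)))))"
      using fe(1) by (simp only: bF[OF \<iota>] coe[OF \<iota>] pos sum.insert[OF _ _] finite.intros)
        (simp add: k_def pos coe[OF \<iota>] bchain.scale_right_diff_distrib bchain.scale_minus_left del: length_concat)
  qed
  also have "\<dots> = (-1) ^ k *\<^sub>Q (Phi X T' o\<^sub>1 (f # os) - Phi X T o\<^sub>1 (e # os))"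
    unfolding Phi_eq_chain chain_def by (rule scale_sum_diff)
  finally have "Phi X T o\<^sub>1 (e # os) - Phi X T' o\<^sub>1 (f # os) = (- ((-1) ^ k)) *\<^sub>Q boundary (chain F ?g ?h)"
    by (simp add: bchain.scale_minus_left flip: power_mult_distrib)
  moreover have "chain F ?g ?h \<in> chains (Phi_rank X) (Phi_degree X + 1)"
  proof (rule chain_in_chains[OF F g br])
    \<comment> \<open>There is one edge more than for \<open>T\<close>, but the number of blocks is
      the same since \<open>e\<close> and \<open>f\<close> share one; so the degree goes up by
      one.\<close>
    have "card (edges X - F) = Suc (Suc (length os))"
      unfolding EF using fe(1,3) eos(1) os(1) by (simp add: distinct_card)
    then show "Phi_degree X + 1 = int (card (edges X - F)) + (\<Sum>s\<in>typeA X. int (val s)) -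
        int (length ?g + length ?h)"
      unfolding Phi_degree_def using length_choice(1)[OF c] by (simp add: sum_subtractf)
  qed
  then have "boundary (chain F ?g ?h) \<in> boundaries (Phi_rank X) (Phi_degree X)"
    unfolding boundaries_def by (rule imageI)
  ultimately have "Phi X T o\<^sub>1 (e # os) - Phi X T' o\<^sub>1 (f # os) \<in> boundaries (Phi_rank X) (Phi_degree X)"
    by (simp only: boundaries_scale)
  then show "(Phi X T o\<^sub>1 (e # os), Phi X T' o\<^sub>1 (f # os)) \<in> homologous (Phi_rank X) (Phi_degree X)"
    using Phi_cycle[OF c] Phi_cycle[OF c'] unfolding homologous_def by simp
qed

text \<open>Each exchange brings an edge of \<open>T'\<close> into the tree and gives up one outside
  \<open>T'\<close>, so \<open>card (T' - T)\<close> drops. Beforehand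
  \<open>homologous_reorder\<close> moves the entering edge to the front; at the end it adjusts the
  orderings.\<close>

lemma homologous_choices:
  assumes c: "Phi_choice X T o\<^sub>1 o\<^sub>2" and c': "Phi_choice X T' o\<^sub>1' o\<^sub>2'"
  shows "(Phi X T o\<^sub>1 o\<^sub>2, Phi X T' o\<^sub>1' o\<^sub>2') \<in> homologous (Phi_rank X) (Phi_degree X)"
  using c
proof (induction "card (T' - T)" arbitrary: T o\<^sub>1 o\<^sub>2 rule: less_induct)
  case less
  show ?case
  proof (cases "T = T'")
    case True
    then show ?thesis using homologous_reorder less.prems c' by blast
  next
    case False
    have T: "maximal_tree X T" and T': "maximal_tree X T'"
      using less.prems c' unfolding Phi_choice_def by auto
    obtain e f where ef: "f \<in> T" "f \<notin> T'" "e \<in> T'" "e \<notin> T"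
      "(ends X e False, ends X e True) \<notin> joined X (T - {f})"
      using tree_exchange_exists[OF T T' False wf_X] .
    have "e \<in> set o\<^sub>2" using ef(3,4) less.prems tree_facts(1)[OF T'] unfolding Phi_choice_def by auto
    define os where "os = remove1 e o\<^sub>2"
    have c1: "Phi_choice X T o\<^sub>1 (e # os)"
      using less.prems \<open>e \<in> set o\<^sub>2\<close> unfolding Phi_choice_def os_def by auto
    let ?T = "insert e (T - {f})"
    note ex = homologous_exchange[OF c1 ef(1,5)]
    have "T' - ?T \<subset> T' - T" using ef by blast
    moreover have "finite (T' - T)" using tree_facts(1)[OF T'] fin_X(2) finite_subset by blast
    ultimately have "card (T' - ?T) < card (T' - T)" by (rule psubset_card_mono[rotated])
    from less.hyps[OF this ex(1)] ex(2) homologous_reorder[OF less.prems c1]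
    show ?thesis by (blast intro: homologous_trans)
  qed
qed

end

theorem proposition7p5:
  fixes X :: "('v, 'e) abgraph"
  assumes "oriented_odd_AB_graph X"
    and "Phi_choice X T o\<^sub>1 o\<^sub>2"
    and "Phi_choice X T' o\<^sub>1' o\<^sub>2'"
  shows "homology_class (Phi_rank X) (Phi_degree X) (Phi X T o\<^sub>1 o\<^sub>2)
           \<in> homology (Phi_rank X) (Phi_degree X) \<and>
         homology_class (Phi_rank X) (Phi_degree X) (Phi X T o\<^sub>1 o\<^sub>2) =
         homology_class (Phi_rank X) (Phi_degree X) (Phi X T' o\<^sub>1' o\<^sub>2')"
proof
  interpret odd_AB X using assms(1) by unfold_locales
  show "homology_class (Phi_rank X) (Phi_degree X) (Phi X T o\<^sub>1 o\<^sub>2) \<in> homology (Phi_rank X) (Phi_degree X)"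
    unfolding homology_def homology_class_def using Phi_cycle[OF assms(2)] by (rule quotientI)
  show "homology_class (Phi_rank X) (Phi_degree X) (Phi X T o\<^sub>1 o\<^sub>2) =
      homology_class (Phi_rank X) (Phi_degree X) (Phi X T' o\<^sub>1' o\<^sub>2')"
    using homologous_choices[OF assms(2,3)] by (rule homology_class_eqI)
qed

end
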